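(* Let $N\ge 1$, $x=(x_1,\dots,x_N)\in\mathbb{W}_N$, $\mu=(\mu_1,\dots,\mu_N)\in\mathbb{W}_N$ and $\delta\ge 2$, and put $\nu=\frac{\delta}{2}-1$. Consider independent diffusions $\mathrm{BESQ}_{\mu_1/2}(\delta),\dots,\mathrm{BESQ}_{\mu_N/2}(\delta)$ started from $x_1,\dots,x_N$ respectively and conditioned to never intersect. Then the transition density, with respect to Lebesgue measure on $\mathbb{W}_N$, of the conditioned process is $$q_t^{(\nu),N,\mu}(x,y)=e^{-\frac{1}{2}\sum_{i=1}^N\mu_i t}\,\frac{\det\left(\phi^{(\nu)}_{\mu_i/2}(y_j)\right)_{i,j=1}^N}{\det\left(\phi^{(\nu)}_{\mu_i/2}(x_j)\right)_{i,j=1}^N}\,\det\left(q_t^{(\nu)}(x_i,y_j)\right)_{i,j=1}^N,\qquad t>0,\ x,y\in\mathbb{W}_N .$$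
   Context: $\mathbb{W}_N=\{x\in(0,\infty)^N:x_1<\dots<x_N\}$; $I_\nu$ is the modified Bessel function of the first kind; $$q_t^{(\nu)}(x,y)=\frac{1}{2t}\left(\frac{y}{x}\right)^{\nu/2}e^{-\frac{x+y}{2t}}I_\nu\!\left(\frac{\sqrt{xy}}{t}\right),\qquad \phi_{\lambda}^{(\nu)}(x)=(2\lambda x)^{-\nu/2}I_{\nu}\!\left(\sqrt{2\lambda x}\right).$$ For $\delta\ge2$, $\nu=\frac\delta2-1$ and $\lambda>0$, the $\mathrm{BESQ}_\lambda(\delta)$ process is the unique strong solution in $(0,\infty)$ of $$d\mathsf{x}(t)=2\sqrt{\mathsf{x}(t)}\,d\mathsf{w}(t)+\left[2(\nu+1)+2\sqrt{2\lambda\mathsf{x}(t)}\,\frac{I_{\nu+1}(\sqrt{2\lambda\mathsf{x}(t)})}{I_{\nu}(\sqrt{2\lambda\mathsf{x}(t)})}\right]dt,$$ $\mathsf{w}$ a standard Brownian motion; equivalently it is the Doob $h$-transform of the squared Bessel process of dimension $\delta$ (transition density $q^{(\nu)}_t$) by $\phi^{(\nu)}_\lambda$, with transition density $e^{-\lambda t}\frac{\phi_\lambda^{(\nu)}(y)}{\phi_\lambda^{(\nu)}(x)}q_t^{(\nu)}(x,y)$. "Conditioned to never intersect" means conditioned on the (positive probability) event $\{\tau_C=\infty\}$, where $\tau_C$ is the first time the vector of the $N$ independent diffusions exits $\mathbb{W}_N$. *)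

theory Defs
  imports "HOL-Probability.Probability"
begin

(* Modified Bessel function of the first kind of order \<nu>, on z > 0. The value at z = 0 is not
   meaningful for \<nu> = 0, because 0 powr 0 = 0; only positive arguments occur below. *)
definition bessel_I :: "real \<Rightarrow> real \<Rightarrow> real" where
  "bessel_I \<nu> z = (\<Sum>k. (z / 2) powr (2 * real k + \<nu>) / (fact k * Gamma (real k + \<nu> + 1)))"

definition besq_q :: "real \<Rightarrow> real \<Rightarrow> real \<Rightarrow> real \<Rightarrow> real" where
  "besq_q \<nu> t x y =
     1 / (2 * t) * (y / x) powr (\<nu> / 2) * exp (- (x + y) / (2 * t)) * bessel_I \<nu> (sqrt (x * y) / t)"

definition besq_phi :: "real \<Rightarrow> real \<Rightarrow> real \<Rightarrow> real" where
  "besq_phi \<nu> l x = (2 * l * x) powr (- \<nu> / 2) * bessel_I \<nu> (sqrt (2 * l * x))"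

definition doob_transform ::
  "real \<Rightarrow> ('b \<Rightarrow> real) \<Rightarrow> (real \<Rightarrow> 'b \<Rightarrow> 'b \<Rightarrow> real) \<Rightarrow> real \<Rightarrow> 'b \<Rightarrow> 'b \<Rightarrow> real" where
  "doob_transform l h p t x y = exp (- l * t) * (h y / h x) * p t x y"

definition natural_filtration ::
  "'w measure \<Rightarrow> (real \<Rightarrow> 'w \<Rightarrow> 'b::topological_space) \<Rightarrow> real \<Rightarrow> 'w measure" where
  "natural_filtration M X s =
     sigma (space M) {X r -` A \<inter> space M | r A. 0 \<le> r \<and> r \<le> s \<and> A \<in> sets borel}"

(* X, started from x, is a time-homogeneous Markov process with state space S, whose transition
   density with respect to Lebesgue measure on S is p. Taking s = 0 gives the law of X t as the
   measure on S with density p t x; taking A = UNIV forces X t into S almost surely. *)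
definition markov_with_transition_density ::
  "'w measure \<Rightarrow> 'b::euclidean_space set \<Rightarrow> (real \<Rightarrow> 'b \<Rightarrow> 'b \<Rightarrow> real) \<Rightarrow> 'b
     \<Rightarrow> (real \<Rightarrow> 'w \<Rightarrow> 'b) \<Rightarrow> bool" where
  "markov_with_transition_density M S p x X \<longleftrightarrow>
     prob_space M \<and>
     (\<forall>t\<ge>0. X t \<in> borel_measurable M) \<and>
     (AE \<omega> in M. X 0 \<omega> = x) \<and>
     (\<forall>s t A. 0 \<le> s \<and> s < t \<and> A \<in> sets borel \<longrightarrow>
        (AE \<omega> in M. real_cond_exp M (natural_filtration M X s) (\<lambda>\<omega>. indicator A (X t \<omega>)) \<omega>
                     = (LINT y:A \<inter> S|lborel. p (t - s) (X s \<omega>) y)))"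

(* The BESQ_l(\<delta>) diffusion started from x: a process with continuous paths in the open
   half-line which is the Doob h-transform, with h = \<phi>_l, of the squared Bessel process of
   dimension \<delta>. *)
definition besq_diffusion ::
  "'w measure \<Rightarrow> real \<Rightarrow> real \<Rightarrow> real \<Rightarrow> (real \<Rightarrow> 'w \<Rightarrow> real) \<Rightarrow> bool" where
  "besq_diffusion M l \<delta> x X \<longleftrightarrow>
     (\<forall>\<omega>\<in>space M. continuous_on {0..} (\<lambda>t. X t \<omega>) \<and> (\<forall>t\<ge>0. 0 < X t \<omega>)) \<and>
     (let \<nu> = \<delta> / 2 - 1 in
        markov_with_transition_density M {0<..}
          (doob_transform l (besq_phi \<nu> l) (besq_q \<nu>)) x X)"

(* Independence of whole paths, as random elements of the product space over the times t \<ge> 0. *)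
definition independent_processes ::
  "'w measure \<Rightarrow> ('i \<Rightarrow> real \<Rightarrow> 'w \<Rightarrow> real) \<Rightarrow> bool" where
  "independent_processes M X \<longleftrightarrow>
     prob_space.indep_vars M (\<lambda>i. PiM {0..} (\<lambda>t. borel)) (\<lambda>i \<omega>. \<lambda>t\<in>{0..}. X i t \<omega>) UNIV"

(* The index type 'n plays the role of {1,...,N}, with N = CARD('n) and its order the order
   of the particles. *)
definition weyl_chamber :: "(real ^ 'n::{finite,linorder}) set" where
  "weyl_chamber = {x. (\<forall>i. 0 < x $ i) \<and> (\<forall>i j. i < j \<longrightarrow> x $ i < x $ j)}"

definition exit_time :: "'b set \<Rightarrow> (real \<Rightarrow> 'w \<Rightarrow> 'b) \<Rightarrow> 'w \<Rightarrow> ereal" where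
  "exit_time C X \<omega> = (INF t\<in>{t. 0 \<le> t \<and> X t \<omega> \<notin> C}. ereal t)"

definition conditioned_besq_density ::
  "real \<Rightarrow> real ^ 'n \<Rightarrow> real \<Rightarrow> real ^ 'n \<Rightarrow> real ^ 'n \<Rightarrow> real" where
  "conditioned_besq_density \<nu> \<mu> t x y =
     exp (- (1 / 2) * (\<Sum>i\<in>UNIV. \<mu> $ i * t))
     * (det (\<chi> i j. besq_phi \<nu> (\<mu> $ i / 2) (y $ j)) / det (\<chi> i j. besq_phi \<nu> (\<mu> $ i / 2) (x $ j)))
     * det (\<chi> i j. besq_q \<nu> t (x $ i) (y $ j))"

end

theory Submission
  imports Defs "HOL-Real_Asymp.Real_Asymp"
begin

text \<open>The independent particles have joint transition density \<open>\<Prod>\<^sub>i e\<^bsup>-\<mu>\<^sub>i t/2\<^esup> \<phi>\<^sub>i(z\<^sub>i) / \<phi>\<^sub>i(y\<^sub>i) q\<^sub>t(y\<^sub>i, z\<^sub>i)\<close>.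
  Replacing \<open>\<Prod>\<^sub>i q\<^sub>t(y\<^sub>i, z\<^sub>i)\<close> by the determinant of \<open>q\<^sub>t(y\<^sub>i, z\<^sub>j)\<close> gives, for fixed \<open>z\<close> and terminal time, a
  bounded continuous martingale along the particles which vanishes when two of them meet. Stopping it at the first
  collision and letting time approach the terminal time, where only the identity permutation
  contributes inside the chamber, shows that this determinant is the transition density of the killed process. Since the
  \<open>i\<close>-th particle grows like \<open>\<mu>\<^sub>i t\<^sup>2\<close>, integrating it over the chamber and letting \<open>t \<rightarrow> \<infinity>\<close> yields
  \<open>h(y) = det(\<phi>\<^sub>i(y\<^sub>j)) / \<Prod>\<^sub>i \<phi>\<^sub>i(y\<^sub>i)\<close> for the probability of never colliding. As a probability \<open>h\<close> is nonnegative,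
  and it does not vanish because the \<open>\<phi>\<^sub>i\<close> form a Chebyshev system. Conditioning is therefore the
  Doob transform of the killed process by \<open>h\<close>, in which the factors \<open>\<phi>\<^sub>i(z\<^sub>i) / \<phi>\<^sub>i(y\<^sub>i)\<close> cancel.\<close>

section \<open>The Bessel series and its Weber integral\<close>

text \<open>One reading of the \<open>\<sigma>\<close>-term of the determinant underlies everything:
  after the weights are reindexed along \<open>\<sigma>\<close>, it is a positive factor
  \<open>bessel_ratio\<close> times a probability density under which coordinate \<open>i\<close> of
  the endpoint has weight \<open>a i\<close>, whatever \<open>\<sigma>\<close> is. So every term,
  not only that of the identity, eventually puts its whole mass into the chamber, and the limit is
  the signed sum of the factors. Two obstacles shape the rest. Neither a bound nor the sign of
  \<open>h\<close> along the paths is available, so limits are dominated by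
  \<open>ratio_sum\<close>, the same sum without signs; its mean is finite at every time because
  each summand is harmonic. And the determinant degenerates at the terminal time, so stopping is
  done strictly before it, and the passage to the limit is made on sets where the square roots of
  the coordinates keep a fixed distance. \<open>bessel_series\<close> replaces the Bessel function
  because it is a power series converging everywhere, bounded below by
  \<open>1 / Gamma (\<nu> + 1)\<close> on the half-line, and free of real powers at 0.\<close>

definition bessel_series :: "real \<Rightarrow> real \<Rightarrow> real" where
  "bessel_series \<nu> w = (\<Sum>k. w ^ k / (fact k * Gamma (real k + \<nu> + 1)))"

text \<open>The quotient of the two Gamma values is \<open>(\<nu> + 1) ... (\<nu> + k)\<close>, and
  each factor \<open>\<nu> + j\<close> is at least \<open>j\<close>.\<close>

lemma fact_mult_Gamma_le:
  assumes "0 \<le> \<nu>"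
  shows "fact k * Gamma (\<nu> + 1) \<le> Gamma (real k + \<nu> + 1)"
proof (induction k)
  case (Suc k)
  have "Gamma (real (Suc k) + \<nu> + 1) = (real k + \<nu> + 1) * Gamma (real k + \<nu> + 1)"
    using Gamma_plus1[of "real k + \<nu> + 1"] assms by (auto simp: nonpos_Ints_def add_ac)
  moreover have "(real k + 1) * (fact k * Gamma (\<nu> + 1)) \<le> (real k + \<nu> + 1) * Gamma (real k + \<nu> + 1)"
    using Suc assms by (intro mult_mono) (auto intro!: Gamma_real_nonneg)
  ultimately show ?case by (simp add: algebra_simps)
qed simp

text \<open>Through \<open>fact_mult_Gamma_le\<close> the terms are compared with the squared terms
  of the exponential series of \<open>sqrt w\<close>.\<close>

lemma bessel_coeff_le:
  assumes "0 \<le> \<nu>" "0 \<le> w"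
  shows "w ^ k / (fact k * Gamma (real k + \<nu> + 1)) \<le> (sqrt w ^ k / fact k)\<^sup>2 / Gamma (\<nu> + 1)"
proof -
  have "0 < Gamma (\<nu> + 1)" using assms by (intro Gamma_real_pos) auto
  moreover have "(sqrt w ^ k)\<^sup>2 = w ^ k"
    using assms by (metis power2_eq_square power_mult_distrib real_sqrt_mult_self abs_of_nonneg)
  moreover have "w ^ k / (fact k * Gamma (real k + \<nu> + 1)) \<le> w ^ k / (fact k * (fact k * Gamma (\<nu> + 1)))"
    using assms \<open>0 < Gamma (\<nu> + 1)\<close>
    by (intro divide_left_mono mult_left_mono fact_mult_Gamma_le mult_pos_pos Gamma_real_pos) auto
  ultimately show ?thesis by (simp add: power_divide power2_eq_square mult_ac)
qed

lemma sum_squares_le_square_sum: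
  fixes f :: "nat \<Rightarrow> real"
  assumes "\<And>k. 0 \<le> f k"
  shows "(\<Sum>k<n. (f k)\<^sup>2) \<le> (\<Sum>k<n. f k)\<^sup>2"
proof (induction n)
  case (Suc n)
  have "0 \<le> f n * (\<Sum>k<n. f k)" using assms by (intro mult_nonneg_nonneg sum_nonneg) auto
  then show ?case using Suc by (simp add: power2_eq_square algebra_simps)
qed simp

text \<open>A sum of squares of nonnegative terms is at most the square of their sum, and that sum
  is at most \<open>exp (sqrt w)\<close>. The rate \<open>2 * sqrt w\<close> is the true growth rate
  of the series, and it is what lets the Gaussian estimates below complete a square.\<close>

lemma bessel_partial_sum_le:
  assumes "0 \<le> \<nu>" "0 \<le> w"
  shows "(\<Sum>k<n. w ^ k / (fact k * Gamma (real k + \<nu> + 1))) \<le> exp (2 * sqrt w) / Gamma (\<nu> + 1)"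
proof -
  have G: "0 < Gamma (\<nu> + 1)" using assms by (intro Gamma_real_pos) auto
  have "(\<Sum>k<n. sqrt w ^ k / fact k) \<le> exp (sqrt w)"
    using exp_converges[of "sqrt w"] assms
    by (intro sum_le_suminf[where f = "\<lambda>k. sqrt w ^ k / fact k", THEN order_trans])
       (auto simp: sums_iff divide_inverse mult_ac)
  then have "(\<Sum>k<n. sqrt w ^ k / fact k)\<^sup>2 \<le> (exp (sqrt w))\<^sup>2"
    using assms by (intro power_mono sum_nonneg) auto
  moreover have "(\<Sum>k<n. (sqrt w ^ k / fact k)\<^sup>2) \<le> (\<Sum>k<n. sqrt w ^ k / fact k)\<^sup>2"
    using assms by (intro sum_squares_le_square_sum) auto
  ultimately have "(\<Sum>k<n. (sqrt w ^ k / fact k)\<^sup>2) \<le> exp (2 * sqrt w)"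
    by (simp add: exp_double)
  moreover have "(\<Sum>k<n. w ^ k / (fact k * Gamma (real k + \<nu> + 1)))
      \<le> (\<Sum>k<n. (sqrt w ^ k / fact k)\<^sup>2) / Gamma (\<nu> + 1)"
    unfolding sum_divide_distrib by (intro sum_mono bessel_coeff_le assms)
  ultimately show ?thesis using G by (meson divide_right_mono less_imp_le order_trans)
qed

lemma summable_bessel_abs:
  assumes "0 \<le> \<nu>"
  shows "summable (\<lambda>k. \<bar>w ^ k / (fact k * Gamma (real k + \<nu> + 1))\<bar>)"
proof (rule bounded_imp_summable)
  have Gp: "0 < Gamma (real k + \<nu> + 1)" for k using assms by (intro Gamma_real_pos) auto
  show "(\<Sum>k\<le>n. \<bar>w ^ k / (fact k * Gamma (real k + \<nu> + 1))\<bar>)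
      \<le> exp (2 * sqrt \<bar>w\<bar>) / Gamma (\<nu> + 1)" for n
    using bessel_partial_sum_le[OF assms abs_ge_zero[of w], of "Suc n"] Gp
    by (simp add: lessThan_Suc_atMost abs_mult power_abs abs_of_pos)
qed simp

lemma summable_bessel:
  assumes "0 \<le> \<nu>"
  shows "summable (\<lambda>k. w ^ k / (fact k * Gamma (real k + \<nu> + 1)))"
  using summable_rabs_cancel[OF summable_bessel_abs[OF assms]] by simp

lemma bessel_series_sums:
  assumes "0 \<le> \<nu>"
  shows "(\<lambda>k. w ^ k / (fact k * Gamma (real k + \<nu> + 1))) sums bessel_series \<nu> w"
  unfolding bessel_series_def using summable_bessel[OF assms] by (rule summable_sums)

lemma bessel_series_le:
  assumes "0 \<le> \<nu>" "0 \<le> w"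
  shows "bessel_series \<nu> w \<le> exp (2 * sqrt w) / Gamma (\<nu> + 1)"
  unfolding bessel_series_def
  by (intro suminf_le_const summable_bessel bessel_partial_sum_le assms)

lemma bessel_series_ge:
  assumes "0 \<le> \<nu>" "0 \<le> w"
  shows "1 / Gamma (\<nu> + 1) \<le> bessel_series \<nu> w"
proof -
  have "0 < Gamma (real k + \<nu> + 1)" for k using assms by (intro Gamma_real_pos) auto
  then have "(\<Sum>k<Suc 0. w ^ k / (fact k * Gamma (real k + \<nu> + 1))) \<le> bessel_series \<nu> w"
    unfolding bessel_series_def using assms
    by (intro sum_le_suminf summable_bessel) (auto intro!: divide_nonneg_nonneg less_imp_le)
  then show ?thesis by simp
qed

lemma bessel_series_pos:
  assumes "0 \<le> \<nu>" "0 \<le> w"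
  shows "0 < bessel_series \<nu> w"
proof -
  have "0 < 1 / Gamma (\<nu> + 1)" using assms by (simp add: Gamma_real_pos)
  then show ?thesis using bessel_series_ge[OF assms] by linarith
qed

lemma bessel_series_has_derivative:
  assumes "0 \<le> \<nu>"
  shows "(bessel_series \<nu> has_real_derivative bessel_series (\<nu> + 1) w) (at w)"
proof -
  define c where "c k = 1 / (fact k * Gamma (real k + \<nu> + 1))" for k
  have s: "summable (\<lambda>k. c k * y ^ k)" for y
    using summable_bessel[OF assms, of y] by (simp add: c_def)
  have "diffs c k = 1 / (fact k * Gamma (real k + (\<nu> + 1) + 1))" for k
  proof -
    have "real (Suc k) + \<nu> + 1 = real k + (\<nu> + 1) + 1" by simp
    then show ?thesis by (simp only: diffs_def c_def) (simp add: fact_reduce del: of_nat_Suc)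
  qed
  moreover have "(\<Sum>k. c k * x ^ k) = bessel_series \<nu> x" for x
    by (simp add: bessel_series_def c_def)
  ultimately show ?thesis
    using termdiffs_strong_converges_everywhere[of c w, OF s] by (simp add: bessel_series_def[abs_def])
qed

text \<open>Since differentiation raises the order by one, this is the equation
  \<open>w F'' + (\<nu> + 1) F' = F\<close>. Coefficientwise it is the functional equation of Gamma
  at \<open>k + \<nu> + 1\<close>.\<close>

lemma bessel_series_ode:
  assumes "0 \<le> \<nu>"
  shows "w * bessel_series (\<nu> + 2) w + (\<nu> + 1) * bessel_series (\<nu> + 1) w = bessel_series \<nu> w"
proof -
  let ?f = "\<lambda>\<nu> k. w ^ k / (fact k * Gamma (real k + \<nu> + 1))"
  have G: "Gamma (real k + \<nu> + 2) = (real k + \<nu> + 1) * Gamma (real k + \<nu> + 1)"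
    "0 < Gamma (real k + \<nu> + 1)" for k
    using Gamma_plus1[of "real k + \<nu> + 1"] assms by (auto simp: nonpos_Ints_def add_ac intro!: Gamma_real_pos)
  have "(\<lambda>k. w * ?f (\<nu> + 2) k) sums (w * bessel_series (\<nu> + 2) w)"
    using assms by (intro sums_mult bessel_series_sums) auto
  moreover have "w * ?f (\<nu> + 2) k = real (Suc k) * ?f (\<nu> + 1) (Suc k)" for k
    by (simp add: add_ac del: of_nat_Suc of_nat_add) (simp add: add_ac)
  ultimately have "(\<lambda>k. real (Suc k) * ?f (\<nu> + 1) (Suc k)) sums (w * bessel_series (\<nu> + 2) w)"
    by simp
  \<comment> \<open>The shifted series lacks the index 0, where the factor \<open>real k\<close>
    vanishes.\<close>
  then have "(\<lambda>k. real k * ?f (\<nu> + 1) k) sums (w * bessel_series (\<nu> + 2) w)"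
    by (subst (asm) sums_Suc_iff) simp
  moreover have "(\<lambda>k. (\<nu> + 1) * ?f (\<nu> + 1) k) sums ((\<nu> + 1) * bessel_series (\<nu> + 1) w)"
    using assms by (intro sums_mult bessel_series_sums) auto
  ultimately have "(\<lambda>k. real k * ?f (\<nu> + 1) k + (\<nu> + 1) * ?f (\<nu> + 1) k)
      sums (w * bessel_series (\<nu> + 2) w + (\<nu> + 1) * bessel_series (\<nu> + 1) w)"
    by (rule sums_add)
  moreover have "real k * ?f (\<nu> + 1) k + (\<nu> + 1) * ?f (\<nu> + 1) k = ?f \<nu> k" for k
  proof -
    have "real k + (\<nu> + 1) + 1 = real k + \<nu> + 2" "real k + \<nu> + 1 \<noteq> 0" using assms by auto
    moreover have "real k * ?f (\<nu> + 1) k + (\<nu> + 1) * ?f (\<nu> + 1) k = (real k + \<nu> + 1) * ?f (\<nu> + 1) k"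
      by (simp only: distrib_right add.assoc)
    ultimately show ?thesis by (simp only: G(1)) simp
  qed
  ultimately show ?thesis
    using bessel_series_sums[OF assms, of w] sums_unique2 by auto
qed

lemma continuous_on_bessel_series:
  assumes "0 \<le> \<nu>" "continuous_on S f"
  shows "continuous_on S (\<lambda>x. bessel_series \<nu> (f x))"
proof -
  have "continuous_on UNIV (bessel_series \<nu>)"
    using bessel_series_has_derivative[OF assms(1)]
    by (meson DERIV_isCont continuous_at_imp_continuous_on)
  then show ?thesis using assms(2) by (rule continuous_on_compose2) auto
qed

lemma borel_measurable_bessel_series [measurable]: "bessel_series \<nu> \<in> borel_measurable borel"
  unfolding bessel_series_def[abs_def] by measurable

section \<open>Weber's integral by termwise integration\<close>

text \<open>Vandermonde's identity for the upper index \<open>j + (k + \<nu>)\<close>. For fixed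
  \<open>k\<close> it writes the quotient as a polynomial in \<open>j\<close>, in the basis
  \<open>j choose m\<close>, which can be summed against \<open>A ^ j / fact j\<close>.\<close>

lemma Gamma_ratio_expand:
  assumes "0 \<le> \<nu>"
  shows "Gamma (real j + real k + \<nu> + 1) / Gamma (real j + \<nu> + 1)
    = (\<Sum>m\<le>k. fact k * real (j choose m) * Gamma (real k + \<nu> + 1) / (fact (k - m) * Gamma (real m + \<nu> + 1)))"
proof -
  have nn: "x \<notin> \<int>\<^sub>\<le>\<^sub>0" if "x > 0" for x :: real
    using that by (auto simp: nonpos_Ints_def)
  have "(\<Sum>m\<in>{0..k}. (real j gchoose m) * ((real k + \<nu>) gchoose (k - m))) = (real j + (real k + \<nu>)) gchoose k"
    by (rule gbinomial_Vandermonde)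
  moreover have "(real j + (real k + \<nu>)) gchoose k
      = Gamma (real j + real k + \<nu> + 1) / (fact k * Gamma (real j + \<nu> + 1))"
    using assms by (subst gbinomial_Gamma) (auto intro!: nn simp: add_ac)
  moreover have "(real k + \<nu>) gchoose (k - m) = Gamma (real k + \<nu> + 1) / (fact (k - m) * Gamma (real m + \<nu> + 1))"
    if "m \<le> k" for m
    using assms that by (subst gbinomial_Gamma) (auto intro!: nn simp: add_ac of_nat_diff)
  ultimately have "Gamma (real j + real k + \<nu> + 1) / (fact k * Gamma (real j + \<nu> + 1))
    = (\<Sum>m\<le>k. real (j choose m) * (Gamma (real k + \<nu> + 1) / (fact (k - m) * Gamma (real m + \<nu> + 1))))"
    by (simp add: binomial_gbinomial atMost_atLeast0)
  then have "fact k * (Gamma (real j + real k + \<nu> + 1) / (fact k * Gamma (real j + \<nu> + 1)))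
    = (\<Sum>m\<le>k. fact k * (real (j choose m) * (Gamma (real k + \<nu> + 1) / (fact (k - m) * Gamma (real m + \<nu> + 1)))))"
    by (simp add: sum_distrib_left)
  then show ?thesis by (simp add: mult_ac)
qed

text \<open>Up to the factor \<open>exp A\<close>, a binomial moment of the Poisson distribution:
  the terms with \<open>j < m\<close> vanish, and a shift by \<open>m\<close> leaves the exponential
  series.\<close>

lemma sums_choose_exp:
  "(\<lambda>j. A ^ j / fact j * real (j choose m)) sums (A ^ m / fact m * exp (A::real))"
proof -
  have "(\<lambda>j. A ^ m / fact m * (A ^ j / fact j)) sums (A ^ m / fact m * exp A)"
    using exp_converges[of A] by (intro sums_mult) (simp add: divide_inverse mult_ac)
  moreover have "A ^ m / fact m * (A ^ j / fact j) = A ^ (j + m) / fact (j + m) * real ((j + m) choose m)" for j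
    by (simp add: binomial_fact power_add mult_ac)
  ultimately have "(\<lambda>j. A ^ (j + m) / fact (j + m) * real ((j + m) choose m)) sums (A ^ m / fact m * exp A)"
    by simp
  then show ?thesis by (subst (asm) sums_iff_shift) (simp add: binomial_eq_0)
qed

text \<open>The limit is \<open>exp A * fact k\<close> times the Laguerre polynomial of degree
  \<open>k\<close> and order \<open>\<nu>\<close> at \<open>- A\<close>.\<close>

lemma bessel_inner_sum:
  assumes "0 \<le> \<nu>"
  shows "(\<lambda>j. A ^ j * Gamma (real j + real k + \<nu> + 1) / (fact j * Gamma (real j + \<nu> + 1)))
    sums (\<Sum>m\<le>k. fact k * Gamma (real k + \<nu> + 1) / (fact (k - m) * Gamma (real m + \<nu> + 1)) * (A ^ m / fact m * exp A))"
proof -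
  have "(\<lambda>j. \<Sum>m\<le>k. fact k * Gamma (real k + \<nu> + 1) / (fact (k - m) * Gamma (real m + \<nu> + 1)) * (A ^ j / fact j * real (j choose m)))
    sums (\<Sum>m\<le>k. fact k * Gamma (real k + \<nu> + 1) / (fact (k - m) * Gamma (real m + \<nu> + 1)) * (A ^ m / fact m * exp A))"
    by (intro sums_sum sums_mult sums_choose_exp)
  moreover have "(\<Sum>m\<le>k. fact k * Gamma (real k + \<nu> + 1) / (fact (k - m) * Gamma (real m + \<nu> + 1)) * (A ^ j / fact j * real (j choose m)))
    = A ^ j / fact j * (Gamma (real j + real k + \<nu> + 1) / Gamma (real j + \<nu> + 1))" for j
    unfolding Gamma_ratio_expand[OF assms] sum_distrib_left by (intro sum.cong) (auto simp: mult_ac)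
  ultimately show ?thesis by simp
qed

text \<open>The generating function of these Laguerre polynomials. Once \<open>fact k\<close> and
  \<open>Gamma (real k + \<nu> + 1)\<close> cancel, the summand is the Bessel term of
  \<open>A * B\<close> at \<open>m\<close> times the exponential term of \<open>B\<close> at
  \<open>k - m\<close>, so the series is a Cauchy product.\<close>

lemma bessel_outer_sum:
  assumes "0 \<le> \<nu>"
  shows "(\<lambda>k. B ^ k / (fact k * Gamma (real k + \<nu> + 1)) *
      (\<Sum>m\<le>k. fact k * Gamma (real k + \<nu> + 1) / (fact (k - m) * Gamma (real m + \<nu> + 1)) * (A ^ m / fact m * exp A)))
    sums (exp (A + B) * bessel_series \<nu> (A * B))"
proof -
  have "(\<lambda>k. \<Sum>m\<le>k. (A * B) ^ m / (fact m * Gamma (real m + \<nu> + 1)) * (B ^ (k - m) / fact (k - m)))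
     sums ((\<Sum>k. (A * B) ^ k / (fact k * Gamma (real k + \<nu> + 1))) * (\<Sum>k. B ^ k / fact k))"
    using summable_bessel_abs[OF assms, of "A * B"] summable_norm_exp[of B]
    by (intro Cauchy_product_sums) (simp_all add: divide_inverse mult_ac)
  moreover have "(\<Sum>k. B ^ k / fact k) = exp B"
    using exp_converges[of B] by (simp add: sums_iff divide_inverse mult_ac)
  ultimately have "(\<lambda>k. exp A * (\<Sum>m\<le>k. (A * B) ^ m / (fact m * Gamma (real m + \<nu> + 1)) * (B ^ (k - m) / fact (k - m))))
     sums (exp A * (bessel_series \<nu> (A * B) * exp B))"
    by (intro sums_mult) (simp add: bessel_series_def)
  moreover have "B ^ k / (fact k * Gamma (real k + \<nu> + 1)) *
      (\<Sum>m\<le>k. fact k * Gamma (real k + \<nu> + 1) / (fact (k - m) * Gamma (real m + \<nu> + 1)) * (A ^ m / fact m * exp A))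
     = exp A * (\<Sum>m\<le>k. (A * B) ^ m / (fact m * Gamma (real m + \<nu> + 1)) * (B ^ (k - m) / fact (k - m)))" for k
  proof -
    have "0 < Gamma (real k + \<nu> + 1)" using assms by (intro Gamma_real_pos) auto
    then obtain g where g: "g = Gamma (real k + \<nu> + 1)" "g \<noteq> 0" by (metis less_irrefl)
    have B: "B ^ k = B ^ m * B ^ (k - m)" if "m \<le> k" for m using that by (simp flip: power_add)
    have "B ^ k / (fact k * g) * (fact k * g / (fact (k - m) * c) * (A ^ m / fact m * exp A))
      = exp A * ((A * B) ^ m / (fact m * c) * (B ^ (k - m) / fact (k - m)))" if "m \<le> k" for m c
      using g(2) by (simp add: power_mult_distrib B[OF that] mult_ac)
    then show ?thesis unfolding sum_distrib_left g(1)[symmetric]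
      by (intro sum.cong) auto
  qed
  ultimately show ?thesis by (simp add: exp_add mult_ac)
qed

lemma nn_integral_powr_exp:
  assumes "0 < p" "0 \<le> s"
  shows "(\<integral>\<^sup>+y\<in>{0<..}. ennreal (y powr s * exp (- p * y)) \<partial>lborel) = ennreal (Gamma (s + 1) / p powr (s + 1))"
proof -
  have "(\<integral>\<^sup>+y\<in>{0<..}. ennreal (y powr s * exp (- p * y)) \<partial>lborel)
    = ennreal (1 / p) * (\<integral>\<^sup>+y. ennreal ((y / p) powr s * exp (- y)) * indicator {0<..} y \<partial>lborel)"
    using assms by (subst nn_integral_real_affine[where c = "1 / p" and t = 0])
      (auto intro!: arg_cong2[where f = "(*)"] nn_integral_cong simp: indicator_def zero_less_divide_iff)
  \<comment> \<open>The Gamma integral is taken over the closed half-line, so the integrands are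
    compared off the point 0.\<close>
  also have "(\<integral>\<^sup>+y. ennreal ((y / p) powr s * exp (- y)) * indicator {0<..} y \<partial>lborel)
     = (\<integral>\<^sup>+y. ennreal (1 / p powr s) * ennreal (indicator {0..} y * y powr s / exp y) \<partial>lborel)"
    by (rule nn_integral_cong_AE, rule AE_mp[OF AE_lborel_singleton[of 0]])
      (use assms in \<open>auto simp: indicator_def powr_divide exp_minus field_simps simp flip: ennreal_mult\<close>)
  also have "\<dots> = ennreal (1 / p powr s) * ennreal (Gamma (s + 1))"
    using Gamma_conv_nn_integral_real[of "s + 1"] assms by (subst nn_integral_cmult) auto
  finally show ?thesis using assms by (simp add: powr_add mult_ac Gamma_real_nonneg flip: ennreal_mult)
qed

text \<open>Weber's second exponential integral for modified Bessel functions, in the variable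
  \<open>y\<close> equal to the squared radius. All terms are nonnegative, so in
  \<open>ennreal\<close> the two series and the integral may be interchanged freely. The
  Chapman-Kolmogorov and eigenfunction identities are special cases.\<close>

theorem bessel_weber_integral:
  assumes "0 \<le> \<nu>" "0 < p" "0 \<le> a" "0 \<le> b"
  shows "(\<integral>\<^sup>+y\<in>{0<..}. ennreal (y powr \<nu> * exp (- p * y) * bessel_series \<nu> (a * y) * bessel_series \<nu> (b * y)) \<partial>lborel)
    = ennreal (exp ((a + b) / p) * bessel_series \<nu> (a * b / p\<^sup>2) / p powr (\<nu> + 1))"
proof -
  define c where "c k = 1 / (fact k * Gamma (real k + \<nu> + 1))" for k
  have c0: "0 \<le> c k" for k using assms by (simp add: c_def Gamma_real_nonneg)
  let ?S = "\<lambda>k. \<Sum>m\<le>k. fact k * Gamma (real k + \<nu> + 1) / (fact (k - m) * Gamma (real m + \<nu> + 1)) * ((a / p) ^ m / fact m * exp (a / p))"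
  let ?g = "\<lambda>j k. (a / p) ^ j * Gamma (real j + real k + \<nu> + 1) / (fact j * Gamma (real j + \<nu> + 1))"
  let ?d = "\<lambda>j k. c j * a ^ j * Gamma (real j + real k + \<nu> + 1) / (p ^ (j + k) * p powr (\<nu> + 1))"
  have bs: "ennreal (bessel_series \<nu> (u * y)) = (\<Sum>k. ennreal (c k * u ^ k * y ^ k))" if "0 \<le> u" "0 \<le> y" for u y
  proof -
    have "(\<lambda>k. c k * u ^ k * y ^ k) sums bessel_series \<nu> (u * y)"
      using bessel_series_sums[OF assms(1), of "u * y"] by (simp add: c_def power_mult_distrib)
    then show ?thesis
      using c0 that by (intro suminf_ennreal_eq[symmetric] mult_nonneg_nonneg) auto
  qed
  have inner: "(\<integral>\<^sup>+y\<in>{0<..}. ennreal (c k * b ^ k) * ennreal (c j * a ^ j) * ennreal (y ^ (j + k) * y powr \<nu> * exp (- p * y)) \<partial>lborel)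
     = ennreal (c k * b ^ k) * ennreal (?d j k)" for j k
  proof -
    have "(\<integral>\<^sup>+y\<in>{0<..}. ennreal (c k * b ^ k) * ennreal (c j * a ^ j) * ennreal (y ^ (j + k) * y powr \<nu> * exp (- p * y)) \<partial>lborel)
      = ennreal (c k * b ^ k) * ennreal (c j * a ^ j) * (\<integral>\<^sup>+y\<in>{0<..}. ennreal (y powr (real (j + k) + \<nu>) * exp (- p * y)) \<partial>lborel)"
      by (subst nn_integral_cmult[symmetric])
         (auto intro!: nn_integral_cong simp: indicator_def powr_add powr_realpow power_add mult_ac)
    also have "\<dots> = ennreal (c k * b ^ k) * ennreal (c j * a ^ j) * ennreal (Gamma (real (j + k) + \<nu> + 1) / p powr (real (j + k) + \<nu> + 1))"
      using assms by (subst nn_integral_powr_exp) auto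
    also have "p powr (real (j + k) + \<nu> + 1) = p ^ (j + k) * p powr (\<nu> + 1)"
      using assms by (simp add: powr_add powr_realpow add_ac mult_ac flip: of_nat_add)
    finally have "(\<integral>\<^sup>+y\<in>{0<..}. ennreal (c k * b ^ k) * ennreal (c j * a ^ j) * ennreal (y ^ (j + k) * y powr \<nu> * exp (- p * y)) \<partial>lborel)
      = ennreal (c k * b ^ k) * (ennreal (c j * a ^ j) * ennreal (Gamma (real (j + k) + \<nu> + 1) / (p ^ (j + k) * p powr (\<nu> + 1))))"
      by (simp only: mult.assoc)
    moreover have "ennreal (c j * a ^ j) * ennreal (Gamma (real (j + k) + \<nu> + 1) / (p ^ (j + k) * p powr (\<nu> + 1)))
      = ennreal (?d j k)"
      using c0[of j] assms(3) by (subst ennreal_mult'[symmetric]) simp_all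
    ultimately show ?thesis by (simp only:)
  qed
  have "(\<integral>\<^sup>+y\<in>{0<..}. ennreal (y powr \<nu> * exp (- p * y) * bessel_series \<nu> (a * y) * bessel_series \<nu> (b * y)) \<partial>lborel)
     = (\<integral>\<^sup>+y. (\<Sum>k. \<Sum>j. ennreal (c k * b ^ k) * ennreal (c j * a ^ j) * ennreal (y ^ (j + k) * y powr \<nu> * exp (- p * y)) * indicator {0<..} y) \<partial>lborel)"
  proof (intro nn_integral_cong)
    fix y :: real
    show "ennreal (y powr \<nu> * exp (- p * y) * bessel_series \<nu> (a * y) * bessel_series \<nu> (b * y)) * indicator {0<..} y
      = (\<Sum>k. \<Sum>j. ennreal (c k * b ^ k) * ennreal (c j * a ^ j) * ennreal (y ^ (j + k) * y powr \<nu> * exp (- p * y)) * indicator {0<..} y)"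
    proof (cases "0 < y")
      case True
      have "ennreal (y powr \<nu> * exp (- p * y) * bessel_series \<nu> (a * y) * bessel_series \<nu> (b * y))
        = ennreal (y powr \<nu> * exp (- p * y)) * ((\<Sum>j. ennreal (c j * a ^ j * y ^ j)) * (\<Sum>k. ennreal (c k * b ^ k * y ^ k)))"
        unfolding bs[OF assms(3) less_imp_le[OF True], symmetric] bs[OF assms(4) less_imp_le[OF True], symmetric]
        using True assms bessel_series_pos[of \<nu>] by (simp add: ennreal_mult less_imp_le mult.assoc)
      also have "\<dots> = (\<Sum>k. \<Sum>j. ennreal (y powr \<nu> * exp (- p * y)) * (ennreal (c j * a ^ j * y ^ j) * ennreal (c k * b ^ k * y ^ k)))"
        by simp
      also have "\<dots> = (\<Sum>k. \<Sum>j. ennreal (c k * b ^ k) * ennreal (c j * a ^ j) * ennreal (y ^ (j + k) * y powr \<nu> * exp (- p * y)))"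
        using True assms c0 by (intro suminf_cong) (simp add: power_add mult_ac flip: ennreal_mult)
      finally show ?thesis using True by simp
    qed simp
  qed
  also have "\<dots> = (\<Sum>k. \<Sum>j. ennreal (c k * b ^ k) * ennreal (?d j k))"
    by (simp add: nn_integral_suminf inner[unfolded mult_minus_left] del: ennreal_suminf_multc ennreal_suminf_cmult)
  \<comment> \<open>For a fixed power \<open>k\<close> of \<open>b\<close> the factors without
    \<open>j\<close> are pulled out; what remains is the series of \<open>bessel_inner_sum\<close>
    at \<open>A = a / p\<close>.\<close>
  also have "\<dots> = (\<Sum>k. ennreal (c k * b ^ k / (p ^ k * p powr (\<nu> + 1))) *
       (\<Sum>j. ennreal (?g j k)))"
  proof (intro suminf_cong)
    fix k
    have "ennreal (c k * b ^ k) * ennreal (?d j k)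
      = ennreal (c k * b ^ k / (p ^ k * p powr (\<nu> + 1))) *
        ennreal (?g j k)" for j
      using assms c0[of k] by (subst (1 2) ennreal_mult'[symmetric]) (simp_all add: c_def power_divide power_add)
    then show "(\<Sum>j. ennreal (c k * b ^ k) * ennreal (?d j k))
      = ennreal (c k * b ^ k / (p ^ k * p powr (\<nu> + 1))) *
       (\<Sum>j. ennreal (?g j k))"
      by (simp del: ennreal_suminf_cmult add: ennreal_suminf_cmult[symmetric])
  qed
  also have "\<dots> = (\<Sum>k. ennreal (1 / p powr (\<nu> + 1) * (c k * (b / p) ^ k *
      ?S k)))"
  proof (intro suminf_cong)
    fix k
    have "(\<Sum>j. ennreal (?g j k))
      = ennreal (?S k)"
      using assms by (intro suminf_ennreal_eq bessel_inner_sum) (auto simp: Gamma_real_nonneg)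
    moreover have "0 \<le> ?S k"
      using assms by (intro sum_nonneg) (auto simp: Gamma_real_nonneg)
    ultimately show "ennreal (c k * b ^ k / (p ^ k * p powr (\<nu> + 1))) *
       (\<Sum>j. ennreal (?g j k))
      = ennreal (1 / p powr (\<nu> + 1) * (c k * (b / p) ^ k *
      ?S k))"
      using c0 assms by (simp add: ennreal_mult''[symmetric] power_divide)
  qed
  also have "\<dots> = ennreal (1 / p powr (\<nu> + 1) * (exp (a / p + b / p) * bessel_series \<nu> (a / p * (b / p))))"
    using assms c0 bessel_outer_sum[of \<nu> "b / p" "a / p"]
    by (intro suminf_ennreal_eq sums_mult) (auto simp: c_def intro!: mult_nonneg_nonneg sum_nonneg divide_nonneg_nonneg Gamma_real_nonneg)
  finally show ?thesis by (simp add: add_divide_distrib power2_eq_square)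
qed

section \<open>Transition kernels of squared Bessel processes\<close>

text \<open>\<open>besq_q\<close> after its prefactor has cancelled the power of \<open>x\<close>
  contained in the Bessel function. Only \<open>y powr \<nu>\<close> is left, so the kernel is
  continuous in \<open>x\<close> down to 0.\<close>

definition besq_kernel :: "real \<Rightarrow> real \<Rightarrow> real \<Rightarrow> real \<Rightarrow> real" where
  "besq_kernel \<nu> t x y =
     y powr \<nu> / (2 * t) powr (\<nu> + 1) * exp (- (x + y) / (2 * t)) * bessel_series \<nu> (x * y / (4 * t\<^sup>2))"

lemma bessel_I_eq:
  assumes "0 \<le> \<nu>" "0 < z"
  shows "bessel_I \<nu> z = (z / 2) powr \<nu> * bessel_series \<nu> (z\<^sup>2 / 4)"
proof -
  have "(z / 2) powr (2 * real k + \<nu>) = (z / 2) powr \<nu> * (z\<^sup>2 / 4) ^ k" for k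
  proof -
    have "(z / 2) powr (2 * real k) = (z / 2) ^ (2 * k)"
      using assms powr_realpow[of "z / 2" "2 * k"] by simp
    then show ?thesis by (simp add: powr_add power_mult power_divide)
  qed
  then have "bessel_I \<nu> z = (\<Sum>k. (z / 2) powr \<nu> * ((z\<^sup>2 / 4) ^ k / (fact k * Gamma (real k + \<nu> + 1))))"
    unfolding bessel_I_def by simp
  also have "\<dots> = (z / 2) powr \<nu> * bessel_series \<nu> (z\<^sup>2 / 4)"
    unfolding bessel_series_def by (intro suminf_mult summable_bessel assms)
  finally show ?thesis .
qed

lemma besq_q_eq:
  assumes "0 \<le> \<nu>" "0 < t" "0 < x" "0 < y"
  shows "besq_q \<nu> t x y = besq_kernel \<nu> t x y"
proof -
  have "besq_q \<nu> t x y = 1 / (2 * t) * ((y / x) powr (\<nu> / 2) * (sqrt (x * y) / t / 2) powr \<nu>)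
      * exp (- (x + y) / (2 * t)) * bessel_series \<nu> ((sqrt (x * y) / t)\<^sup>2 / 4)"
    unfolding besq_q_def using assms by (subst bessel_I_eq) auto
  also have "(sqrt (x * y) / t)\<^sup>2 / 4 = x * y / (4 * t\<^sup>2)"
    using assms by (simp add: power_divide)
  also have "sqrt (x * y) = (x * y) powr (1 / 2)"
    using assms by (simp add: powr_half_sqrt)
  also have "(y / x) powr (\<nu> / 2) * ((x * y) powr (1 / 2) / t / 2) powr \<nu>
      = ((y / x) powr (\<nu> / 2) * (x * y) powr (\<nu> / 2)) / (2 * t) powr \<nu>"
    using assms by (simp add: powr_divide powr_powr powr_mult)
  also have "(y / x) powr (\<nu> / 2) * (x * y) powr (\<nu> / 2) = (y / x * (x * y)) powr (\<nu> / 2)"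
    using assms by (subst powr_mult) auto
  also have "y / x * (x * y) = y powr 2"
    using assms by (simp add: power2_eq_square)
  also have "(y powr 2) powr (\<nu> / 2) = y powr \<nu>" by (simp only: powr_powr) simp
  finally show ?thesis using assms by (simp add: besq_kernel_def powr_add)
qed

lemma besq_phi_eq:
  assumes "0 \<le> \<nu>" "0 < l" "0 < x"
  shows "besq_phi \<nu> l x = 2 powr (- \<nu>) * bessel_series \<nu> (l / 2 * x)"
proof -
  have "besq_phi \<nu> l x = (2 * l * x) powr (- \<nu> / 2) * (sqrt (2 * l * x) / 2) powr \<nu> * bessel_series \<nu> ((sqrt (2 * l * x))\<^sup>2 / 4)"
    unfolding besq_phi_def using assms by (subst bessel_I_eq) auto
  also have "(sqrt (2 * l * x))\<^sup>2 / 4 = l / 2 * x" using assms by simp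
  also have "sqrt (2 * l * x) = (2 * l * x) powr (1 / 2)"
    using assms by (simp only: powr_half_sqrt mult_nonneg_nonneg less_imp_le zero_le_numeral)
  also have "(2 * l * x) powr (- \<nu> / 2) * ((2 * l * x) powr (1 / 2) / 2) powr \<nu> = 2 powr (- \<nu>)"
  proof -
    have "0 < 2 * l * x" using assms by simp
    then obtain u where u: "u = 2 * l * x" "0 < u" by blast
    have "u powr (- \<nu> / 2) * (u powr (1 / 2) / 2) powr \<nu> = u powr (- \<nu> / 2) * u powr (\<nu> / 2) / 2 powr \<nu>"
      by (simp add: powr_divide powr_powr)
    also have "u powr (- \<nu> / 2) * u powr (\<nu> / 2) = 1"
      using u(2) by (simp flip: powr_add)
    finally show ?thesis unfolding u(1) by (simp only: powr_minus[of 2] divide_inverse mult_1_left)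
  qed
  finally show ?thesis .
qed

lemma borel_measurable_besq_kernel [measurable (raw)]:
  assumes [measurable]: "f \<in> borel_measurable M" "g \<in> borel_measurable M"
  shows "(\<lambda>\<omega>. besq_kernel \<nu> t (f \<omega>) (g \<omega>)) \<in> borel_measurable M"
  unfolding besq_kernel_def by measurable

lemma besq_kernel_nonneg:
  assumes "0 \<le> \<nu>" "0 \<le> x" "0 \<le> y"
  shows "0 \<le> besq_kernel \<nu> t x y"
  using assms bessel_series_pos[of \<nu> "x * y / (4 * t\<^sup>2)"] by (auto simp: besq_kernel_def intro!: mult_nonneg_nonneg)

text \<open>As a function of the intermediate point, the integrand is that of Weber's integral with
  decay rate \<open>1 / (2 * s) + 1 / (2 * t)\<close>.\<close>

lemma besq_kernel_chapman_kolmogorov: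
  assumes "0 \<le> \<nu>" "0 < s" "0 < t" "0 \<le> x" "0 \<le> z"
  shows "(\<integral>\<^sup>+y\<in>{0<..}. ennreal (besq_kernel \<nu> s x y * besq_kernel \<nu> t y z) \<partial>lborel)
    = ennreal (besq_kernel \<nu> (s + t) x z)"
proof -
  define p where "p = 1 / (2 * s) + 1 / (2 * t)"
  define C where "C = z powr \<nu> / ((2 * s) powr (\<nu> + 1) * (2 * t) powr (\<nu> + 1)) * exp (- x / (2 * s) - z / (2 * t))"
  have p: "p = (s + t) / (2 * s * t)" "0 < p" using assms by (auto simp: p_def field_simps)
  have C: "0 \<le> C" by (auto simp: C_def)
  have eq: "besq_kernel \<nu> s x y * besq_kernel \<nu> t y z
     = C * (y powr \<nu> * exp (- p * y) * bessel_series \<nu> (x / (4 * s\<^sup>2) * y) * bessel_series \<nu> (z / (4 * t\<^sup>2) * y))" for y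
  proof -
    have "exp (- (x + y) / (2 * s)) * exp (- (y + z) / (2 * t)) = exp (- x / (2 * s) - z / (2 * t)) * exp (- p * y)"
      unfolding mult_exp_exp p_def by (rule arg_cong[where f = exp]) (use assms in \<open>simp add: field_simps\<close>)
    then show ?thesis unfolding besq_kernel_def C_def by (simp add: mult_ac)
  qed
  have "(\<integral>\<^sup>+y\<in>{0<..}. ennreal (besq_kernel \<nu> s x y * besq_kernel \<nu> t y z) \<partial>lborel)
     = ennreal C * (\<integral>\<^sup>+y\<in>{0<..}. ennreal (y powr \<nu> * exp (- p * y) * bessel_series \<nu> (x / (4 * s\<^sup>2) * y) * bessel_series \<nu> (z / (4 * t\<^sup>2) * y)) \<partial>lborel)"
    unfolding eq ennreal_mult'[OF C] mult.assoc by (intro nn_integral_cmult) measurable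
  also have "\<dots> = ennreal (C * (exp ((x / (4 * s\<^sup>2) + z / (4 * t\<^sup>2)) / p)
      * bessel_series \<nu> (x / (4 * s\<^sup>2) * (z / (4 * t\<^sup>2)) / p\<^sup>2) / p powr (\<nu> + 1)))"
    unfolding ennreal_mult'[OF C] using assms p(2) by (subst bessel_weber_integral) simp_all
  also have "x / (4 * s\<^sup>2) * (z / (4 * t\<^sup>2)) / p\<^sup>2 = x * z / (4 * (s + t)\<^sup>2)"
    using assms by (simp add: p power2_eq_square field_simps)
  also have "C * (exp ((x / (4 * s\<^sup>2) + z / (4 * t\<^sup>2)) / p) * bessel_series \<nu> (x * z / (4 * (s + t)\<^sup>2)) / p powr (\<nu> + 1))
     = z powr \<nu> / ((2 * s) powr (\<nu> + 1) * (2 * t) powr (\<nu> + 1) * p powr (\<nu> + 1))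
       * (exp (- x / (2 * s) - z / (2 * t)) * exp ((x / (4 * s\<^sup>2) + z / (4 * t\<^sup>2)) / p)) * bessel_series \<nu> (x * z / (4 * (s + t)\<^sup>2))"
    by (simp add: C_def)
  also have "(2 * s) powr (\<nu> + 1) * (2 * t) powr (\<nu> + 1) * p powr (\<nu> + 1) = (2 * s * (2 * t) * p) powr (\<nu> + 1)"
  proof -
    have "u powr q * v powr q * w powr q = (u * v * w) powr q" if "0 < u" "0 < v" "0 < w" for u v w q :: real
      using that by (simp add: powr_mult)
    from this[of "2 * s" "2 * t" p "\<nu> + 1"] show ?thesis using assms p(2) by simp
  qed
  also have "2 * s * (2 * t) * p = 2 * (s + t)" using assms by (simp add: p field_simps)
  also have "exp (- x / (2 * s) - z / (2 * t)) * exp ((x / (4 * s\<^sup>2) + z / (4 * t\<^sup>2)) / p) = exp (- (x + z) / (2 * (s + t)))"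
  proof -
    have "- x / (2 * s) + x / (4 * s\<^sup>2) / p = - x / (2 * (s + t))"
      "- z / (2 * t) + z / (4 * t\<^sup>2) / p = - z / (2 * (s + t))"
      using assms by (simp_all add: p power2_eq_square divide_simps) (simp_all add: algebra_simps)
    then show ?thesis unfolding mult_exp_exp
      by (intro arg_cong[where f = exp]) (simp add: add_divide_distrib diff_divide_distrib)
  qed
  finally show ?thesis by (simp add: besq_kernel_def)
qed

text \<open>\<open>bessel_series \<nu> (a * y)\<close> is an eigenfunction, with eigenvalue
  \<open>2 * a\<close>, of the generator \<open>2 x D^2 + 2 (\<nu> + 1) D\<close> of the squared
  Bessel process. The identity is Weber's integral with rate \<open>1 / (2 * t)\<close>.\<close>

lemma besq_kernel_eigenfunction:
  assumes "0 \<le> \<nu>" "0 < t" "0 \<le> x" "0 \<le> a"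
  shows "(\<integral>\<^sup>+y\<in>{0<..}. ennreal (besq_kernel \<nu> t x y * bessel_series \<nu> (a * y)) \<partial>lborel)
    = ennreal (exp (2 * a * t) * bessel_series \<nu> (a * x))"
proof -
  define C where "C = exp (- x / (2 * t)) / (2 * t) powr (\<nu> + 1)"
  have C: "0 \<le> C" by (auto simp: C_def)
  have eq: "besq_kernel \<nu> t x y * bessel_series \<nu> (a * y)
     = C * (y powr \<nu> * exp (- (1 / (2 * t)) * y) * bessel_series \<nu> (x / (4 * t\<^sup>2) * y) * bessel_series \<nu> (a * y))" for y
  proof -
    have "exp (- (x + y) / (2 * t)) = exp (- x / (2 * t)) * exp (- (1 / (2 * t)) * y)"
      unfolding mult_exp_exp by (rule arg_cong[where f = exp]) (use assms in \<open>simp add: field_simps\<close>)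
    then show ?thesis unfolding besq_kernel_def C_def by (simp add: mult_ac)
  qed
  have "(\<integral>\<^sup>+y\<in>{0<..}. ennreal (besq_kernel \<nu> t x y * bessel_series \<nu> (a * y)) \<partial>lborel)
     = ennreal C * (\<integral>\<^sup>+y\<in>{0<..}. ennreal (y powr \<nu> * exp (- (1 / (2 * t)) * y) * bessel_series \<nu> (x / (4 * t\<^sup>2) * y) * bessel_series \<nu> (a * y)) \<partial>lborel)"
    unfolding eq ennreal_mult'[OF C] mult.assoc by (intro nn_integral_cmult) measurable
  also have "\<dots> = ennreal (C * (exp ((x / (4 * t\<^sup>2) + a) / (1 / (2 * t)))
      * bessel_series \<nu> (x / (4 * t\<^sup>2) * a / (1 / (2 * t))\<^sup>2) / (1 / (2 * t)) powr (\<nu> + 1)))"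
    unfolding ennreal_mult'[OF C] using assms by (subst bessel_weber_integral) simp_all
  also have "x / (4 * t\<^sup>2) * a / (1 / (2 * t))\<^sup>2 = a * x"
    using assms by (simp add: power2_eq_square field_simps)
  also have "(x / (4 * t\<^sup>2) + a) / (1 / (2 * t)) = x / (2 * t) + 2 * a * t"
    using assms by (simp add: power2_eq_square field_simps)
  also have "C * (exp (x / (2 * t) + 2 * a * t) * bessel_series \<nu> (a * x) / (1 / (2 * t)) powr (\<nu> + 1))
      = exp (- x / (2 * t)) * exp (x / (2 * t) + 2 * a * t) * bessel_series \<nu> (a * x)"
    using assms by (simp add: C_def powr_divide)
  also have "exp (- x / (2 * t)) * exp (x / (2 * t) + 2 * a * t) = exp (2 * a * t)"
    unfolding mult_exp_exp by simp
  finally show ?thesis .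
qed

text \<open>The bound \<open>exp (2 * sqrt w)\<close> on the series completes the square in the
  exponent. The kernel is thus Gaussian in \<open>sqrt x - sqrt y\<close>, which is why distances
  are measured between square roots from here on.\<close>

lemma besq_kernel_le:
  assumes "0 \<le> \<nu>" "0 < t" "0 \<le> x" "0 \<le> y"
  shows "besq_kernel \<nu> t x y \<le> y powr \<nu> / ((2 * t) powr (\<nu> + 1) * Gamma (\<nu> + 1)) * exp (- (sqrt x - sqrt y)\<^sup>2 / (2 * t))"
proof -
  have "bessel_series \<nu> (x * y / (4 * t\<^sup>2)) \<le> exp (2 * sqrt (x * y / (4 * t\<^sup>2))) / Gamma (\<nu> + 1)"
    using assms by (intro bessel_series_le) auto
  also have "sqrt (x * y / (4 * t\<^sup>2)) = sqrt x * sqrt y / (2 * t)"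
    using assms by (simp add: real_sqrt_divide real_sqrt_mult)
  finally have "besq_kernel \<nu> t x y \<le> y powr \<nu> / (2 * t) powr (\<nu> + 1) * exp (- (x + y) / (2 * t)) *
     (exp (2 * (sqrt x * sqrt y / (2 * t))) / Gamma (\<nu> + 1))"
    unfolding besq_kernel_def by (intro mult_left_mono) auto
  also have "\<dots> = y powr \<nu> / ((2 * t) powr (\<nu> + 1) * Gamma (\<nu> + 1)) * (exp (- (x + y) / (2 * t)) * exp (2 * (sqrt x * sqrt y / (2 * t))))"
    by simp
  also have "exp (- (x + y) / (2 * t)) * exp (2 * (sqrt x * sqrt y / (2 * t))) = exp (- (sqrt x - sqrt y)\<^sup>2 / (2 * t))"
    unfolding mult_exp_exp using assms
    by (intro arg_cong[where f = exp]) (simp add: power2_diff add_divide_distrib diff_divide_distrib)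
  finally show ?thesis .
qed

lemma continuous_on_besq_kernel:
  assumes "0 \<le> \<nu>" "continuous_on S \<tau>" "continuous_on S f" "\<And>r. r \<in> S \<Longrightarrow> 0 < \<tau> r"
  shows "continuous_on S (\<lambda>r. besq_kernel \<nu> (\<tau> r) (f r) z)"
  unfolding besq_kernel_def
  by (intro continuous_intros continuous_on_bessel_series assms) (use assms(4) in \<open>force+\<close>)

section \<open>The Doob transform of a single particle\<close>

text \<open>The transition density of the diffusion with parameter \<open>l = 2 * a\<close>; the
  constant between \<open>besq_phi\<close> and the series cancels in the quotient.\<close>

definition besq_density :: "real \<Rightarrow> real \<Rightarrow> real \<Rightarrow> real \<Rightarrow> real \<Rightarrow> real" where
  "besq_density \<nu> a t x y = exp (- 2 * a * t) * bessel_series \<nu> (a * y) / bessel_series \<nu> (a * x) * besq_kernel \<nu> t x y"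

lemma borel_measurable_besq_density [measurable (raw)]:
  assumes [measurable]: "f \<in> borel_measurable M" "g \<in> borel_measurable M"
  shows "(\<lambda>\<omega>. besq_density \<nu> a t (f \<omega>) (g \<omega>)) \<in> borel_measurable M"
  unfolding besq_density_def by measurable

lemma besq_density_nonneg:
  assumes "0 \<le> \<nu>" "0 \<le> a" "0 \<le> x" "0 \<le> y"
  shows "0 \<le> besq_density \<nu> a t x y"
  using assms bessel_series_pos[of \<nu> "a * x"] bessel_series_pos[of \<nu> "a * y"]
  by (auto simp: besq_density_def intro!: mult_nonneg_nonneg divide_nonneg_nonneg besq_kernel_nonneg)

lemma besq_density_eq:
  assumes "0 \<le> \<nu>" "0 < m" "0 < t" "0 < x" "0 < y"
  shows "doob_transform (m / 2) (besq_phi \<nu> (m / 2)) (besq_q \<nu>) t x y = besq_density \<nu> (m / 4) t x y"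
  using assms by (simp add: doob_transform_def besq_density_def besq_phi_eq besq_q_eq)

text \<open>The denominator at \<open>y\<close> cancels the numerator of the Doob transform and
  leaves an eigenfunction for \<open>b\<close>. With \<open>b = a\<close> this is total mass 1; with
  the weight of another particle as \<open>b\<close> it leads to the harmonicity of
  \<open>bessel_ratio\<close>.\<close>

lemma nn_integral_besq_density:
  assumes "0 \<le> \<nu>" "0 \<le> a" "0 \<le> b" "0 < t" "0 \<le> x"
  shows "(\<integral>\<^sup>+y\<in>{0<..}. ennreal (besq_density \<nu> a t x y * (bessel_series \<nu> (b * y) / bessel_series \<nu> (a * y))) \<partial>lborel)
    = ennreal (exp (2 * (b - a) * t) * (bessel_series \<nu> (b * x) / bessel_series \<nu> (a * x)))"
proof -
  have "(\<integral>\<^sup>+y\<in>{0<..}. ennreal (besq_density \<nu> a t x y * (bessel_series \<nu> (b * y) / bessel_series \<nu> (a * y))) \<partial>lborel)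
    = (\<integral>\<^sup>+y. ennreal (exp (- 2 * a * t) / bessel_series \<nu> (a * x)) * (ennreal (besq_kernel \<nu> t x y * bessel_series \<nu> (b * y)) * indicator {0<..} y) \<partial>lborel)"
  proof (intro nn_integral_cong)
    fix y :: real
    define c where "c = exp (- 2 * a * t) / bessel_series \<nu> (a * x)"
    have c: "0 \<le> c" using assms bessel_series_pos[of \<nu> "a * x"] by (simp add: c_def)
    have "besq_density \<nu> a t x y * (bessel_series \<nu> (b * y) / bessel_series \<nu> (a * y))
      = c * (besq_kernel \<nu> t x y * bessel_series \<nu> (b * y))" if "0 < y"
      using that assms bessel_series_pos[of \<nu> "a * y"] by (simp add: besq_density_def c_def)
    then show "ennreal (besq_density \<nu> a t x y * (bessel_series \<nu> (b * y) / bessel_series \<nu> (a * y))) * indicator {0<..} y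
      = ennreal (exp (- 2 * a * t) / bessel_series \<nu> (a * x)) * (ennreal (besq_kernel \<nu> t x y * bessel_series \<nu> (b * y)) * indicator {0<..} y)"
      unfolding c_def[symmetric] by (cases "0 < y") (simp_all add: ennreal_mult'[OF c])
  qed
  also have "\<dots> = ennreal (exp (- 2 * a * t) / bessel_series \<nu> (a * x)) * ennreal (exp (2 * b * t) * bessel_series \<nu> (b * x))"
    using assms by (subst nn_integral_cmult) (auto simp: besq_kernel_eigenfunction)
  also have "\<dots> = ennreal (exp (- 2 * a * t) / bessel_series \<nu> (a * x) * (exp (2 * b * t) * bessel_series \<nu> (b * x)))"
    using assms bessel_series_pos[of \<nu> "a * x"] by (intro ennreal_mult'[symmetric]) simp
  also have "exp (- 2 * a * t) / bessel_series \<nu> (a * x) * (exp (2 * b * t) * bessel_series \<nu> (b * x))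
     = exp (2 * (b - a) * t) * (bessel_series \<nu> (b * x) / bessel_series \<nu> (a * x))"
    by (simp add: algebra_simps exp_diff exp_minus divide_inverse)
  finally show ?thesis .
qed

lemma nn_integral_besq_density_1:
  assumes "0 \<le> \<nu>" "0 \<le> a" "0 < t" "0 \<le> x"
  shows "(\<integral>\<^sup>+y\<in>{0<..}. ennreal (besq_density \<nu> a t x y) \<partial>lborel) = 1"
proof -
  have "(\<integral>\<^sup>+y\<in>{0<..}. ennreal (besq_density \<nu> a t x y) \<partial>lborel)
    = (\<integral>\<^sup>+y\<in>{0<..}. ennreal (besq_density \<nu> a t x y * (bessel_series \<nu> (a * y) / bessel_series \<nu> (a * y))) \<partial>lborel)"
  proof (intro nn_integral_cong)
    fix y :: real
    have "0 < y \<Longrightarrow> bessel_series \<nu> (a * y) \<noteq> 0" using assms bessel_series_pos[of \<nu> "a * y"] by auto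
    then show "ennreal (besq_density \<nu> a t x y) * indicator {0<..} y
      = ennreal (besq_density \<nu> a t x y * (bessel_series \<nu> (a * y) / bessel_series \<nu> (a * y))) * indicator {0<..} y"
      by (auto simp: indicator_def)
  qed
  also have "\<dots> = 1"
    using assms bessel_series_pos[of \<nu> "a * x"] by (subst nn_integral_besq_density) auto
  finally show ?thesis .
qed

section \<open>Tails of the one-particle law at large times\<close>

text \<open>The Doob factor adds \<open>2 * sqrt a * sqrt y - 2 * a * t\<close> to the exponent.
  Together with the Gaussian of \<open>besq_kernel_le\<close> this is a square centred at
  \<open>sqrt y = 2 * sqrt a * t\<close>, up to the cross term \<open>sqrt x * sqrt y / t\<close>.
  The assumption \<open>1 \<le> t\<close> serves to drop the power of \<open>2 * t\<close>.\<close>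

lemma besq_density_le:
  assumes "0 \<le> \<nu>" "0 \<le> a" "1 \<le> t" "0 \<le> x" "0 < y"
  shows "besq_density \<nu> a t x y
    \<le> y powr \<nu> * exp (- (sqrt y - 2 * sqrt a * t)\<^sup>2 / (2 * t) + sqrt x * sqrt y / t) / Gamma (\<nu> + 1)"
proof -
  have G: "0 < Gamma (\<nu> + 1)" using assms by (intro Gamma_real_pos) auto
  have "bessel_series \<nu> (a * y) / bessel_series \<nu> (a * x) \<le> (exp (2 * sqrt (a * y)) / Gamma (\<nu> + 1)) / (1 / Gamma (\<nu> + 1))"
    using assms G by (intro frac_le bessel_series_le bessel_series_ge) auto
  then have 1: "bessel_series \<nu> (a * y) / bessel_series \<nu> (a * x) \<le> exp (2 * sqrt a * sqrt y)"
    using G by (simp add: real_sqrt_mult mult.assoc)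
  have "1 \<le> (2 * t) powr (\<nu> + 1)" using assms by (intro ge_one_powr_ge_zero) auto
  then have "y powr \<nu> / ((2 * t) powr (\<nu> + 1) * Gamma (\<nu> + 1)) \<le> y powr \<nu> / (1 * Gamma (\<nu> + 1))"
    using G assms(3) by (intro divide_left_mono mult_right_mono mult_pos_pos) auto
  then have 3: "y powr \<nu> / ((2 * t) powr (\<nu> + 1) * Gamma (\<nu> + 1)) \<le> y powr \<nu> / Gamma (\<nu> + 1)" by simp
  have 2: "besq_kernel \<nu> t x y \<le> y powr \<nu> / Gamma (\<nu> + 1) * exp (- (sqrt x - sqrt y)\<^sup>2 / (2 * t))"
    by (rule order_trans[OF besq_kernel_le mult_right_mono[OF 3]]) (use assms in auto)
  have "besq_density \<nu> a t x y = exp (- 2 * a * t) * ((bessel_series \<nu> (a * y) / bessel_series \<nu> (a * x)) * besq_kernel \<nu> t x y)"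
    by (simp add: besq_density_def)
  also have "\<dots> \<le> exp (- 2 * a * t) * (exp (2 * sqrt a * sqrt y) * (y powr \<nu> / Gamma (\<nu> + 1) * exp (- (sqrt x - sqrt y)\<^sup>2 / (2 * t))))"
    by (rule mult_left_mono[OF mult_mono[OF 1 2]]) (use assms in \<open>auto intro: besq_kernel_nonneg\<close>)
  also have "\<dots> = y powr \<nu> / Gamma (\<nu> + 1) * exp (- 2 * a * t + 2 * sqrt a * sqrt y + - (sqrt x - sqrt y)\<^sup>2 / (2 * t))"
  proof -
    have "e * (f * (g * h)) = g * (e * f * h)" for e f g h :: real by simp
    then show ?thesis unfolding exp_add .
  qed
  also have "- 2 * a * t + 2 * sqrt a * sqrt y + - (sqrt x - sqrt y)\<^sup>2 / (2 * t)
     = - (sqrt y - 2 * sqrt a * t)\<^sup>2 / (2 * t) + sqrt x * sqrt y / t - x / (2 * t)"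
  proof -
    have "- 2 * (u * u) * t + 2 * u * w + - (v - w)\<^sup>2 / (2 * t) = - (w - 2 * u * t)\<^sup>2 / (2 * t) + v * w / t - (v * v) / (2 * t)" for u v w
      using assms(3) by (simp add: power2_eq_square field_simps)
    from this[of "sqrt a" "sqrt y" "sqrt x"] show ?thesis using assms by simp
  qed
  also have "y powr \<nu> / Gamma (\<nu> + 1) * exp (- (sqrt y - 2 * sqrt a * t)\<^sup>2 / (2 * t) + sqrt x * sqrt y / t - x / (2 * t))
    \<le> y powr \<nu> / Gamma (\<nu> + 1) * exp (- (sqrt y - 2 * sqrt a * t)\<^sup>2 / (2 * t) + sqrt x * sqrt y / t)"
    by (rule mult_left_mono) (use assms G in auto)
  finally show ?thesis by (simp only: times_divide_eq_left)
qed

text \<open>Beyond \<open>\<kappa>^2 * t^2\<close> the excess of \<open>sqrt y\<close> over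
  \<open>2 * sqrt a * t\<close> is at least the fraction \<open>\<theta>\<close> of
  \<open>sqrt y\<close>, so the exponent is at most \<open>- \<theta>^2 * y / (2 * t)\<close> plus
  the cross term.\<close>

lemma besq_density_upper_tail:
  assumes "0 \<le> \<nu>" "0 \<le> a" "0 \<le> x" "2 * sqrt a < \<kappa>"
  shows "((\<lambda>t. \<integral>\<^sup>+y\<in>{\<kappa>\<^sup>2 * t\<^sup>2..}. ennreal (besq_density \<nu> a t x y) \<partial>lborel) \<longlongrightarrow> 0) at_top"
proof -
  have \<kappa>: "0 < \<kappa>" using assms by (smt (verit) real_sqrt_ge_zero)
  have G: "0 < Gamma (\<nu> + 1)" using assms by (intro Gamma_real_pos) auto
  define \<theta> where "\<theta> = 1 - 2 * sqrt a / \<kappa>"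
  have \<theta>: "0 < \<theta>" using assms \<kappa> by (simp add: \<theta>_def)
  \<comment> \<open>The quantity \<open>\<theta>^2 * y / (2 * t)\<close> is spent in three portions.
    Half of it gives decay in \<open>t\<close>, because \<open>y\<close> is at least
    \<open>\<kappa>^2 * t^2\<close>; a quarter absorbs the cross term at the price of
    \<open>2 * x / \<theta>^2\<close>; the last quarter, with rate
    \<open>\<theta>^2 / 8 / t\<close>, keeps the integral over \<open>y\<close> finite.\<close>
  define B where "B t = exp (- (\<theta>\<^sup>2 * \<kappa>\<^sup>2 / 4) * t + 2 * x / \<theta>\<^sup>2) / (\<theta>\<^sup>2 / 8 / t) powr (\<nu> + 1)" for t
  have bound: "(\<integral>\<^sup>+y\<in>{\<kappa>\<^sup>2 * t\<^sup>2..}. ennreal (besq_density \<nu> a t x y) \<partial>lborel) \<le> ennreal (B t)" if t: "1 \<le> t" for t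
  proof -
    define C where "C = exp (- (\<theta>\<^sup>2 * \<kappa>\<^sup>2 / 4) * t + 2 * x / \<theta>\<^sup>2) / Gamma (\<nu> + 1)"
    have C: "0 \<le> C" using G by (simp add: C_def)
    have "besq_density \<nu> a t x y \<le> C * (y powr \<nu> * exp (- (\<theta>\<^sup>2 / 8 / t) * y))" if y: "\<kappa>\<^sup>2 * t\<^sup>2 \<le> y" for y
    proof -
      have "0 < \<kappa>\<^sup>2 * t\<^sup>2" using \<kappa> t by simp
      then have y0: "0 < y" using y by linarith
      obtain u where u: "u = sqrt y" "0 < u" "y = u\<^sup>2" using y0 by (intro that[of "sqrt y"]) auto
      obtain v where v: "v = sqrt x" "0 \<le> v" "x = v\<^sup>2" using assms(3) by (intro that[of "sqrt x"]) auto
      have "sqrt (\<kappa>\<^sup>2 * t\<^sup>2) \<le> sqrt y" using y by simp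
      then have ku: "\<kappa> * t \<le> u" using \<kappa> t by (simp add: u(1) real_sqrt_mult)
      have "2 * sqrt a / \<kappa> * (\<kappa> * t) \<le> 2 * sqrt a / \<kappa> * u"
        using ku \<kappa> assms(2) by (intro mult_left_mono) auto
      then have "\<theta> * u \<le> u - 2 * sqrt a * t" using \<kappa> by (simp add: \<theta>_def algebra_simps)
      then have "(\<theta> * u)\<^sup>2 \<le> (u - 2 * sqrt a * t)\<^sup>2" by (rule power_mono) (use \<theta> u(2) in simp)
      then have 1: "\<theta>\<^sup>2 * u\<^sup>2 / (2 * t) \<le> (u - 2 * sqrt a * t)\<^sup>2 / (2 * t)"
        using t by (intro divide_right_mono) (auto simp: power_mult_distrib)
      \<comment> \<open>The arithmetic-geometric mean inequality for \<open>v * u\<close>, weighted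
        so as to cost exactly \<open>\<theta>^2 * u^2 / 8\<close>.\<close>
      have "0 \<le> 2 * (\<theta> * u / 4 - v / \<theta>)\<^sup>2" by simp
      then have "v * u \<le> \<theta>\<^sup>2 * u\<^sup>2 / 8 + 2 * v\<^sup>2 / \<theta>\<^sup>2"
        using \<theta> by (simp add: power2_diff power_mult_distrib power_divide algebra_simps)
      then have "v * u / t \<le> (\<theta>\<^sup>2 * u\<^sup>2 / 8 + 2 * v\<^sup>2 / \<theta>\<^sup>2) / t"
        using t by (intro divide_right_mono) auto
      also have "\<dots> = \<theta>\<^sup>2 * u\<^sup>2 / (8 * t) + (2 * v\<^sup>2 / \<theta>\<^sup>2) / t" by (simp add: add_divide_distrib)
      also have "(2 * v\<^sup>2 / \<theta>\<^sup>2) / t \<le> (2 * v\<^sup>2 / \<theta>\<^sup>2) / 1" using t by (intro divide_left_mono) auto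
      finally have 2: "v * u / t \<le> \<theta>\<^sup>2 * u\<^sup>2 / (8 * t) + 2 * v\<^sup>2 / \<theta>\<^sup>2" by simp
      have "(\<kappa> * t)\<^sup>2 \<le> u\<^sup>2" using ku \<kappa> t by (intro power_mono) auto
      then have "\<theta>\<^sup>2 * (\<kappa> * t)\<^sup>2 / (4 * t) \<le> \<theta>\<^sup>2 * u\<^sup>2 / (4 * t)"
        using t by (intro divide_right_mono mult_left_mono) auto
      then have 3: "\<theta>\<^sup>2 * \<kappa>\<^sup>2 / 4 * t \<le> \<theta>\<^sup>2 * u\<^sup>2 / (4 * t)"
        using t by (simp add: power_mult_distrib power2_eq_square)
      have 4: "\<theta>\<^sup>2 * u\<^sup>2 / (2 * t) = \<theta>\<^sup>2 * u\<^sup>2 / (4 * t) + \<theta>\<^sup>2 * u\<^sup>2 / (4 * t)"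
        "\<theta>\<^sup>2 * u\<^sup>2 / (4 * t) = \<theta>\<^sup>2 * u\<^sup>2 / (8 * t) + \<theta>\<^sup>2 * u\<^sup>2 / (8 * t)" by simp_all
      have 5: "\<theta>\<^sup>2 / 8 / t * y = \<theta>\<^sup>2 * u\<^sup>2 / (8 * t)" using u by simp
      have "besq_density \<nu> a t x y \<le> y powr \<nu> * exp (- (u - 2 * sqrt a * t)\<^sup>2 / (2 * t) + v * u / t) / Gamma (\<nu> + 1)"
        using besq_density_le[OF assms(1,2) t assms(3) y0] by (simp add: u(1) v(1))
      also have "\<dots> \<le> y powr \<nu> * exp (- (\<theta>\<^sup>2 * \<kappa>\<^sup>2 / 4) * t + 2 * x / \<theta>\<^sup>2 + - (\<theta>\<^sup>2 / 8 / t) * y) / Gamma (\<nu> + 1)"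
      proof -
        have "- (u - 2 * sqrt a * t)\<^sup>2 / (2 * t) = - ((u - 2 * sqrt a * t)\<^sup>2 / (2 * t))"
          "- (\<theta>\<^sup>2 / 8 / t) * y = - (\<theta>\<^sup>2 / 8 / t * y)" "- (\<theta>\<^sup>2 * \<kappa>\<^sup>2 / 4) * t = - (\<theta>\<^sup>2 * \<kappa>\<^sup>2 / 4 * t)" by simp_all
        moreover have 6: "2 * x / \<theta>\<^sup>2 = 2 * v\<^sup>2 / \<theta>\<^sup>2" by (simp only: v(3))
        moreover have "0 \<le> \<theta>\<^sup>2 * u\<^sup>2 / (8 * t)" using t by simp
        ultimately have "- (u - 2 * sqrt a * t)\<^sup>2 / (2 * t) + v * u / t \<le> - (\<theta>\<^sup>2 * \<kappa>\<^sup>2 / 4) * t + 2 * x / \<theta>\<^sup>2 + - (\<theta>\<^sup>2 / 8 / t) * y"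
          using 1 2 3 4 5 6 by linarith
        then show ?thesis using G by (intro divide_right_mono mult_left_mono) auto
      qed
      also have "\<dots> = C * (y powr \<nu> * exp (- (\<theta>\<^sup>2 / 8 / t) * y))"
        unfolding exp_add[of _ "- (\<theta>\<^sup>2 / 8 / t) * y"] by (simp add: C_def)
      finally show ?thesis .
    qed
    moreover have "0 < y" if "\<kappa>\<^sup>2 * t\<^sup>2 \<le> y" for y
    proof -
      have "0 < \<kappa>\<^sup>2 * t\<^sup>2" using \<kappa> t by simp
      then show ?thesis using that by linarith
    qed
    ultimately have "(\<integral>\<^sup>+y\<in>{\<kappa>\<^sup>2 * t\<^sup>2..}. ennreal (besq_density \<nu> a t x y) \<partial>lborel)
      \<le> (\<integral>\<^sup>+y. ennreal C * (ennreal (y powr \<nu> * exp (- (\<theta>\<^sup>2 / 8 / t) * y)) * indicator {0<..} y) \<partial>lborel)"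
      unfolding mult.assoc[symmetric] ennreal_mult'[OF C, symmetric]
      by (intro nn_integral_mono) (auto simp: indicator_def simp del: ennreal_mult' intro!: ennreal_leI)
    also have "\<dots> = ennreal C * (\<integral>\<^sup>+y\<in>{0<..}. ennreal (y powr \<nu> * exp (- (\<theta>\<^sup>2 / 8 / t) * y)) \<partial>lborel)"
      by (intro nn_integral_cmult) measurable
    also have "\<dots> = ennreal (C * (Gamma (\<nu> + 1) / (\<theta>\<^sup>2 / 8 / t) powr (\<nu> + 1)))"
      unfolding ennreal_mult'[OF C] using assms(1) \<theta> t by (subst nn_integral_powr_exp) auto
    also have "C * (Gamma (\<nu> + 1) / (\<theta>\<^sup>2 / 8 / t) powr (\<nu> + 1)) = B t"
      using G by (simp add: C_def B_def)
    finally show ?thesis .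
  qed
  have "(B \<longlongrightarrow> 0) at_top"
  proof -
    have "((\<lambda>t. exp (- p * t + q) / (r / t) powr s) \<longlongrightarrow> 0) at_top" if "p > 0" "r > 0" "s > 0" for p q r s :: real
      using that by real_asymp
    then show ?thesis unfolding B_def[abs_def] by this (use \<theta> \<kappa> assms in auto)
  qed
  then have "((\<lambda>t. ennreal (B t)) \<longlongrightarrow> 0) at_top" using tendsto_ennrealI by fastforce
  then show ?thesis
    by (rule tendsto_sandwich[where f = "\<lambda>_. 0" and h = "\<lambda>t. ennreal (B t)", rotated 3])
       (auto intro!: eventually_mono[OF eventually_ge_at_top[of 1]] bound)
qed

text \<open>Here nothing has to be kept for integrability: the interval has length
  \<open>\<kappa>^2 * t^2\<close>, and on it the density is below \<open>C t\<close>, which is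
  exponentially small. The cross term stays bounded because
  \<open>sqrt y \<le> \<kappa> * t\<close>.\<close>

lemma besq_density_lower_tail:
  assumes "0 \<le> \<nu>" "0 \<le> a" "0 \<le> x" "0 < \<kappa>" "\<kappa> < 2 * sqrt a"
  shows "((\<lambda>t. \<integral>\<^sup>+y\<in>{0<..\<kappa>\<^sup>2 * t\<^sup>2}. ennreal (besq_density \<nu> a t x y) \<partial>lborel) \<longlongrightarrow> 0) at_top"
proof -
  have G: "0 < Gamma (\<nu> + 1)" using assms by (intro Gamma_real_pos) auto
  define \<theta> where "\<theta> = 2 * sqrt a - \<kappa>"
  have \<theta>: "0 < \<theta>" using assms by (simp add: \<theta>_def)
  define C where "C t = (\<kappa>\<^sup>2 * t\<^sup>2) powr \<nu> * exp (- (\<theta>\<^sup>2 / 2) * t + sqrt x * \<kappa>) / Gamma (\<nu> + 1)" for t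
  have C: "0 \<le> C t" for t using G by (simp add: C_def)
  have bound: "(\<integral>\<^sup>+y\<in>{0<..\<kappa>\<^sup>2 * t\<^sup>2}. ennreal (besq_density \<nu> a t x y) \<partial>lborel) \<le> ennreal (C t * (\<kappa>\<^sup>2 * t\<^sup>2))" if t: "1 \<le> t" for t
  proof -
    have "besq_density \<nu> a t x y \<le> C t" if y: "0 < y" "y \<le> \<kappa>\<^sup>2 * t\<^sup>2" for y
    proof -
      have "sqrt y \<le> sqrt (\<kappa>\<^sup>2 * t\<^sup>2)" using y by simp
      then have ku: "sqrt y \<le> \<kappa> * t" using assms(4) t by (simp add: real_sqrt_mult)
      have "\<theta> * t \<le> 2 * sqrt a * t - sqrt y" using ku by (simp add: \<theta>_def algebra_simps)
      then have "(\<theta> * t)\<^sup>2 \<le> (2 * sqrt a * t - sqrt y)\<^sup>2" using \<theta> t by (intro power_mono) auto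
      then have "(\<theta> * t)\<^sup>2 / (2 * t) \<le> (sqrt y - 2 * sqrt a * t)\<^sup>2 / (2 * t)"
        using t by (intro divide_right_mono) (auto simp: power2_commute)
      then have 1: "\<theta>\<^sup>2 / 2 * t \<le> (sqrt y - 2 * sqrt a * t)\<^sup>2 / (2 * t)"
        using t by (simp add: power_mult_distrib power2_eq_square)
      have "sqrt x * sqrt y / t \<le> sqrt x * (\<kappa> * t) / t"
        using ku t assms(3) by (intro divide_right_mono mult_left_mono) auto
      then have 2: "sqrt x * sqrt y / t \<le> sqrt x * \<kappa>" using t by simp
      have "besq_density \<nu> a t x y \<le> y powr \<nu> * exp (- (sqrt y - 2 * sqrt a * t)\<^sup>2 / (2 * t) + sqrt x * sqrt y / t) / Gamma (\<nu> + 1)"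
        by (rule besq_density_le[OF assms(1,2) t assms(3) y(1)])
      also have "\<dots> \<le> C t"
        unfolding C_def using 1 2 y assms(1) G
        by (intro divide_right_mono mult_mono powr_mono2) auto
      finally show ?thesis .
    qed
    then have "(\<integral>\<^sup>+y\<in>{0<..\<kappa>\<^sup>2 * t\<^sup>2}. ennreal (besq_density \<nu> a t x y) \<partial>lborel)
      \<le> (\<integral>\<^sup>+y\<in>{0<..\<kappa>\<^sup>2 * t\<^sup>2}. ennreal (C t) \<partial>lborel)"
      by (intro nn_integral_mono) (auto simp: indicator_def intro!: ennreal_leI)
    also have "\<dots> = ennreal (C t * (\<kappa>\<^sup>2 * t\<^sup>2))"
      using C by (simp add: nn_integral_cmult_indicator ennreal_mult')
    finally show ?thesis .
  qed
  have "((\<lambda>t. C t * (\<kappa>\<^sup>2 * t\<^sup>2)) \<longlongrightarrow> 0) at_top"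
  proof -
    have "((\<lambda>t. (k * t\<^sup>2) powr \<nu> * exp (- p * t + q) / g * (k * t\<^sup>2)) \<longlongrightarrow> 0) at_top" if "p > 0" "k > 0" "g > 0" for p q k g :: real
      using that by real_asymp
    then show ?thesis unfolding C_def[abs_def] by this (use \<theta> assms(4) G in auto)
  qed
  then have "((\<lambda>t. ennreal (C t * (\<kappa>\<^sup>2 * t\<^sup>2))) \<longlongrightarrow> 0) at_top" using tendsto_ennrealI by fastforce
  then show ?thesis
    by (rule tendsto_sandwich[where f = "\<lambda>_. 0" and h = "\<lambda>t. ennreal (C t * (\<kappa>\<^sup>2 * t\<^sup>2))", rotated 3])
       (auto intro!: eventually_mono[OF eventually_ge_at_top[of 1]] bound)
qed

section \<open>Bessel series as a Chebyshev system\<close>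

lemma rolle_interlaced_zeros:
  fixes f f' :: "real \<Rightarrow> real"
  assumes "continuous_on {0..} f" and "\<And>x. 0 < x \<Longrightarrow> (f has_real_derivative f' x) (at x)"
    and "\<And>i. i \<le> n \<Longrightarrow> 0 \<le> z i \<and> f (z i) = 0" and "\<And>i. i < n \<Longrightarrow> z i < z (Suc i)"
  obtains w where "\<And>i. i < n \<Longrightarrow> 0 < w i \<and> f' (w i) = 0" "\<And>i. Suc i < n \<Longrightarrow> w i < w (Suc i)"
proof -
  have "\<exists>w>z i. w < z (Suc i) \<and> f' w = 0" if i: "i < n" for i
  proof -
    have z: "0 \<le> z i" "z i < z (Suc i)" "f (z i) = f (z (Suc i))"
      using assms(3)[of i] assms(3)[of "Suc i"] assms(4) i by auto
    have "continuous_on {z i..z (Suc i)} f"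
      using z by (intro continuous_on_subset[OF assms(1)]) auto
    moreover have "f differentiable (at x)" if "z i < x" "x < z (Suc i)" for x
      using assms(2)[of x] that z unfolding real_differentiable_def by fastforce
    ultimately obtain w where "z i < w" "w < z (Suc i)" "DERIV f w :> 0"
      using Rolle[OF z(2,3)] by blast
    then show ?thesis using assms(2)[of w] z DERIV_unique by (intro exI[of _ w]) fastforce
  qed
  then obtain w where w: "\<And>i. i < n \<Longrightarrow> z i < w i \<and> w i < z (Suc i) \<and> f' (w i) = 0" by metis
  show ?thesis
  proof (rule that[of w])
    show "0 < w i \<and> f' (w i) = 0" if "i < n" for i
      using w[OF that] assms(3)[of i] that by auto
    show "w i < w (Suc i)" if "Suc i < n" for i
      using w[of i] w[of "Suc i"] that by auto
  qed
qed

text \<open>For \<open>L = x D\<^sup>2 + (\<nu> + 1) D\<close> one has \<open>L F\<^sub>a = a F\<^sub>a\<close>, where \<open>F\<^sub>a x = bessel_series \<nu> (a x)\<close>. Applying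
  Rolle's theorem to \<open>g / F\<^sub>a\<close> and to \<open>x\<^bsup>\<nu> + 1\<^esup> (g' F\<^sub>a - g F\<^sub>a')\<close>, which also vanishes at \<open>0\<close>, shows that
  \<open>(L - a) g\<close> has at most one zero less than \<open>g\<close>, while it has one term less.\<close>

lemma bessel_chebyshev_system:
  fixes a c :: "'i \<Rightarrow> real"
  assumes "0 \<le> \<nu>" "finite S" "inj_on a S" "\<And>s. s \<in> S \<Longrightarrow> 0 < a s"
    and "\<And>i. i < card S \<Longrightarrow> 0 < z i \<and> (\<Sum>s\<in>S. c s * bessel_series \<nu> (a s * z i)) = 0"
    and "\<And>i. Suc i < card S \<Longrightarrow> z i < z (Suc i)"
  shows "\<forall>s\<in>S. c s = 0"
  using assms(2-)
proof (induction S arbitrary: c z rule: finite_induct)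
  case (insert s0 S)
  define n where "n = card S"
  have card: "card (insert s0 S) = Suc n" using insert by (simp add: n_def)
  define F F1 F2 where "F x = bessel_series \<nu> (a s0 * x)" and "F1 x = a s0 * bessel_series (\<nu> + 1) (a s0 * x)"
    and "F2 x = (a s0)\<^sup>2 * bessel_series (\<nu> + 2) (a s0 * x)" for x
  define g g1 g2 where "g x = (\<Sum>s\<in>insert s0 S. c s * bessel_series \<nu> (a s * x))"
    and "g1 x = (\<Sum>s\<in>insert s0 S. c s * (a s * bessel_series (\<nu> + 1) (a s * x)))"
    and "g2 x = (\<Sum>s\<in>insert s0 S. c s * ((a s)\<^sup>2 * bessel_series (\<nu> + 2) (a s * x)))" for x
  have d: "((\<lambda>x. bessel_series \<kappa> (b * x)) has_real_derivative b * bessel_series (\<kappa> + 1) (b * x)) (at x)"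
    if "0 \<le> \<kappa>" for b \<kappa> x
    using DERIV_chain2[where f = "bessel_series \<kappa>" and g = "(*) b" and x = x and Db = b, OF bessel_series_has_derivative[OF that]]
    by (simp add: mult.commute)
  have dF: "(F has_real_derivative F1 x) (at x)" "(F1 has_real_derivative F2 x) (at x)" for x
    unfolding F_def[abs_def] F1_def[abs_def] F2_def
    using d[OF assms(1)] DERIV_cmult[OF d[of "\<nu> + 1" "a s0" x], of "a s0"] assms(1)
    by (simp_all add: power2_eq_square mult.assoc add.assoc)
  have d1: "((\<lambda>x. c s * (a s * bessel_series (\<nu> + 1) (a s * x))) has_real_derivative c s * ((a s)\<^sup>2 * bessel_series (\<nu> + 2) (a s * x))) (at x)" for x s
    using DERIV_cmult[OF d[of "\<nu> + 1" "a s" x], of "c s * a s"] assms(1)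
    by (simp add: power2_eq_square mult_ac add_ac)
  have dg: "(g has_real_derivative g1 x) (at x)" "(g1 has_real_derivative g2 x) (at x)" for x
    unfolding g_def[abs_def] g1_def[abs_def] g2_def using assms(1)
    by (auto intro!: DERIV_sum DERIV_cmult d d1)
  have cont: "continuous_on A F" "continuous_on A F1" "continuous_on A g" "continuous_on A g1" for A
    using dF dg by (meson DERIV_isCont continuous_at_imp_continuous_on)+
  have a0: "0 < a s0" using insert.prems(2) by simp
  have Fpos: "0 < F x" if "0 \<le> x" for x
    unfolding F_def using that a0 assms(1) by (intro bessel_series_pos) auto
  \<comment> \<open>\<open>N\<close> is the numerator of the derivative of \<open>g / F\<close>, a
    Wronskian. The weight in \<open>W\<close> is the integrating factor that turns the derivative of
    \<open>N\<close> into an expression in the operator \<open>L\<close>.\<close>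
  define N where "N x = g1 x * F x - g x * F1 x" for x
  define W where "W x = x powr (\<nu> + 1) * N x" for x
  define g' where "g' x = (\<Sum>s\<in>S. c s * (a s - a s0) * bessel_series \<nu> (a s * x))" for x
  have r1: "continuous_on {0..} (\<lambda>x. g x / F x)"
    using Fpos by (intro continuous_intros cont) force
  have r2: "((\<lambda>x. g x / F x) has_real_derivative N x / (F x)\<^sup>2) (at x)" if "0 < x" for x
    using Fpos[of x] that DERIV_divide[OF dg(1) dF(1), of x] by (simp add: N_def power2_eq_square)
  have r3: "0 \<le> z i \<and> g (z i) / F (z i) = 0" if "i \<le> n" for i
    using insert.prems(3)[of i] that card by (simp add: g_def)
  have r4: "z i < z (Suc i)" if "i < n" for i
    using insert.prems(4)[of i] that card by simp
  obtain w where w: "\<And>i. i < n \<Longrightarrow> 0 < w i \<and> N (w i) / (F (w i))\<^sup>2 = 0" "\<And>i. Suc i < n \<Longrightarrow> w i < w (Suc i)"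
    using rolle_interlaced_zeros[where f = "\<lambda>x. g x / F x" and f' = "\<lambda>x. N x / (F x)\<^sup>2" and n = n and z = z, OF r1 r2 r3 r4] by blast
  \<comment> \<open>Rolle's theorem has cost one zero. Prepending 0, where the weight
    \<open>x powr (\<nu> + 1)\<close> vanishes, restores \<open>n + 1\<close> zeros for the second
    use.\<close>
  define w' where "w' i = (case i of 0 \<Rightarrow> 0 | Suc j \<Rightarrow> w j)" for i
  have L: "x * ((b::real)\<^sup>2 * bessel_series (\<nu> + 2) (b * x)) + (\<nu> + 1) * (b * bessel_series (\<nu> + 1) (b * x)) = b * bessel_series \<nu> (b * x)" for b x
    using arg_cong[OF bessel_series_ode[OF assms(1), of "b * x"], of "(*) b"]
    by (simp add: power2_eq_square algebra_simps)
  have LF: "x * F2 x + (\<nu> + 1) * F1 x = a s0 * F x" for x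
    unfolding F_def F1_def F2_def by (rule L)
  have Lg: "x * g2 x + (\<nu> + 1) * g1 x - a s0 * g x = g' x" for x
  proof -
    have "x * g2 x + (\<nu> + 1) * g1 x - a s0 * g x = (\<Sum>s\<in>insert s0 S. c s * (x * ((a s)\<^sup>2 * bessel_series (\<nu> + 2) (a s * x))
       + (\<nu> + 1) * (a s * bessel_series (\<nu> + 1) (a s * x)) - a s0 * bessel_series \<nu> (a s * x)))"
      unfolding g_def g1_def g2_def sum_distrib_left sum.distrib[symmetric] sum_subtractf[symmetric]
      by (intro sum.cong refl) (simp add: algebra_simps)
    also have "\<dots> = (\<Sum>s\<in>insert s0 S. c s * (a s - a s0) * bessel_series \<nu> (a s * x))"
      unfolding L by (intro sum.cong) (auto simp: algebra_simps)
    also have "\<dots> = g' x" using insert.hyps by (simp add: g'_def)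
    finally show ?thesis .
  qed
  have s1: "continuous_on {0..} W"
    unfolding W_def[abs_def] N_def
    by (intro continuous_intros cont continuous_on_powr') (use assms(1) in auto)
  have s2: "(W has_real_derivative x powr \<nu> * F x * g' x) (at x)" if "0 < x" for x
  proof -
    have "(N has_real_derivative (g2 x * F x - g x * F2 x)) (at x)"
      unfolding N_def[abs_def] by (auto intro!: derivative_eq_intros dF dg)
    then have "(W has_real_derivative ((\<nu> + 1) * x powr (\<nu> + 1 - 1) * N x + (g2 x * F x - g x * F2 x) * x powr (\<nu> + 1))) (at x)"
      unfolding W_def[abs_def] by (rule DERIV_mult[OF has_real_derivative_powr[OF that]])
    moreover have "(\<nu> + 1) * x powr (\<nu> + 1 - 1) * N x + (g2 x * F x - g x * F2 x) * x powr (\<nu> + 1)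
       = x powr \<nu> * ((x * g2 x + (\<nu> + 1) * g1 x) * F x - g x * (x * F2 x + (\<nu> + 1) * F1 x))"
      using that by (simp add: N_def powr_add algebra_simps)
    moreover have "\<dots> = x powr \<nu> * F x * g' x"
      unfolding LF Lg[symmetric] by (simp add: algebra_simps)
    ultimately show ?thesis by simp
  qed
  have "0 < w i" "N (w i) = 0" if "i < n" for i
    using w(1)[OF that] Fpos[of "w i"] by auto
  then have s3: "0 \<le> w' i \<and> W (w' i) = 0" if "i \<le> n" for i
    using that by (cases i) (auto simp: w'_def W_def less_imp_le)
  have s4: "w' i < w' (Suc i)" if "i < n" for i
    using that w by (auto simp: w'_def split: nat.split)
  obtain v where v: "\<And>i. i < n \<Longrightarrow> 0 < v i \<and> v i powr \<nu> * F (v i) * g' (v i) = 0" "\<And>i. Suc i < n \<Longrightarrow> v i < v (Suc i)"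
    using rolle_interlaced_zeros[where f = W and f' = "\<lambda>x. x powr \<nu> * F x * g' x" and n = n and z = w', OF s1 s2 s3 s4] by blast
  have "g' (v i) = 0" if "i < n" for i
    using v(1)[OF that] Fpos[of "v i"] by auto
  \<comment> \<open>\<open>g'\<close> has \<open>n\<close> terms and \<open>n\<close> positive
    zeros, so the induction hypothesis applies to the coefficients
    \<open>c s * (a s - a s0)\<close>; the weights being distinct, the second factor can then be
    cancelled.\<close>
  then have "\<forall>s\<in>S. c s * (a s - a s0) = 0"
    using insert.prems(1,2) v unfolding g'_def
    by (intro insert.IH[of v]) (auto simp: n_def)
  then have c: "\<forall>s\<in>S. c s = 0"
    using insert.prems(1) insert.hyps(2) by (auto simp: inj_on_def)
  have "g (z 0) = 0" "0 < z 0" using insert.prems(3)[of 0] card by (auto simp: g_def)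
  then have "c s0 = 0"
    using c insert.hyps Fpos[of "z 0"] by (simp add: g_def F_def)
  with c show ?case by simp
qed simp

text \<open>A null vector of the transposed matrix is a combination of the series that vanishes at
  all coordinates of \<open>y\<close>, which are as many distinct points as there are terms.\<close>

lemma det_bessel_series_nonzero:
  fixes a :: "'n::{finite,linorder} \<Rightarrow> real" and y :: "real ^ 'n::{finite,linorder}"
  assumes "0 \<le> \<nu>" "inj a" "\<And>i. 0 < a i" "y \<in> weyl_chamber"
  shows "det (\<chi> i j. bessel_series \<nu> (a i * y $ j)) \<noteq> 0"
proof -
  let ?A = "\<chi> i j. bessel_series \<nu> (a i * y $ j) :: real ^ 'n::{finite,linorder} ^ 'n::{finite,linorder}"
  let ?B = "transpose ?A"
  have "inj (($) y)"
    using assms(4) by (auto simp: weyl_chamber_def inj_on_def) (metis linorder_neqE less_irrefl)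
  then have card: "card (range (($) y)) = CARD('n)" by (rule card_image)
  \<comment> \<open>The Chebyshev lemma numbers its zeros increasingly by natural numbers, whereas
    the coordinates are indexed by the type \<open>'n\<close>.\<close>
  define z where "z = sorted_list_of_set (range (($) y))"
  have z: "length z = CARD('n)" "set z = range (($) y)" "sorted_wrt (<) z"
    using card sorted_list_of_set.strict_sorted_key_list_of_set by (auto simp: z_def)
  have "c = 0" if "?B *v c = 0" for c
  proof -
    have "(\<Sum>i\<in>UNIV. c $ i * bessel_series \<nu> (a i * y $ j)) = 0" for j
      using that by (simp add: vec_eq_iff matrix_vector_mult_def transpose_def mult.commute)
    then have "0 < z ! i \<and> (\<Sum>s\<in>UNIV. c $ s * bessel_series \<nu> (a s * z ! i)) = 0" if "i < CARD('n)" for i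
    proof -
      have "z ! i \<in> range (($) y)" using z that nth_mem by metis
      then show ?thesis using \<open>\<And>j. (\<Sum>i\<in>UNIV. c $ i * bessel_series \<nu> (a i * y $ j)) = 0\<close> assms(4)
        by (auto simp: weyl_chamber_def)
    qed
    moreover have "z ! i < z ! Suc i" if "Suc i < CARD('n)" for i
      using z that by (simp add: sorted_wrt_nth_less)
    ultimately have "\<forall>s\<in>UNIV. c $ s = 0"
      using assms by (intro bessel_chebyshev_system[of \<nu> UNIV a "\<lambda>i. z ! i"]) auto
    then show ?thesis by (simp add: vec_eq_iff)
  qed
  then have "\<exists>B'. B' ** ?B = mat 1" by (simp add: matrix_left_invertible_ker)
  then have "invertible ?B" by (simp add: invertible_left_inverse)
  then show ?thesis unfolding invertible_det_nz det_transpose .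
qed

section \<open>Karlin--McGregor terms\<close>

lemma borel_measurable_vec_nth [measurable (raw)]:
  fixes f :: "'a \<Rightarrow> real ^ 'n::finite"
  assumes "f \<in> borel_measurable M"
  shows "(\<lambda>\<omega>. f \<omega> $ i) \<in> borel_measurable M"
  by (rule borel_measurable_continuous_on[OF _ assms]) (intro continuous_intros)

lemma borel_measurable_vec_lambda [measurable (raw)]:
  fixes f :: "'n::finite \<Rightarrow> 'a \<Rightarrow> real"
  assumes "\<And>i. f i \<in> borel_measurable M"
  shows "(\<lambda>\<omega>. \<chi> i. f i \<omega>) \<in> borel_measurable M"
  by (subst borel_measurable_euclidean_space) (auto simp: Basis_vec_def inner_axis assms)

lemma nn_integral_lborel_vec_prod:
  fixes f :: "'n::finite \<Rightarrow> real \<Rightarrow> ennreal"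
  assumes [measurable]: "\<And>i. f i \<in> borel_measurable borel"
  shows "(\<integral>\<^sup>+z. (\<Prod>i\<in>UNIV. f i (z $ i)) \<partial>(lborel :: (real ^ 'n) measure)) = (\<Prod>i\<in>UNIV. \<integral>\<^sup>+y. f i y \<partial>lborel)"
proof -
  define e where "e i = (axis i 1 :: real ^ 'n)" for i :: 'n
  have inj: "inj e" by (auto simp: inj_def e_def axis_eq_axis)
  have B: "Basis = range e" by (auto simp: Basis_vec_def e_def)
  define g where "g b = f (the_inv e b)" for b
  have ge: "g (e i) = f i" for i by (simp add: g_def the_inv_f_f[OF inj])
  have "(\<integral>\<^sup>+z. (\<Prod>b\<in>Basis. g b (z \<bullet> b)) \<partial>(lborel :: (real ^ 'n) measure)) = (\<Prod>b\<in>Basis. \<integral>\<^sup>+y. g b y \<partial>lborel)"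
    by (rule nn_integral_lborel_prod) (auto simp: g_def)
  then show ?thesis
    unfolding B prod.reindex[OF inj] by (simp add: ge) (simp add: e_def inner_axis)
qed

lemma nn_integral_lborel_vec_prod_permuted:
  fixes f :: "'n::finite \<Rightarrow> real \<Rightarrow> ennreal"
  assumes "\<And>i. f i \<in> borel_measurable borel" "\<sigma> permutes UNIV"
  shows "(\<integral>\<^sup>+z. (\<Prod>i\<in>UNIV. f i (z $ \<sigma> i)) \<partial>(lborel :: (real ^ 'n) measure)) = (\<Prod>i\<in>UNIV. \<integral>\<^sup>+y. f i y \<partial>lborel)"
proof -
  have bij: "bij (inv \<sigma>)" and \<sigma>: "\<sigma> (inv \<sigma> j) = j" for j
    using permutes_bij[OF permutes_inv[OF assms(2)]] permutes_inverses[OF assms(2)] by auto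
  have "(\<Prod>i\<in>UNIV. f i (z $ \<sigma> i)) = (\<Prod>j\<in>UNIV. f (inv \<sigma> j) (z $ j))" for z :: "real ^ 'n"
    using prod.reindex_bij_betw[OF bij, of "\<lambda>i. f i (z $ \<sigma> i)"] by (simp add: \<sigma>)
  then have "(\<integral>\<^sup>+z. (\<Prod>i\<in>UNIV. f i (z $ \<sigma> i)) \<partial>(lborel :: (real ^ 'n) measure)) = (\<Prod>j\<in>UNIV. \<integral>\<^sup>+y. f (inv \<sigma> j) y \<partial>lborel)"
    by (simp only: nn_integral_lborel_vec_prod[where f = "\<lambda>j. f (inv \<sigma> j)", OF assms(1)])
  also have "\<dots> = (\<Prod>i\<in>UNIV. \<integral>\<^sup>+y. f i y \<partial>lborel)"
    by (rule prod.reindex_bij_betw[OF bij])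
  finally show ?thesis .
qed

definition positive_orthant :: "(real ^ 'n) set" where
  "positive_orthant = {z. \<forall>i. 0 < z $ i}"

lemma positive_orthantD: "z \<in> positive_orthant \<Longrightarrow> 0 < z $ i"
  by (simp add: positive_orthant_def)

text \<open>Written along a permutation so that the indicator can be merged factor by factor into a
  \<open>\<sigma>\<close>-term.\<close>

lemma indicator_positive_orthant:
  "indicator positive_orthant z = (\<Prod>i\<in>UNIV. indicator {0<..} (z $ \<sigma> i) :: ennreal)"
  if "\<sigma> permutes UNIV" for \<sigma> :: "'n::finite \<Rightarrow> 'n"
proof (cases "z \<in> positive_orthant")
  case False
  then obtain j where "\<not> 0 < z $ j" by (auto simp: positive_orthant_def)
  then have "indicator {0<..} (z $ \<sigma> (inv \<sigma> j)) = (0 :: ennreal)"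
    using permutes_inverses(1)[OF that] by simp
  then have "(\<Prod>i\<in>UNIV. indicator {0<..} (z $ \<sigma> i) :: ennreal) = 0"
    by (intro prod_zero) auto
  then show ?thesis using False by simp
qed (auto simp: positive_orthant_def)

lemma sets_positive_orthant [measurable]: "positive_orthant \<in> sets (borel :: (real ^ 'n::finite) measure)"
  unfolding positive_orthant_def by measurable

lemma sets_weyl_chamber [measurable]: "weyl_chamber \<in> sets (borel :: (real ^ 'n::{finite,linorder}) measure)"
proof -
  have "weyl_chamber = {z :: real ^ 'n::{finite,linorder}. (\<forall>i. 0 < z $ i) \<and> (\<forall>i j. z $ i < z $ j \<or> \<not> i < j)}"
    by (auto simp: weyl_chamber_def)
  also have "\<dots> \<in> sets borel" by measurable
  finally show ?thesis .
qed

lemma weyl_chamber_subset: "weyl_chamber \<subseteq> positive_orthant"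
  by (auto simp: weyl_chamber_def positive_orthant_def)

section \<open>Permutation terms of the determinants\<close>

text \<open>Up to sign, one summand of \<open>h\<close>. For a permutation \<open>\<pi>\<close> it
  is a positive harmonic function of the independent particles, since the rates
  \<open>2 * a (\<pi> i)\<close> and \<open>2 * a i\<close> have the same sum.\<close>

definition bessel_ratio :: "real \<Rightarrow> ('n::finite \<Rightarrow> real) \<Rightarrow> ('n \<Rightarrow> 'n) \<Rightarrow> real ^ 'n \<Rightarrow> real" where
  "bessel_ratio \<nu> a \<pi> y = (\<Prod>i\<in>UNIV. bessel_series \<nu> (a (\<pi> i) * y $ i) / bessel_series \<nu> (a i * y $ i))"

text \<open>The \<open>\<sigma>\<close>-summand of the Karlin--McGregor determinant of the \<open>h\<close>-transformed kernels; the weights are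
  \<open>a i = \<mu>\<^sub>i / 4\<close>, since \<open>\<phi>\<close> with parameter \<open>\<mu>\<^sub>i / 2\<close> is \<open>bessel_series \<nu> (\<mu>\<^sub>i / 4 \<cdot> x)\<close> up to a constant. For \<open>\<sigma> = id\<close> it
  is the joint transition density of the independent particles.\<close>

definition km_term :: "real \<Rightarrow> ('n::finite \<Rightarrow> real) \<Rightarrow> real \<Rightarrow> ('n \<Rightarrow> 'n) \<Rightarrow> real ^ 'n \<Rightarrow> real ^ 'n \<Rightarrow> real" where
  "km_term \<nu> a t \<sigma> y z = (\<Prod>i\<in>UNIV. exp (- 2 * a i * t) * bessel_series \<nu> (a i * z $ i) / bessel_series \<nu> (a i * y $ i)
     * besq_kernel \<nu> t (y $ i) (z $ \<sigma> i))"

definition km_density :: "real \<Rightarrow> ('n::finite \<Rightarrow> real) \<Rightarrow> real \<Rightarrow> real ^ 'n \<Rightarrow> real ^ 'n \<Rightarrow> real" where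
  "km_density \<nu> a t y z = (\<Sum>\<sigma> | \<sigma> permutes UNIV. of_int (sign \<sigma>) * km_term \<nu> a t \<sigma> y z)"

definition bessel_h :: "real \<Rightarrow> ('n::finite \<Rightarrow> real) \<Rightarrow> real ^ 'n \<Rightarrow> real" where
  "bessel_h \<nu> a y = (\<Sum>\<sigma> | \<sigma> permutes UNIV. of_int (sign \<sigma>) * bessel_ratio \<nu> a \<sigma> y)"

lemma borel_measurable_bessel_ratio [measurable (raw)]:
  assumes [measurable]: "f \<in> borel_measurable M"
  shows "(\<lambda>\<omega>. bessel_ratio \<nu> a \<sigma> (f \<omega>)) \<in> borel_measurable M"
  unfolding bessel_ratio_def by measurable

lemma borel_measurable_km_term [measurable (raw)]:
  assumes [measurable]: "f \<in> borel_measurable M" "g \<in> borel_measurable M"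
  shows "(\<lambda>\<omega>. km_term \<nu> a t \<sigma> (f \<omega>) (g \<omega>)) \<in> borel_measurable M"
  unfolding km_term_def by measurable

lemma borel_measurable_km_density [measurable (raw)]:
  assumes [measurable]: "f \<in> borel_measurable M" "g \<in> borel_measurable M"
  shows "(\<lambda>\<omega>. km_density \<nu> a t (f \<omega>) (g \<omega>)) \<in> borel_measurable M"
  unfolding km_density_def by measurable

lemma borel_measurable_bessel_h [measurable (raw)]:
  assumes [measurable]: "f \<in> borel_measurable M"
  shows "(\<lambda>\<omega>. bessel_h \<nu> a (f \<omega>)) \<in> borel_measurable M"
  unfolding bessel_h_def by measurable

text \<open>The permutation in \<open>bessel_ratio\<close> moves the weights and not the points,
  hence the transpose.\<close>

lemma bessel_h_eq_det:
  "bessel_h \<nu> a y = det (\<chi> i j. bessel_series \<nu> (a i * y $ j)) / (\<Prod>i\<in>UNIV. bessel_series \<nu> (a i * y $ i))"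
proof -
  have "det (\<chi> i j. bessel_series \<nu> (a i * y $ j)) = det (transpose (\<chi> i j. bessel_series \<nu> (a j * y $ i)))"
    by (simp add: transpose_def)
  also have "\<dots> = (\<Sum>p | p permutes UNIV. of_int (sign p) * (\<Prod>i\<in>UNIV. bessel_series \<nu> (a (p i) * y $ i)))"
    unfolding det_transpose by (simp add: det_def)
  finally show ?thesis
    by (simp add: bessel_h_def bessel_ratio_def prod_dividef sum_divide_distrib)
qed

lemma km_density_eq_det:
  "km_density \<nu> a t y z = (\<Prod>i\<in>UNIV. exp (- 2 * a i * t) * bessel_series \<nu> (a i * z $ i) / bessel_series \<nu> (a i * y $ i))
     * det (\<chi> i j. besq_kernel \<nu> t (y $ i) (z $ j))"
  unfolding km_density_def km_term_def det_def prod.distrib sum_distrib_left by (simp add: mult_ac)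

locale bessel_weights =
  fixes \<nu> :: real and a :: "'n::finite \<Rightarrow> real"
  assumes \<nu>: "0 \<le> \<nu>" and a: "\<And>i. 0 < a i"
begin

lemma bessel_series_orthant_pos:
  assumes "y \<in> positive_orthant"
  shows "0 < bessel_series \<nu> (a i * y $ j)"
  using \<nu> a[of i] positive_orthantD[OF assms] by (intro bessel_series_pos) (auto intro: less_imp_le)

lemma bessel_ratio_pos:
  assumes "y \<in> positive_orthant"
  shows "0 < bessel_ratio \<nu> a \<pi> y"
  unfolding bessel_ratio_def using bessel_series_orthant_pos[OF assms] by (intro prod_pos) auto

lemma bessel_ratio_id:
  assumes "y \<in> positive_orthant"
  shows "bessel_ratio \<nu> a id y = 1"
  unfolding bessel_ratio_def using bessel_series_orthant_pos[OF assms] by (intro prod.neutral) (auto simp: less_imp_neq[THEN not_sym])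

lemma km_term_nonneg:
  assumes "y \<in> positive_orthant" "z \<in> positive_orthant"
  shows "0 \<le> km_term \<nu> a t \<sigma> y z"
  unfolding km_term_def
  using bessel_series_orthant_pos[OF assms(1)] bessel_series_orthant_pos[OF assms(2)] positive_orthantD[OF assms(1)] positive_orthantD[OF assms(2)]
  by (intro prod_nonneg ballI mult_nonneg_nonneg divide_nonneg_nonneg besq_kernel_nonneg \<nu>) (auto intro: less_imp_le)

text \<open>Reindexing the weights along \<open>\<sigma>\<close> lets the particle started at
  \<open>y $ i\<close> run with weight \<open>a (\<sigma> i)\<close> and end at
  \<open>z $ \<sigma> i\<close>. Each term is therefore \<open>bessel_ratio\<close> times a
  probability density, and coordinate \<open>i\<close> of \<open>z\<close> always carries the weight
  \<open>a i\<close>.\<close>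

lemma km_term_eq:
  assumes "\<sigma> permutes UNIV" "y \<in> positive_orthant"
  shows "km_term \<nu> a t \<sigma> y z = bessel_ratio \<nu> a \<sigma> y * (\<Prod>i\<in>UNIV. besq_density \<nu> (a (\<sigma> i)) t (y $ i) (z $ \<sigma> i))"
proof -
  have bij: "bij \<sigma>" using assms(1) by (rule permutes_bij)
  have ne: "bessel_series \<nu> (a i * y $ j) \<noteq> 0" for i j
    using bessel_series_orthant_pos[OF assms(2), of i j] by simp
  have "(\<Prod>i\<in>UNIV. exp (- 2 * a i * t) * bessel_series \<nu> (a i * z $ i)) = (\<Prod>i\<in>UNIV. exp (- 2 * a (\<sigma> i) * t) * bessel_series \<nu> (a (\<sigma> i) * z $ \<sigma> i))"
    using prod.reindex_bij_betw[OF bij, of "\<lambda>i. exp (- 2 * a i * t) * bessel_series \<nu> (a i * z $ i)"] by simp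
  then have "km_term \<nu> a t \<sigma> y z = (\<Prod>i\<in>UNIV. exp (- 2 * a (\<sigma> i) * t) * bessel_series \<nu> (a (\<sigma> i) * z $ \<sigma> i)) / (\<Prod>i\<in>UNIV. bessel_series \<nu> (a i * y $ i)) * (\<Prod>i\<in>UNIV. besq_kernel \<nu> t (y $ i) (z $ \<sigma> i))"
    unfolding km_term_def prod.distrib prod_dividef by simp
  also have "\<dots> = (\<Prod>i\<in>UNIV. exp (- 2 * a (\<sigma> i) * t) * bessel_series \<nu> (a (\<sigma> i) * z $ \<sigma> i) / bessel_series \<nu> (a i * y $ i) * besq_kernel \<nu> t (y $ i) (z $ \<sigma> i))"
    by (simp only: prod.distrib prod_dividef)
  also have "\<dots> = (\<Prod>i\<in>UNIV. bessel_series \<nu> (a (\<sigma> i) * y $ i) / bessel_series \<nu> (a i * y $ i) * besq_density \<nu> (a (\<sigma> i)) t (y $ i) (z $ \<sigma> i))"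
    using ne by (intro prod.cong) (auto simp: besq_density_def)
  finally show ?thesis by (simp only: bessel_ratio_def prod.distrib)
qed

text \<open>Each coordinate is integrated by \<open>nn_integral_besq_density\<close>; the
  exponential factors multiply to 1 because permuting the weights does not change their sum. With
  \<open>\<sigma> = id\<close> this is the harmonicity of \<open>bessel_ratio\<close>, with
  \<open>\<pi> = id\<close> the total mass of a term, and in general it controls \<open>h\<close>
  integrated against the determinant.\<close>

lemma nn_integral_km_term:
  assumes \<sigma>: "\<sigma> permutes UNIV" and \<pi>: "\<pi> permutes UNIV" and y: "y \<in> positive_orthant" and t: "0 < t"
  shows "(\<integral>\<^sup>+z\<in>positive_orthant. ennreal (km_term \<nu> a t \<sigma> y z * bessel_ratio \<nu> a \<pi> z) \<partial>lborel) = ennreal (bessel_ratio \<nu> a (\<pi> \<circ> \<sigma>) y)"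
proof -
  define g where "g i w = besq_density \<nu> (a (\<sigma> i)) t (y $ i) w * (bessel_series \<nu> (a (\<pi> (\<sigma> i)) * w) / bessel_series \<nu> (a (\<sigma> i) * w))" for i w
  have g0: "0 \<le> g i w" if "0 < w" for i w
    unfolding g_def using that \<nu> a positive_orthantD[OF y, of i]
    by (intro mult_nonneg_nonneg divide_nonneg_nonneg besq_density_nonneg less_imp_le[OF bessel_series_pos]) (auto intro: less_imp_le)
  have [measurable]: "g i \<in> borel_measurable borel" for i unfolding g_def by measurable
  have bij: "bij \<sigma>" using \<sigma> by (rule permutes_bij)
  have R0: "0 \<le> bessel_ratio \<nu> a \<sigma> y" using bessel_ratio_pos[OF y] by (simp add: less_imp_le)
  have eq: "ennreal (km_term \<nu> a t \<sigma> y z * bessel_ratio \<nu> a \<pi> z) * indicator positive_orthant z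
     = ennreal (bessel_ratio \<nu> a \<sigma> y) * (\<Prod>i\<in>UNIV. ennreal (g i (z $ \<sigma> i)) * indicator {0<..} (z $ \<sigma> i))" for z
  proof (cases "z \<in> positive_orthant")
    case True
    have "bessel_ratio \<nu> a \<pi> z = (\<Prod>i\<in>UNIV. bessel_series \<nu> (a (\<pi> (\<sigma> i)) * z $ \<sigma> i) / bessel_series \<nu> (a (\<sigma> i) * z $ \<sigma> i))"
      unfolding bessel_ratio_def
      using prod.reindex_bij_betw[OF bij, of "\<lambda>i. bessel_series \<nu> (a (\<pi> i) * z $ i) / bessel_series \<nu> (a i * z $ i)"] by simp
    then have "km_term \<nu> a t \<sigma> y z * bessel_ratio \<nu> a \<pi> z = bessel_ratio \<nu> a \<sigma> y * (\<Prod>i\<in>UNIV. g i (z $ \<sigma> i))"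
      by (simp only: km_term_eq[OF \<sigma> y] g_def prod.distrib mult.assoc)
    moreover have "ennreal (\<Prod>i\<in>UNIV. g i (z $ \<sigma> i)) = (\<Prod>i\<in>UNIV. ennreal (g i (z $ \<sigma> i)) * indicator {0<..} (z $ \<sigma> i))"
      using True g0 by (subst prod_ennreal[symmetric]) (auto simp: positive_orthant_def intro!: prod.cong)
    ultimately show ?thesis using True R0 by (simp add: ennreal_mult')
  next
    case False
    then show ?thesis using indicator_positive_orthant[OF \<sigma>, of z] by (simp add: prod.distrib)
  qed
  have "(\<integral>\<^sup>+w\<in>{0<..}. ennreal (g i w) \<partial>lborel) = ennreal (exp (2 * (a (\<pi> (\<sigma> i)) - a (\<sigma> i)) * t) * (bessel_series \<nu> (a (\<pi> (\<sigma> i)) * y $ i) / bessel_series \<nu> (a (\<sigma> i) * y $ i)))" for i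
    unfolding g_def using \<nu> a t positive_orthantD[OF y, of i] by (intro nn_integral_besq_density) (auto intro: less_imp_le)
  then have "(\<integral>\<^sup>+z\<in>positive_orthant. ennreal (km_term \<nu> a t \<sigma> y z * bessel_ratio \<nu> a \<pi> z) \<partial>lborel)
     = ennreal (bessel_ratio \<nu> a \<sigma> y) * (\<Prod>i\<in>UNIV. ennreal (exp (2 * (a (\<pi> (\<sigma> i)) - a (\<sigma> i)) * t) * (bessel_series \<nu> (a (\<pi> (\<sigma> i)) * y $ i) / bessel_series \<nu> (a (\<sigma> i) * y $ i))))"
    unfolding eq by (subst nn_integral_cmult, measurable, subst nn_integral_lborel_vec_prod_permuted[OF _ \<sigma>], measurable)
  also have "\<dots> = ennreal (bessel_ratio \<nu> a \<sigma> y) * ennreal (\<Prod>i\<in>UNIV. exp (2 * (a (\<pi> (\<sigma> i)) - a (\<sigma> i)) * t) * (bessel_series \<nu> (a (\<pi> (\<sigma> i)) * y $ i) / bessel_series \<nu> (a (\<sigma> i) * y $ i)))"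
    using bessel_series_orthant_pos[OF y] by (subst prod_ennreal) (auto intro!: mult_nonneg_nonneg divide_nonneg_nonneg less_imp_le)
  also have "\<dots> = ennreal (bessel_ratio \<nu> a \<sigma> y * (\<Prod>i\<in>UNIV. exp (2 * (a (\<pi> (\<sigma> i)) - a (\<sigma> i)) * t) * (bessel_series \<nu> (a (\<pi> (\<sigma> i)) * y $ i) / bessel_series \<nu> (a (\<sigma> i) * y $ i))))"
    by (rule ennreal_mult'[OF R0, symmetric])
  also have "(\<Prod>i\<in>UNIV. exp (2 * (a (\<pi> (\<sigma> i)) - a (\<sigma> i)) * t) * (bessel_series \<nu> (a (\<pi> (\<sigma> i)) * y $ i) / bessel_series \<nu> (a (\<sigma> i) * y $ i)))
     = (\<Prod>i\<in>UNIV. bessel_series \<nu> (a (\<pi> (\<sigma> i)) * y $ i) / bessel_series \<nu> (a (\<sigma> i) * y $ i))"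
  proof -
    have "(\<Sum>i\<in>UNIV. a (\<pi> (\<sigma> i))) = (\<Sum>i\<in>UNIV. a (\<sigma> i))"
      using sum.reindex_bij_betw[OF permutes_bij[OF permutes_compose[OF \<sigma> \<pi>]], of a] sum.reindex_bij_betw[OF bij, of a] by simp
    then have "(\<Sum>i\<in>UNIV. 2 * (a (\<pi> (\<sigma> i)) - a (\<sigma> i)) * t) = 0"
      by (simp add: sum_distrib_right[symmetric] sum_distrib_left[symmetric] sum_subtractf)
    then have "(\<Prod>i\<in>UNIV. exp (2 * (a (\<pi> (\<sigma> i)) - a (\<sigma> i)) * t)) = 1"
      by (simp only: exp_sum[symmetric, OF finite] exp_zero)
    then show ?thesis by (simp only: prod.distrib mult_1_left)
  qed
  also have "bessel_ratio \<nu> a \<sigma> y * (\<Prod>i\<in>UNIV. bessel_series \<nu> (a (\<pi> (\<sigma> i)) * y $ i) / bessel_series \<nu> (a (\<sigma> i) * y $ i)) = bessel_ratio \<nu> a (\<pi> \<circ> \<sigma>) y"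
    unfolding bessel_ratio_def prod.distrib[symmetric]
    using bessel_series_orthant_pos[OF y] by (intro prod.cong) (auto simp: less_imp_neq[THEN not_sym])
  finally show ?thesis .
qed

text \<open>The first leg is the true transition density. The series at the intermediate point
  cancel and the kernels compose coordinate by coordinate, so each \<open>\<sigma>\<close>-term by
  itself gives a martingale.\<close>

lemma nn_integral_km_term_chapman_kolmogorov:
  assumes \<sigma>: "\<sigma> permutes UNIV" and y: "y \<in> positive_orthant" and x: "x \<in> positive_orthant" and st: "0 < s" "0 < t"
  shows "(\<integral>\<^sup>+z\<in>positive_orthant. ennreal (km_term \<nu> a s id y z * km_term \<nu> a t \<sigma> z x) \<partial>lborel) = ennreal (km_term \<nu> a (s + t) \<sigma> y x)"
proof -
  define c where "c i = exp (- 2 * a i * (s + t)) * bessel_series \<nu> (a i * x $ i) / bessel_series \<nu> (a i * y $ i)" for i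
  define g where "g i w = besq_kernel \<nu> s (y $ i) w * besq_kernel \<nu> t w (x $ \<sigma> i)" for i w
  have g0: "0 \<le> g i w" if "0 < w" for i w
    unfolding g_def using that \<nu> positive_orthantD[OF y, of i] positive_orthantD[OF x, of "\<sigma> i"]
    by (intro mult_nonneg_nonneg besq_kernel_nonneg) (auto intro: less_imp_le)
  have c0: "0 \<le> c i" for i
    unfolding c_def using bessel_series_orthant_pos[OF y, of i i] bessel_series_orthant_pos[OF x, of i i] by simp
  then have C0: "0 \<le> (\<Prod>i\<in>UNIV. c i)" by (intro prod_nonneg) auto
  have [measurable]: "g i \<in> borel_measurable borel" for i unfolding g_def by measurable
  have eq: "ennreal (km_term \<nu> a s id y z * km_term \<nu> a t \<sigma> z x) * indicator positive_orthant z
     = ennreal (\<Prod>i\<in>UNIV. c i) * (\<Prod>i\<in>UNIV. ennreal (g i (z $ i)) * indicator {0<..} (z $ i))" for z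
  proof (cases "z \<in> positive_orthant")
    case True
    have "km_term \<nu> a s id y z * km_term \<nu> a t \<sigma> z x = (\<Prod>i\<in>UNIV. c i * g i (z $ i))"
      unfolding km_term_def prod.distrib[symmetric]
    proof (intro prod.cong refl)
      fix i
      have "bessel_series \<nu> (a i * z $ i) \<noteq> 0" using bessel_series_orthant_pos[OF True, of i i] by simp
      moreover have "exp (- 2 * a i * (s + t)) = exp (- 2 * a i * s) * exp (- 2 * a i * t)"
        unfolding mult_exp_exp by (simp add: algebra_simps)
      ultimately show "exp (- 2 * a i * s) * bessel_series \<nu> (a i * z $ i) / bessel_series \<nu> (a i * y $ i) * besq_kernel \<nu> s (y $ i) (z $ id i) *
         (exp (- 2 * a i * t) * bessel_series \<nu> (a i * x $ i) / bessel_series \<nu> (a i * z $ i) * besq_kernel \<nu> t (z $ i) (x $ \<sigma> i)) = c i * g i (z $ i)"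
        by (simp add: c_def g_def)
    qed
    moreover have "ennreal (\<Prod>i\<in>UNIV. g i (z $ i)) = (\<Prod>i\<in>UNIV. ennreal (g i (z $ i)) * indicator {0<..} (z $ i))"
      using True g0 by (subst prod_ennreal[symmetric]) (auto simp: positive_orthant_def intro!: prod.cong)
    ultimately show ?thesis using True C0 by (simp add: ennreal_mult' prod.distrib)
  next
    case False
    then show ?thesis using indicator_positive_orthant[OF permutes_id, of z] by (simp add: prod.distrib)
  qed
  have "(\<integral>\<^sup>+w\<in>{0<..}. ennreal (g i w) \<partial>lborel) = ennreal (besq_kernel \<nu> (s + t) (y $ i) (x $ \<sigma> i))" for i
    unfolding g_def using \<nu> st positive_orthantD[OF y, of i] positive_orthantD[OF x, of "\<sigma> i"]
    by (intro besq_kernel_chapman_kolmogorov) (auto intro: less_imp_le)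
  then have "(\<integral>\<^sup>+z\<in>positive_orthant. ennreal (km_term \<nu> a s id y z * km_term \<nu> a t \<sigma> z x) \<partial>lborel)
     = ennreal (\<Prod>i\<in>UNIV. c i) * (\<Prod>i\<in>UNIV. ennreal (besq_kernel \<nu> (s + t) (y $ i) (x $ \<sigma> i)))"
    unfolding eq by (subst nn_integral_cmult, measurable, subst nn_integral_lborel_vec_prod, measurable)
  also have "\<dots> = ennreal (\<Prod>i\<in>UNIV. c i) * ennreal (\<Prod>i\<in>UNIV. besq_kernel \<nu> (s + t) (y $ i) (x $ \<sigma> i))"
    using \<nu> positive_orthantD[OF y] positive_orthantD[OF x]
    by (subst prod_ennreal) (auto intro!: besq_kernel_nonneg intro: less_imp_le)
  also have "\<dots> = ennreal ((\<Prod>i\<in>UNIV. c i) * (\<Prod>i\<in>UNIV. besq_kernel \<nu> (s + t) (y $ i) (x $ \<sigma> i)))"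
    by (rule ennreal_mult'[OF C0, symmetric])
  finally show ?thesis by (simp only: km_term_def c_def prod.distrib)
qed

lemma abs_km_density_le:
  assumes "y \<in> positive_orthant" "z \<in> positive_orthant"
  shows "\<bar>km_density \<nu> a t y z\<bar> \<le> (\<Sum>\<sigma> | \<sigma> permutes UNIV. km_term \<nu> a t \<sigma> y z)"
  unfolding km_density_def
  by (rule order_trans[OF sum_abs]) (auto intro!: sum_mono simp: abs_mult sign_def km_term_nonneg[OF assms])

lemma abs_bessel_h_le:
  assumes "y \<in> positive_orthant"
  shows "\<bar>bessel_h \<nu> a y\<bar> \<le> (\<Sum>\<sigma> | \<sigma> permutes UNIV. bessel_ratio \<nu> a \<sigma> y)"
  unfolding bessel_h_def
  by (rule order_trans[OF sum_abs]) (auto intro!: sum_mono simp: abs_mult sign_def less_imp_le[OF bessel_ratio_pos[OF assms]])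

lemma continuous_on_km_density:
  assumes "continuous_on S \<tau>" "continuous_on S f" "\<And>r. r \<in> S \<Longrightarrow> 0 < \<tau> r" "\<And>r. r \<in> S \<Longrightarrow> f r \<in> positive_orthant"
  shows "continuous_on S (\<lambda>r. km_density \<nu> a (\<tau> r) (f r) z)"
  unfolding km_density_def km_term_def
proof (intro continuous_intros continuous_on_prod' continuous_on_besq_kernel continuous_on_bessel_series \<nu> assms(1,2,3))
  fix i
  show "\<forall>r\<in>S. bessel_series \<nu> (a i * f r $ i) \<noteq> 0"
    using bessel_series_orthant_pos[OF assms(4)] by (metis less_irrefl)
qed

lemma km_density_eq_0:
  assumes "y $ i = y $ j" "i \<noteq> j"
  shows "km_density \<nu> a t y z = 0"
proof -
  have "det (\<chi> i j. besq_kernel \<nu> t (y $ i) (z $ j)) = 0"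
    by (rule det_identical_rows[OF assms(2)]) (simp add: row_def assms(1))
  then show ?thesis by (simp add: km_density_eq_det)
qed

end

section \<open>Short and long time estimates\<close>

text \<open>Bounded sets exhausting the chamber. The gap \<open>1 / m\<close> is imposed on the
  square roots, the scale on which \<open>besq_kernel_le\<close> is Gaussian.\<close>

definition chamber_level :: "real \<Rightarrow> (real ^ 'n::{finite,linorder}) set" where
  "chamber_level m = {z. (\<forall>i. 0 < z $ i \<and> z $ i \<le> m) \<and> (\<forall>i j. i < j \<longrightarrow> sqrt (z $ i) + 1 / m \<le> sqrt (z $ j))}"

lemma sets_chamber_level [measurable]: "chamber_level m \<in> sets (borel :: (real ^ 'n::{finite,linorder}) measure)"
proof -
  have "chamber_level m = {z :: real ^ 'n::{finite,linorder}. (\<forall>i. 0 < z $ i) \<and> (\<forall>i. z $ i \<le> m) \<and> (\<forall>i j. sqrt (z $ i) + 1 / m \<le> sqrt (z $ j) \<or> \<not> i < j)}"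
    by (auto simp: chamber_level_def)
  also have "\<dots> \<in> sets borel" by measurable
  finally show ?thesis .
qed

lemma chamber_level_subset: "0 < m \<Longrightarrow> chamber_level m \<subseteq> weyl_chamber"
proof
  fix z :: "real ^ 'n::{finite,linorder}"
  assume m: "0 < m" and z: "z \<in> chamber_level m"
  have "z $ i < z $ j" if "i < j" for i j
  proof -
    have "sqrt (z $ i) + 1 / m \<le> sqrt (z $ j)" using z that by (simp add: chamber_level_def)
    moreover have "0 < 1 / m" using m by simp
    ultimately have "sqrt (z $ i) < sqrt (z $ j)" by linarith
    then show ?thesis by simp
  qed
  then show "z \<in> weyl_chamber" using z by (simp add: chamber_level_def weyl_chamber_def)
qed

lemma chamber_level_eventually:
  assumes "z \<in> weyl_chamber"
  shows "\<forall>\<^sub>F m in sequentially. z \<in> chamber_level (real m)"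
proof -
  have "\<forall>\<^sub>F m in sequentially. \<forall>i. z $ i \<le> real m"
    by (intro eventually_all_finite eventually_compose_filterlim[OF eventually_ge_at_top filterlim_real_sequentially])
  moreover have "\<forall>\<^sub>F m in sequentially. \<forall>i j. i < j \<longrightarrow> sqrt (z $ i) + 1 / real m \<le> sqrt (z $ j)"
  proof (intro eventually_all_finite)
    fix i j
    show "\<forall>\<^sub>F m in sequentially. i < j \<longrightarrow> sqrt (z $ i) + 1 / real m \<le> sqrt (z $ j)"
    proof (cases "i < j")
      case True
      then have "sqrt (z $ i) < sqrt (z $ j)" using assms by (auto simp: weyl_chamber_def)
      moreover have "(\<lambda>m. sqrt (z $ i) + 1 / real m) \<longlonglongrightarrow> sqrt (z $ i) + 0"
        by (intro tendsto_intros lim_1_over_n)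
      ultimately have "\<forall>\<^sub>F m in sequentially. sqrt (z $ i) + 1 / real m < sqrt (z $ j)"
        by (intro order_tendstoD(2)) auto
      then show ?thesis by eventually_elim auto
    qed simp
  qed
  ultimately show ?thesis
    by eventually_elim (use assms in \<open>auto simp: chamber_level_def weyl_chamber_def\<close>)
qed

lemma emeasure_chamber_level: "emeasure lborel (chamber_level m :: (real ^ 'n::{finite,linorder}) set) < \<infinity>"
proof -
  have "chamber_level m \<subseteq> cbox 0 (\<chi> i. m :: real ^ 'n::{finite,linorder})"
    by (auto simp: chamber_level_def mem_box_cart less_imp_le)
  then have "emeasure lborel (chamber_level m :: (real ^ 'n::{finite,linorder}) set) \<le> emeasure lborel (cbox 0 (\<chi> i. m :: real ^ 'n::{finite,linorder}))"
    by (intro emeasure_mono) auto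
  then show ?thesis using emeasure_lborel_cbox_finite le_less_trans by blast
qed

text \<open>Let \<open>i\<close> be the least point that is moved. Everything below \<open>i\<close>
  is fixed, so both the image of \<open>i\<close> and the preimage \<open>j\<close> of
  \<open>i\<close> lie above \<open>i\<close>.\<close>

lemma permutation_inversion:
  fixes \<sigma> :: "'n::{finite,linorder} \<Rightarrow> 'n"
  assumes "\<sigma> permutes UNIV" "\<sigma> \<noteq> id"
  obtains i j where "i < j" "\<sigma> j < \<sigma> i"
proof -
  define i where "i = Min {k. \<sigma> k \<noteq> k}"
  have ne: "{k. \<sigma> k \<noteq> k} \<noteq> {}" using assms(2) by (auto simp: fun_eq_iff)
  have i: "\<sigma> i \<noteq> i" using Min_in[OF finite ne] by (simp add: i_def)
  have lt: "\<sigma> k = k" if "k < i" for k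
  proof (rule ccontr)
    assume "\<sigma> k \<noteq> k"
    then have "i \<le> k" unfolding i_def by (intro Min_le) auto
    then show False using that by simp
  qed
  have inj: "\<sigma> k = \<sigma> l \<longleftrightarrow> k = l" for k l
    using permutes_inj[OF assms(1)] by (auto dest: injD)
  have 1: "i < \<sigma> i"
  proof (rule ccontr)
    assume "\<not> i < \<sigma> i"
    then have "\<sigma> i < i" using i by simp
    then have "\<sigma> (\<sigma> i) = \<sigma> i" by (rule lt)
    then show False using inj i by simp
  qed
  obtain j where j: "\<sigma> j = i" using permutes_surj[OF assms(1)] by (metis surjD)
  have "i < j"
  proof (rule ccontr)
    assume "\<not> i < j"
    then have "j < i" using j i by (metis linorder_neqE)
    then show False using lt j by force
  qed
  then show ?thesis using that[of i j] j 1 by simp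
qed

locale ordered_bessel_weights = bessel_weights \<nu> a
  for \<nu> :: real and a :: "'n::{finite,linorder} \<Rightarrow> real" +
  assumes a_mono: "\<And>i j. i < j \<Longrightarrow> a i < a j"
begin

text \<open>The factors \<open>Gamma (\<nu> + 1)\<close> from the lower bound of the series at
  \<open>y\<close> and from \<open>besq_kernel_le\<close> cancel. The starting point
  \<open>y\<close> survives only in the Gaussian factor, so the bounds derived from this one are
  uniform in \<open>y\<close>.\<close>

lemma km_term_le:
  assumes "0 < t" "y \<in> positive_orthant" "z \<in> positive_orthant"
  shows "km_term \<nu> a t \<sigma> y z \<le> (\<Prod>i\<in>UNIV. bessel_series \<nu> (a i * z $ i) * ((z $ \<sigma> i) powr \<nu> / (2 * t) powr (\<nu> + 1)))
    * exp (- (\<Sum>i\<in>UNIV. (sqrt (y $ i) - sqrt (z $ \<sigma> i))\<^sup>2) / (2 * t))"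
proof -
  have G: "0 < Gamma (\<nu> + 1)" using \<nu> by (intro Gamma_real_pos) auto
  have "exp (- 2 * a i * t) * bessel_series \<nu> (a i * z $ i) / bessel_series \<nu> (a i * y $ i) * besq_kernel \<nu> t (y $ i) (z $ \<sigma> i)
    \<le> bessel_series \<nu> (a i * z $ i) * ((z $ \<sigma> i) powr \<nu> / (2 * t) powr (\<nu> + 1)) * exp (- (sqrt (y $ i) - sqrt (z $ \<sigma> i))\<^sup>2 / (2 * t))" for i
  proof -
    have y: "0 < y $ i" and z: "0 < z $ i" "0 < z $ \<sigma> i" using assms(2,3) by (auto simp: positive_orthantD)
    have B: "0 < bessel_series \<nu> (a i * z $ i)" "1 / Gamma (\<nu> + 1) \<le> bessel_series \<nu> (a i * y $ i)"
      using \<nu> a[of i] y z by (simp_all add: bessel_series_pos bessel_series_ge)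
    have E: "exp (- 2 * a i * t) \<le> 1" using a[of i] assms(1) by simp
    have "exp (- 2 * a i * t) * bessel_series \<nu> (a i * z $ i) / bessel_series \<nu> (a i * y $ i)
      \<le> 1 * bessel_series \<nu> (a i * z $ i) / (1 / Gamma (\<nu> + 1))"
      using B E G by (intro frac_le mult_right_mono) auto
    moreover have "besq_kernel \<nu> t (y $ i) (z $ \<sigma> i) \<le> (z $ \<sigma> i) powr \<nu> / ((2 * t) powr (\<nu> + 1) * Gamma (\<nu> + 1)) * exp (- (sqrt (y $ i) - sqrt (z $ \<sigma> i))\<^sup>2 / (2 * t))"
      using \<nu> assms(1) y z by (intro besq_kernel_le) auto
    ultimately have "exp (- 2 * a i * t) * bessel_series \<nu> (a i * z $ i) / bessel_series \<nu> (a i * y $ i) * besq_kernel \<nu> t (y $ i) (z $ \<sigma> i)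
      \<le> 1 * bessel_series \<nu> (a i * z $ i) / (1 / Gamma (\<nu> + 1)) * ((z $ \<sigma> i) powr \<nu> / ((2 * t) powr (\<nu> + 1) * Gamma (\<nu> + 1)) * exp (- (sqrt (y $ i) - sqrt (z $ \<sigma> i))\<^sup>2 / (2 * t)))"
      using B G \<nu> y z by (intro mult_mono besq_kernel_nonneg) auto
    then show ?thesis using G by simp
  qed
  then have "km_term \<nu> a t \<sigma> y z \<le> (\<Prod>i\<in>UNIV. bessel_series \<nu> (a i * z $ i) * ((z $ \<sigma> i) powr \<nu> / (2 * t) powr (\<nu> + 1)) * exp (- (sqrt (y $ i) - sqrt (z $ \<sigma> i))\<^sup>2 / (2 * t)))"
    unfolding km_term_def using \<nu> positive_orthantD[OF assms(2)] positive_orthantD[OF assms(3)]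
      bessel_series_orthant_pos[OF assms(2)] bessel_series_orthant_pos[OF assms(3)]
    by (intro prod_mono conjI mult_nonneg_nonneg divide_nonneg_nonneg besq_kernel_nonneg) (auto intro: less_imp_le)
  also have "\<dots> = (\<Prod>i\<in>UNIV. bessel_series \<nu> (a i * z $ i) * ((z $ \<sigma> i) powr \<nu> / (2 * t) powr (\<nu> + 1)))
    * exp (\<Sum>i\<in>UNIV. - (sqrt (y $ i) - sqrt (z $ \<sigma> i))\<^sup>2 / (2 * t))"
    by (simp only: prod.distrib exp_sum finite)
  also have "(\<Sum>i\<in>UNIV. - (sqrt (y $ i) - sqrt (z $ \<sigma> i))\<^sup>2 / (2 * t)) = - (\<Sum>i\<in>UNIV. (sqrt (y $ i) - sqrt (z $ \<sigma> i))\<^sup>2) / (2 * t)"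
    by (simp only: sum_negf sum_divide_distrib[symmetric])
  finally show ?thesis .
qed

text \<open>For times at least \<open>\<epsilon>\<close> the Gaussian factor is at most 1, and the
  powers of \<open>2 * t\<close> are controlled by those of \<open>2 * \<epsilon>\<close>. This
  bounds the martingales along the paths up to any time before the terminal one.\<close>

lemma km_density_bounded:
  assumes "0 < \<epsilon>" "z \<in> positive_orthant"
  obtains C where "0 \<le> C" "\<And>t y \<sigma>. \<epsilon> \<le> t \<Longrightarrow> y \<in> positive_orthant \<Longrightarrow> \<sigma> permutes UNIV \<Longrightarrow> km_term \<nu> a t \<sigma> y z \<le> C"
    "\<And>t y. \<epsilon> \<le> t \<Longrightarrow> y \<in> positive_orthant \<Longrightarrow> \<bar>km_density \<nu> a t y z\<bar> \<le> C"
proof -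
  define D where "D \<sigma> = (\<Prod>i\<in>UNIV. bessel_series \<nu> (a i * z $ i) * ((z $ \<sigma> i) powr \<nu> / (2 * \<epsilon>) powr (\<nu> + 1)))" for \<sigma> :: "'n \<Rightarrow> 'n"
  define C where "C = (\<Sum>\<sigma> | \<sigma> permutes UNIV. D \<sigma>)"
  have B: "0 \<le> bessel_series \<nu> (a i * z $ i)" for i
    using bessel_series_orthant_pos[OF assms(2), of i i] by simp
  have D0: "0 \<le> D \<sigma>" for \<sigma> unfolding D_def using B by (intro prod_nonneg) auto
  have le: "km_term \<nu> a t \<sigma> y z \<le> D \<sigma>" if "\<epsilon> \<le> t" "y \<in> positive_orthant" for t y \<sigma>
  proof -
    have t: "0 < t" using that assms by simp
    have "km_term \<nu> a t \<sigma> y z \<le> (\<Prod>i\<in>UNIV. bessel_series \<nu> (a i * z $ i) * ((z $ \<sigma> i) powr \<nu> / (2 * t) powr (\<nu> + 1))) * 1"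
      by (rule order_trans[OF km_term_le[OF t that(2) assms(2)] mult_left_mono])
         (use B t in \<open>auto intro!: prod_nonneg divide_nonneg_nonneg sum_nonneg\<close>)
    also have "\<dots> \<le> D \<sigma>"
      unfolding D_def mult_1_right using B that(1) assms(1) \<nu>
      by (intro prod_mono conjI mult_left_mono divide_left_mono powr_mono2 mult_pos_pos) auto
    finally show ?thesis .
  qed
  show ?thesis
  proof (rule that)
    show "0 \<le> C" unfolding C_def using D0 by (intro sum_nonneg) auto
    show "km_term \<nu> a t \<sigma> y z \<le> C" if "\<epsilon> \<le> t" "y \<in> positive_orthant" "\<sigma> permutes UNIV" for t y \<sigma>
    proof -
      have "D \<sigma> \<le> C" unfolding C_def using that D0 by (intro member_le_sum finite_permutations) auto
      then show ?thesis using le[OF that(1,2), of \<sigma>] by linarith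
    qed
    show "\<bar>km_density \<nu> a t y z\<bar> \<le> C" if "\<epsilon> \<le> t" "y \<in> positive_orthant" for t y
      by (rule order_trans[OF abs_km_density_le[OF that(2) assms(2)]])
         (auto simp: C_def intro!: sum_mono le that)
  qed
qed

text \<open>For \<open>y\<close> in the chamber and \<open>\<sigma> \<noteq> id\<close>, an inversion of \<open>\<sigma>\<close> forces one of the particles to travel a
  distance bounded below on the level set, so the term is Gaussian small in \<open>t\<close>.\<close>

lemma km_term_off_diagonal_decay:
  assumes \<sigma>: "\<sigma> permutes UNIV" "\<sigma> \<noteq> id" and m: "0 < m"
  obtains \<eta> where "(\<eta> \<longlongrightarrow> 0) (at_right 0)"
    "\<And>t y z. 0 < t \<Longrightarrow> y \<in> weyl_chamber \<Longrightarrow> z \<in> chamber_level m \<Longrightarrow> km_term \<nu> a t \<sigma> y z \<le> \<eta> t"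
proof -
  have G: "0 < Gamma (\<nu> + 1)" using \<nu> by (intro Gamma_real_pos) auto
  obtain i j where ij: "i < j" "\<sigma> j < \<sigma> i" using permutation_inversion[OF \<sigma>] .
  define D where "D = (\<Prod>i\<in>UNIV. exp (2 * sqrt (a i * m)) / Gamma (\<nu> + 1) * m powr \<nu>)"
  define N where "N = CARD('n)"
  \<comment> \<open>An inversion yields \<open>(1 / m)^2 \<le> 2 * S\<close> for the sum
    \<open>S\<close> of the squared displacements, and the Gaussian exponent is
    \<open>S / (2 * t)\<close>; hence the constant \<open>1 / (4 * m^2)\<close>.\<close>
  define q where "q = 1 / (4 * m\<^sup>2)"
  have q: "0 < q" using m by (simp add: q_def)
  define \<eta> where "\<eta> t = D * (1 / (2 * t) powr (\<nu> + 1)) ^ N * exp (- q / t)" for t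
  have D0: "0 \<le> D" unfolding D_def using G by (intro prod_nonneg) auto
  have "((\<lambda>t. D * (2 * t) powr (- p) * exp (- q / t)) \<longlongrightarrow> 0) (at_right 0)" for p :: real
    using q by real_asymp
  moreover have "\<forall>\<^sub>F t in at_right 0. D * (2 * t) powr (- ((\<nu> + 1) * N)) * exp (- q / t) = \<eta> t"
    by (rule eventually_mono[OF eventually_at_right_less])
       (auto simp: \<eta>_def power_one_over powr_minus divide_inverse powr_powr[symmetric] powr_realpow power_inverse)
  ultimately have lim: "(\<eta> \<longlongrightarrow> 0) (at_right 0)"
    by (rule Lim_transform_eventually)
  have "km_term \<nu> a t \<sigma> y z \<le> \<eta> t" if t: "0 < t" and y: "y \<in> weyl_chamber" and z: "z \<in> chamber_level m" for t y z
  proof -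
    have yp: "y \<in> positive_orthant" and zp: "z \<in> positive_orthant"
      using y z chamber_level_subset[OF m] weyl_chamber_subset by auto
    define d where "d k = sqrt (y $ k) - sqrt (z $ \<sigma> k)" for k
    have "y $ i < y $ j" using y ij by (auto simp: weyl_chamber_def)
    then have "sqrt (y $ i) < sqrt (y $ j)" by (rule real_sqrt_less_mono)
    moreover have "sqrt (z $ \<sigma> j) + 1 / m \<le> sqrt (z $ \<sigma> i)" using z ij by (auto simp: chamber_level_def)
    \<comment> \<open>The order of the starting points and the reversed order of the endpoints add
      up, so the two displacements differ by at least the gap.\<close>
    ultimately have "1 / m \<le> d j - d i" unfolding d_def by linarith
    then have "(1 / m)\<^sup>2 \<le> (d j - d i)\<^sup>2" using m by (intro power_mono) auto
    also have "\<dots> \<le> 2 * ((d i)\<^sup>2 + (d j)\<^sup>2)"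
      using zero_le_power2[of "d i + d j"] by (simp add: power2_eq_square algebra_simps)
    also have "(d i)\<^sup>2 + (d j)\<^sup>2 = (\<Sum>k\<in>{i, j}. (d k)\<^sup>2)" using ij by auto
    also have "\<dots> \<le> (\<Sum>k\<in>UNIV. (d k)\<^sup>2)" by (intro sum_mono2) auto
    finally have "(1 / m)\<^sup>2 / (4 * t) \<le> 2 * (\<Sum>k\<in>UNIV. (d k)\<^sup>2) / (4 * t)"
      using t by (intro divide_right_mono) auto
    then have "exp (- (\<Sum>k\<in>UNIV. (d k)\<^sup>2) / (2 * t)) \<le> exp (- q / t)"
      using t by (simp add: q_def power_divide)
    moreover have "(\<Prod>i\<in>UNIV. bessel_series \<nu> (a i * z $ i) * ((z $ \<sigma> i) powr \<nu> / (2 * t) powr (\<nu> + 1)))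
       \<le> (\<Prod>i\<in>UNIV. (exp (2 * sqrt (a i * m)) / Gamma (\<nu> + 1)) * (m powr \<nu> / (2 * t) powr (\<nu> + 1)))"
    proof (intro prod_mono conjI mult_mono divide_right_mono)
      fix i
      have zi: "0 < z $ k" "z $ k \<le> m" for k using z by (auto simp: chamber_level_def)
      have "bessel_series \<nu> (a i * z $ i) \<le> exp (2 * sqrt (a i * z $ i)) / Gamma (\<nu> + 1)"
        using \<nu> a[of i] zi[of i] by (intro bessel_series_le) auto
      also have "\<dots> \<le> exp (2 * sqrt (a i * m)) / Gamma (\<nu> + 1)"
        using a[of i] zi[of i] G by (intro divide_right_mono) auto
      finally show "bessel_series \<nu> (a i * z $ i) \<le> exp (2 * sqrt (a i * m)) / Gamma (\<nu> + 1)" .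
      show "(z $ \<sigma> i) powr \<nu> \<le> m powr \<nu>" using zi[of "\<sigma> i"] \<nu> by (intro powr_mono2) auto
      show "0 \<le> bessel_series \<nu> (a i * z $ i) * ((z $ \<sigma> i) powr \<nu> / (2 * t) powr (\<nu> + 1))"
        using bessel_series_orthant_pos[OF zp, of i i] by simp
    qed (use G in auto)
    moreover have "0 \<le> (\<Prod>i\<in>UNIV. (exp (2 * sqrt (a i * m)) / Gamma (\<nu> + 1)) * (m powr \<nu> / (2 * t) powr (\<nu> + 1)))"
      using G by (intro prod_nonneg) auto
    ultimately have "km_term \<nu> a t \<sigma> y z \<le> (\<Prod>i\<in>UNIV. (exp (2 * sqrt (a i * m)) / Gamma (\<nu> + 1)) * (m powr \<nu> / (2 * t) powr (\<nu> + 1))) * exp (- q / t)"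
      unfolding d_def by (intro order_trans[OF km_term_le[OF t yp zp] mult_mono]) auto
    also have "(\<Prod>i\<in>UNIV. (exp (2 * sqrt (a i * m)) / Gamma (\<nu> + 1)) * (m powr \<nu> / (2 * t) powr (\<nu> + 1))) = D * (1 / (2 * t) powr (\<nu> + 1)) ^ N"
      by (simp add: D_def N_def prod.distrib prod_dividef power_one_over power_mult_distrib)
    finally show ?thesis by (simp add: \<eta>_def)
  qed
  with lim show ?thesis by (rule that)
qed

section \<open>Long time mass of the chamber\<close>

lemma nn_integral_km_term_1:
  assumes "\<sigma> permutes UNIV" "y \<in> positive_orthant" "0 < t"
  shows "(\<integral>\<^sup>+z\<in>positive_orthant. ennreal (km_term \<nu> a t \<sigma> y z) \<partial>lborel) = ennreal (bessel_ratio \<nu> a \<sigma> y)"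
proof -
  have "(\<integral>\<^sup>+z\<in>positive_orthant. ennreal (km_term \<nu> a t \<sigma> y z) \<partial>lborel)
    = (\<integral>\<^sup>+z\<in>positive_orthant. ennreal (km_term \<nu> a t \<sigma> y z * bessel_ratio \<nu> a id z) \<partial>lborel)"
    by (intro nn_integral_cong) (auto simp: indicator_def bessel_ratio_id)
  then show ?thesis using nn_integral_km_term[OF assms(1) permutes_id assms(2,3)] by simp
qed

text \<open>The marginal of a \<open>\<sigma>\<close>-term. Coordinate \<open>i\<close> of the
  endpoint is reached by the particle with index \<open>inv \<sigma> i\<close>, running with weight
  \<open>a i\<close>; every other factor integrates to 1.\<close>

lemma nn_integral_km_term_coordinate:
  assumes \<sigma>: "\<sigma> permutes UNIV" and y: "y \<in> positive_orthant" and t: "0 < t" and S[measurable]: "S \<in> sets borel"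
  shows "(\<integral>\<^sup>+z. ennreal (km_term \<nu> a t \<sigma> y z) * indicator positive_orthant z * indicator S (z $ i) \<partial>lborel)
    = ennreal (bessel_ratio \<nu> a \<sigma> y) * (\<integral>\<^sup>+w\<in>{0<..} \<inter> S. ennreal (besq_density \<nu> (a i) t (y $ inv \<sigma> i) w) \<partial>lborel)"
proof -
  define k where "k = inv \<sigma> i"
  have k: "\<sigma> l = i \<longleftrightarrow> l = k" for l
    using permutes_inverses[OF \<sigma>] by (auto simp: k_def)
  define g where "g l w = ennreal (besq_density \<nu> (a (\<sigma> l)) t (y $ l) w) * indicator {0<..} w * (if l = k then indicator S w else 1)" for l w
  have [measurable]: "g l \<in> borel_measurable borel" for l unfolding g_def by measurable
  have R0: "0 \<le> bessel_ratio \<nu> a \<sigma> y" using bessel_ratio_pos[OF y] by (simp add: less_imp_le)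
  have dens0: "0 \<le> besq_density \<nu> (a (\<sigma> l)) t (y $ l) w" if "0 < w" for l w
    using that \<nu> a positive_orthantD[OF y, of l] by (intro besq_density_nonneg) (auto intro: less_imp_le)
  have eq: "ennreal (km_term \<nu> a t \<sigma> y z) * indicator positive_orthant z * indicator S (z $ i)
    = ennreal (bessel_ratio \<nu> a \<sigma> y) * (\<Prod>l\<in>UNIV. g l (z $ \<sigma> l))" for z
  proof (cases "z \<in> positive_orthant")
    case True
    then have "(\<Prod>l\<in>UNIV. g l (z $ \<sigma> l)) = (\<Prod>l\<in>UNIV. ennreal (besq_density \<nu> (a (\<sigma> l)) t (y $ l) (z $ \<sigma> l))) * (\<Prod>l\<in>UNIV. if l = k then indicator S (z $ \<sigma> l) else 1)"
      by (simp add: g_def prod.distrib positive_orthantD)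
    also have "(\<Prod>l\<in>UNIV. if l = k then indicator S (z $ \<sigma> l) else 1) = (indicator S (z $ \<sigma> k) :: ennreal)"
      by (simp add: prod.delta)
    also have "(\<Prod>l\<in>UNIV. ennreal (besq_density \<nu> (a (\<sigma> l)) t (y $ l) (z $ \<sigma> l))) = ennreal (\<Prod>l\<in>UNIV. besq_density \<nu> (a (\<sigma> l)) t (y $ l) (z $ \<sigma> l))"
      using True dens0 by (intro prod_ennreal) (auto simp: positive_orthantD)
    finally show ?thesis using True R0 k[of k] by (simp add: km_term_eq[OF \<sigma> y] ennreal_mult' mult.assoc)
  next
    case False
    have "(\<Prod>l\<in>UNIV. g l (z $ \<sigma> l)) = (\<Prod>l\<in>UNIV. indicator {0<..} (z $ \<sigma> l)) * (\<Prod>l\<in>UNIV. ennreal (besq_density \<nu> (a (\<sigma> l)) t (y $ l) (z $ \<sigma> l)) * (if l = k then indicator S (z $ \<sigma> l) else 1))"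
      unfolding g_def prod.distrib[symmetric] by (simp only: mult_ac)
    then show ?thesis using False indicator_positive_orthant[OF \<sigma>, of z] by simp
  qed
  have "(\<integral>\<^sup>+w. g l w \<partial>lborel) = (if l = k then (\<integral>\<^sup>+w\<in>{0<..} \<inter> S. ennreal (besq_density \<nu> (a i) t (y $ k) w) \<partial>lborel) else 1)" for l
  proof (cases "l = k")
    case True
    then show ?thesis using k[of l] by (auto simp: g_def indicator_def intro!: nn_integral_cong)
  next
    case False
    then show ?thesis using nn_integral_besq_density_1[of \<nu> "a (\<sigma> l)" t "y $ l"] \<nu> t a positive_orthantD[OF y, of l]
      by (simp add: g_def less_imp_le)
  qed
  then have "(\<Prod>l\<in>UNIV. \<integral>\<^sup>+w. g l w \<partial>lborel) = (\<integral>\<^sup>+w\<in>{0<..} \<inter> S. ennreal (besq_density \<nu> (a i) t (y $ k) w) \<partial>lborel)"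
    by (simp add: prod.delta)
  moreover have "(\<integral>\<^sup>+z. ennreal (bessel_ratio \<nu> a \<sigma> y) * (\<Prod>l\<in>UNIV. g l (z $ \<sigma> l)) \<partial>lborel)
    = ennreal (bessel_ratio \<nu> a \<sigma> y) * (\<integral>\<^sup>+z. (\<Prod>l\<in>UNIV. g l (z $ \<sigma> l)) \<partial>lborel)"
    by (rule nn_integral_cmult) measurable
  moreover have "(\<integral>\<^sup>+z. (\<Prod>l\<in>UNIV. g l (z $ \<sigma> l)) \<partial>lborel) = (\<Prod>l\<in>UNIV. \<integral>\<^sup>+w. g l w \<partial>lborel)"
    by (rule nn_integral_lborel_vec_prod_permuted[OF _ \<sigma>]) measurable
  ultimately show ?thesis by (simp add: eq k_def)
qed

text \<open>The \<open>i\<close>-th particle is asymptotic to \<open>4 (a i) t\<^sup>2\<close>, so that the particles are eventually ordered.\<close>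

lemma km_term_weyl_chamber_limit:
  assumes \<sigma>: "\<sigma> permutes UNIV" and y: "y \<in> positive_orthant"
  shows "((\<lambda>t. \<integral>\<^sup>+z\<in>weyl_chamber. ennreal (km_term \<nu> a t \<sigma> y z) \<partial>lborel) \<longlongrightarrow> ennreal (bessel_ratio \<nu> a \<sigma> y)) at_top"
proof -
  define P where "P = {(i, j). (i :: 'n) < j}"
  have "\<exists>\<kappa>. 2 * sqrt (a i) < \<kappa> \<and> \<kappa> < 2 * sqrt (a j)" if "i < j" for i j
    using dense[of "2 * sqrt (a i)" "2 * sqrt (a j)"] a_mono[OF that] by simp
  \<comment> \<open>\<open>\<kappa> i j\<close> is a speed strictly between the speeds
    \<open>2 * sqrt (a i)\<close> and \<open>2 * sqrt (a j)\<close> of the square roots of the two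
    coordinates.\<close>
  then obtain \<kappa> where \<kappa>: "\<And>i j. i < j \<Longrightarrow> 2 * sqrt (a i) < \<kappa> i j \<and> \<kappa> i j < 2 * sqrt (a j)" by metis
  define I where "I t S i = (\<integral>\<^sup>+z. ennreal (km_term \<nu> a t \<sigma> y z) * indicator positive_orthant z * indicator S (z $ i) \<partial>lborel)" for t S i
  define R where "R t = (\<Sum>(i, j)\<in>P. I t {(\<kappa> i j)\<^sup>2 * t\<^sup>2..} i + I t {..(\<kappa> i j)\<^sup>2 * t\<^sup>2} j)" for t
  have finP: "finite P" by simp
  have y0: "0 \<le> y $ k" for k using positive_orthantD[OF y, of k] by simp
  have U: "((\<lambda>t. I t {(\<kappa> i j)\<^sup>2 * t\<^sup>2..} i) \<longlongrightarrow> 0) at_top" if "i < j" for i j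
  proof -
    have "((\<lambda>t. ennreal (bessel_ratio \<nu> a \<sigma> y) * (\<integral>\<^sup>+w\<in>{(\<kappa> i j)\<^sup>2 * t\<^sup>2..}. ennreal (besq_density \<nu> (a i) t (y $ inv \<sigma> i) w) \<partial>lborel)) \<longlongrightarrow> ennreal (bessel_ratio \<nu> a \<sigma> y) * 0) at_top"
      using \<nu> a[of i] \<kappa>[OF that] y0 by (intro ennreal_tendsto_cmult besq_density_upper_tail) (auto intro: less_imp_le)
    then have lim: "((\<lambda>t. ennreal (bessel_ratio \<nu> a \<sigma> y) * (\<integral>\<^sup>+w\<in>{(\<kappa> i j)\<^sup>2 * t\<^sup>2..}. ennreal (besq_density \<nu> (a i) t (y $ inv \<sigma> i) w) \<partial>lborel)) \<longlongrightarrow> 0) at_top"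
      by simp
    have "\<forall>\<^sub>F t in at_top. I t {(\<kappa> i j)\<^sup>2 * t\<^sup>2..} i \<le> ennreal (bessel_ratio \<nu> a \<sigma> y) * (\<integral>\<^sup>+w\<in>{(\<kappa> i j)\<^sup>2 * t\<^sup>2..}. ennreal (besq_density \<nu> (a i) t (y $ inv \<sigma> i) w) \<partial>lborel)"
      using eventually_gt_at_top[of 0]
    proof eventually_elim
      case (elim t)
      show ?case unfolding I_def
        by (subst nn_integral_km_term_coordinate[OF \<sigma> y elim], measurable)
           (auto intro!: mult_left_mono nn_integral_mono simp: indicator_def)
    qed
    then show ?thesis by (intro tendsto_sandwich[OF _ _ tendsto_const lim]) auto
  qed
  have L: "((\<lambda>t. I t {..(\<kappa> i j)\<^sup>2 * t\<^sup>2} j) \<longlongrightarrow> 0) at_top" if "i < j" for i j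
  proof -
    have "0 < \<kappa> i j" using \<kappa>[OF that] real_sqrt_gt_zero[OF a[of i]] by linarith
    then have "((\<lambda>t. ennreal (bessel_ratio \<nu> a \<sigma> y) * (\<integral>\<^sup>+w\<in>{0<..(\<kappa> i j)\<^sup>2 * t\<^sup>2}. ennreal (besq_density \<nu> (a j) t (y $ inv \<sigma> j) w) \<partial>lborel)) \<longlongrightarrow> ennreal (bessel_ratio \<nu> a \<sigma> y) * 0) at_top"
      using \<nu> a[of j] \<kappa>[OF that] y0 by (intro ennreal_tendsto_cmult besq_density_lower_tail) (auto intro: less_imp_le)
    then have lim: "((\<lambda>t. ennreal (bessel_ratio \<nu> a \<sigma> y) * (\<integral>\<^sup>+w\<in>{0<..(\<kappa> i j)\<^sup>2 * t\<^sup>2}. ennreal (besq_density \<nu> (a j) t (y $ inv \<sigma> j) w) \<partial>lborel)) \<longlongrightarrow> 0) at_top"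
      by simp
    have "\<forall>\<^sub>F t in at_top. I t {..(\<kappa> i j)\<^sup>2 * t\<^sup>2} j \<le> ennreal (bessel_ratio \<nu> a \<sigma> y) * (\<integral>\<^sup>+w\<in>{0<..(\<kappa> i j)\<^sup>2 * t\<^sup>2}. ennreal (besq_density \<nu> (a j) t (y $ inv \<sigma> j) w) \<partial>lborel)"
      using eventually_gt_at_top[of 0]
    proof eventually_elim
      case (elim t)
      show ?case unfolding I_def
        by (subst nn_integral_km_term_coordinate[OF \<sigma> y elim], measurable)
           (auto intro!: mult_left_mono nn_integral_mono simp: indicator_def)
    qed
    then show ?thesis by (intro tendsto_sandwich[OF _ _ tendsto_const lim]) auto
  qed
  have "((\<lambda>t. R t) \<longlongrightarrow> (\<Sum>(i, j)\<in>P. 0 + 0)) at_top"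
    unfolding R_def by (intro tendsto_sum) (auto simp: P_def intro!: tendsto_add[OF U L, simplified])
  then have R: "(R \<longlongrightarrow> 0) at_top" by simp
  \<comment> \<open>The mass off the chamber. A disordered pair \<open>i < j\<close> has coordinate
    \<open>i\<close> above or coordinate \<open>j\<close> below the separating level
    \<open>(\<kappa> i j)^2 * t^2\<close>, and both events are negligible by the tail
    estimates.\<close>
  define Q where "Q t = (\<integral>\<^sup>+z\<in>positive_orthant - weyl_chamber. ennreal (km_term \<nu> a t \<sigma> y z) \<partial>lborel)" for t
  have "Q t \<le> R t" for t
  proof -
    have "ennreal (km_term \<nu> a t \<sigma> y z) * indicator (positive_orthant - weyl_chamber) z
      \<le> (\<Sum>(i, j)\<in>P. ennreal (km_term \<nu> a t \<sigma> y z) * indicator positive_orthant z * indicator {(\<kappa> i j)\<^sup>2 * t\<^sup>2..} (z $ i)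
         + ennreal (km_term \<nu> a t \<sigma> y z) * indicator positive_orthant z * indicator {..(\<kappa> i j)\<^sup>2 * t\<^sup>2} (z $ j))" (is "?l \<le> (\<Sum>p\<in>P. ?r p)") for z
    proof (cases "z \<in> positive_orthant - weyl_chamber")
      case True
      then have "\<exists>i j. i < j \<and> \<not> z $ i < z $ j" by (auto simp: weyl_chamber_def positive_orthant_def)
      then obtain i j where ij: "i < j" "z $ j \<le> z $ i" by (auto simp: not_less)
      have "(\<kappa> i j)\<^sup>2 * t\<^sup>2 \<le> z $ i \<or> z $ j \<le> (\<kappa> i j)\<^sup>2 * t\<^sup>2" using ij by linarith
      then have "?l \<le> ?r (i, j)" using True by (auto simp: indicator_def)
      also have "\<dots> \<le> (\<Sum>p\<in>P. ?r p)" using ij finP by (intro member_le_sum) (auto simp: P_def)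
      finally show ?thesis .
    qed simp
    then have "Q t \<le> (\<integral>\<^sup>+z. (\<Sum>(i, j)\<in>P. ennreal (km_term \<nu> a t \<sigma> y z) * indicator positive_orthant z * indicator {(\<kappa> i j)\<^sup>2 * t\<^sup>2..} (z $ i)
         + ennreal (km_term \<nu> a t \<sigma> y z) * indicator positive_orthant z * indicator {..(\<kappa> i j)\<^sup>2 * t\<^sup>2} (z $ j)) \<partial>lborel)"
      unfolding Q_def by (intro nn_integral_mono) auto
    also have "\<dots> = R t"
      unfolding R_def I_def by (simp add: case_prod_beta nn_integral_sum nn_integral_add)
    finally show ?thesis .
  qed
  then have Q: "(Q \<longlongrightarrow> 0) at_top"
    by (intro tendsto_sandwich[OF _ _ tendsto_const R]) (auto intro: always_eventually)
  then have "((\<lambda>t. ennreal (bessel_ratio \<nu> a \<sigma> y) - Q t) \<longlongrightarrow> ennreal (bessel_ratio \<nu> a \<sigma> y) - 0) at_top"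
    by (intro tendsto_diff_ennreal tendsto_const) auto
  moreover have "\<forall>\<^sub>F t in at_top. ennreal (bessel_ratio \<nu> a \<sigma> y) - Q t = (\<integral>\<^sup>+z\<in>weyl_chamber. ennreal (km_term \<nu> a t \<sigma> y z) \<partial>lborel)"
    using eventually_gt_at_top[of 0]
  proof eventually_elim
    case (elim t)
    have "ennreal (bessel_ratio \<nu> a \<sigma> y) = (\<integral>\<^sup>+z. ennreal (km_term \<nu> a t \<sigma> y z) * indicator weyl_chamber z + ennreal (km_term \<nu> a t \<sigma> y z) * indicator (positive_orthant - weyl_chamber) z \<partial>lborel)"
      unfolding nn_integral_km_term_1[OF \<sigma> y elim, symmetric]
      using weyl_chamber_subset by (intro nn_integral_cong) (auto simp: indicator_def)
    also have "\<dots> = (\<integral>\<^sup>+z\<in>weyl_chamber. ennreal (km_term \<nu> a t \<sigma> y z) \<partial>lborel) + Q t"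
      unfolding Q_def by (intro nn_integral_add) auto
    finally have sum: "ennreal (bessel_ratio \<nu> a \<sigma> y) = (\<integral>\<^sup>+z\<in>weyl_chamber. ennreal (km_term \<nu> a t \<sigma> y z) \<partial>lborel) + Q t" .
    then have "Q t \<noteq> \<top>" by (metis ennreal_neq_top ennreal_add_eq_top)
    with sum show ?case by simp
  qed
  ultimately show ?thesis by (simp add: tendsto_cong)
qed

end

section \<open>Markov property of the independent particles\<close>

lemma space_natural_filtration [simp]: "space (natural_filtration M X s) = space M"
  by (simp add: natural_filtration_def space_measure_of_conv)

lemma sets_natural_filtration:
  "sets (natural_filtration M X s) = sigma_sets (space M) {X r -` A \<inter> space M | r A. 0 \<le> r \<and> r \<le> s \<and> A \<in> sets borel}"
  unfolding natural_filtration_def by (rule sets_measure_of) auto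

lemma measurable_natural_filtration:
  assumes "0 \<le> r" "r \<le> s"
  shows "X r \<in> borel_measurable (natural_filtration M X s)"
  using assms by (intro measurableI) (auto simp: sets_natural_filtration)

lemma natural_filtration_subset:
  assumes "\<And>r. 0 \<le> r \<Longrightarrow> r \<le> s \<Longrightarrow> X r \<in> borel_measurable N" "space N = space M"
  shows "sets (natural_filtration M X s) \<subseteq> sets N"
  unfolding sets_natural_filtration assms(2)[symmetric]
  by (rule sets.sigma_sets_subset) (use assms(1) in auto)

lemma subalgebra_natural_filtration:
  assumes "\<And>r. 0 \<le> r \<Longrightarrow> X r \<in> borel_measurable M"
  shows "subalgebra M (natural_filtration M X s)"
  using natural_filtration_subset[of s X M M] assms by (simp add: subalgebra_def)

lemma natural_filtration_mono:
  assumes "s \<le> t"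
  shows "sets (natural_filtration M X s) \<subseteq> sets (natural_filtration M X t)"
  by (rule natural_filtration_subset) (use assms in \<open>auto intro: measurable_natural_filtration\<close>)

text \<open>The independence hypothesis speaks of whole paths. Expressing an event of the past as a
  preimage under the path makes it applicable to such events.\<close>

lemma natural_filtration_vimage:
  assumes B: "B \<in> sets (natural_filtration M X s)"
  obtains S where "S \<in> sets (PiM {0..} (\<lambda>_. borel))" "B = (\<lambda>\<omega>. \<lambda>t\<in>{0..}. X t \<omega>) -` S \<inter> space M"
proof -
  let ?p = "\<lambda>\<omega>. \<lambda>t\<in>{0..}. X t \<omega>"
  let ?P = "PiM {0..} (\<lambda>_. borel :: 'b measure)"
  let ?V = "vimage_algebra (space M) ?p ?P"
  have p: "?p \<in> space M \<rightarrow> space ?P" by (auto simp: space_PiM)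
  have "X r \<in> borel_measurable ?V" if "0 \<le> r" for r
  proof -
    have "(\<lambda>\<zeta>. \<zeta> r) \<circ> ?p \<in> borel_measurable ?V"
      using that by (intro measurable_comp[OF measurable_vimage_algebra1[OF p]] measurable_component_singleton) auto
    moreover have "(\<lambda>\<zeta>. \<zeta> r) \<circ> ?p = X r" using that by (auto simp: fun_eq_iff)
    ultimately show ?thesis by simp
  qed
  then have "sets (natural_filtration M X s) \<subseteq> sets ?V"
    by (intro natural_filtration_subset) auto
  then show ?thesis using B that unfolding sets_vimage_algebra2[OF p] by blast
qed

lemma (in prob_space) sigma_finite_subalgebra_of_subalgebra:
  assumes "subalgebra M F"
  shows "sigma_finite_subalgebra M F"
proof -
  interpret R: prob_space "restr_to_subalg M F"
    using assms prob_space_axioms by (rule prob_space_restr_to_subalg)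
  show ?thesis using assms R.sigma_finite_measure_axioms by (simp add: sigma_finite_subalgebra_def)
qed

locale besq_particles = prob_space M + ordered_bessel_weights \<nu> a
  for M :: "'w measure" and \<nu> :: real and a :: "'n::{finite,linorder} \<Rightarrow> real" +
  fixes X :: "'n::{finite,linorder} \<Rightarrow> real \<Rightarrow> 'w \<Rightarrow> real" and x :: "real ^ 'n::{finite,linorder}"
  assumes diffusion: "\<And>i. besq_diffusion M (2 * a i) (2 * \<nu> + 2) (x $ i) (X i)"
    and independent: "independent_processes M X"
    and x: "x \<in> weyl_chamber"
begin

definition Y :: "real \<Rightarrow> 'w \<Rightarrow> real ^ 'n::{finite,linorder}" where
  "Y t \<omega> = (\<chi> i. X i t \<omega>)"

abbreviation F :: "real \<Rightarrow> 'w measure" where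
  "F \<equiv> natural_filtration M Y"

lemma Y_nth [simp]: "Y t \<omega> $ i = X i t \<omega>"
  by (simp add: Y_def)

lemma X_cont: "\<omega> \<in> space M \<Longrightarrow> continuous_on {0..} (\<lambda>t. X i t \<omega>)"
  and X_pos: "\<omega> \<in> space M \<Longrightarrow> 0 \<le> t \<Longrightarrow> 0 < X i t \<omega>"
  and X_markov: "markov_with_transition_density M {0<..} (doob_transform (2 * a i) (besq_phi \<nu> (2 * a i)) (besq_q \<nu>)) (x $ i) (X i)"
  using diffusion[of i] by (auto simp: besq_diffusion_def Let_def add_divide_distrib)

lemma X_measurable [measurable]: "0 \<le> t \<Longrightarrow> X i t \<in> borel_measurable M"
  using X_markov[of i] by (simp add: markov_with_transition_density_def)

lemma Y_orthant: "\<omega> \<in> space M \<Longrightarrow> 0 \<le> t \<Longrightarrow> Y t \<omega> \<in> positive_orthant"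
  using X_pos by (simp add: positive_orthant_def)

lemma Y_measurable [measurable]: "0 \<le> t \<Longrightarrow> Y t \<in> borel_measurable M"
  unfolding Y_def[abs_def] by measurable

lemma Y_cont: "\<omega> \<in> space M \<Longrightarrow> continuous_on {0..} (\<lambda>t. Y t \<omega>)"
  unfolding Y_def by (intro continuous_on_vec_lambda X_cont)

lemma AE_Y_0: "AE \<omega> in M. Y 0 \<omega> = x"
proof -
  have "AE \<omega> in M. \<forall>i. X i 0 \<omega> = x $ i"
    using X_markov by (intro eventually_all_finite) (simp add: markov_with_transition_density_def)
  then show ?thesis by eventually_elim (simp add: vec_eq_iff)
qed

lemma F_subalgebra: "subalgebra M (F s)"
  by (rule subalgebra_natural_filtration) measurable

lemma F_sets: "B \<in> sets (F s) \<Longrightarrow> B \<in> sets M"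
  using F_subalgebra by (auto simp: subalgebra_def)

text \<open>Tested on past events and written with nonnegative integrals, the conditional
  expectation can be multiplied over the independent particles and then extended to joint
  events.\<close>

lemma single_markov:
  assumes st: "0 \<le> s" "s < t" and A[measurable]: "A \<in> sets borel" and B: "B \<in> sets (natural_filtration M (X i) s)"
  shows "(\<integral>\<^sup>+\<omega>. indicator B \<omega> * indicator A (X i t \<omega>) \<partial>M)
    = (\<integral>\<^sup>+\<omega>. indicator B \<omega> * (\<integral>\<^sup>+w\<in>{0<..}. ennreal (besq_density \<nu> (a i) (t - s) (X i s \<omega>) w) * indicator A w \<partial>lborel) \<partial>M)"
proof -
  let ?F = "natural_filtration M (X i) s"
  have sub: "subalgebra M ?F" by (rule subalgebra_natural_filtration) measurable
  interpret F: sigma_finite_subalgebra M ?F by (rule sigma_finite_subalgebra_of_subalgebra[OF sub])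
  have [measurable]: "B \<in> sets M" using B sub by (auto simp: subalgebra_def)
  have [measurable]: "X i t \<in> borel_measurable M" "X i s \<in> borel_measurable M" using st by auto
  define G where "G \<omega> = (\<integral>\<^sup>+w\<in>{0<..}. ennreal (besq_density \<nu> (a i) (t - s) (X i s \<omega>) w) * indicator A w \<partial>lborel)" for \<omega>
  have [measurable]: "G \<in> borel_measurable M" unfolding G_def by measurable
  have G1: "G \<omega> \<le> 1" if "\<omega> \<in> space M" for \<omega>
  proof -
    have "G \<omega> \<le> (\<integral>\<^sup>+w\<in>{0<..}. ennreal (besq_density \<nu> (a i) (t - s) (X i s \<omega>) w) \<partial>lborel)"
      unfolding G_def by (intro nn_integral_mono) (auto simp: indicator_def)
    also have "\<dots> = 1"
      using \<nu> a[of i] st X_pos[OF that, of s i] by (intro nn_integral_besq_density_1) auto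
    finally show ?thesis .
  qed
  \<comment> \<open>\<open>G \<omega>\<close> is finite by \<open>G1\<close>, so nothing is lost
    when the Bochner integral is read as its real value.\<close>
  have lint: "(LINT y:A \<inter> {0<..}|lborel. doob_transform (2 * a i) (besq_phi \<nu> (2 * a i)) (besq_q \<nu>) (t - s) (X i s \<omega>) y) = enn2real (G \<omega>)"
    if \<omega>: "\<omega> \<in> space M" for \<omega>
  proof -
    have "(LINT y:A \<inter> {0<..}|lborel. doob_transform (2 * a i) (besq_phi \<nu> (2 * a i)) (besq_q \<nu>) (t - s) (X i s \<omega>) y)
      = (\<integral>y. indicator (A \<inter> {0<..}) y * besq_density \<nu> (a i) (t - s) (X i s \<omega>) y \<partial>lborel)"
      unfolding set_lebesgue_integral_def
      using besq_density_eq[of \<nu> "4 * a i" "t - s" "X i s \<omega>"] \<nu> a[of i] st X_pos[OF \<omega>, of s i]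
      by (intro Bochner_Integration.integral_cong) (auto simp: indicator_def)
    also have "\<dots> = enn2real (\<integral>\<^sup>+y. ennreal (indicator (A \<inter> {0<..}) y * besq_density \<nu> (a i) (t - s) (X i s \<omega>) y) \<partial>lborel)"
      using \<nu> a[of i] X_pos[OF \<omega> st(1), of i]
      by (intro integral_eq_nn_integral) (auto simp: indicator_def intro!: AE_I2 besq_density_nonneg)
    also have "(\<integral>\<^sup>+y. ennreal (indicator (A \<inter> {0<..}) y * besq_density \<nu> (a i) (t - s) (X i s \<omega>) y) \<partial>lborel) = G \<omega>"
      unfolding G_def by (intro nn_integral_cong) (auto simp: indicator_def)
    finally show ?thesis .
  qed
  have "AE \<omega> in M. real_cond_exp M ?F (\<lambda>\<omega>. indicator A (X i t \<omega>)) \<omega>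
    = (LINT y:A \<inter> {0<..}|lborel. doob_transform (2 * a i) (besq_phi \<nu> (2 * a i)) (besq_q \<nu>) (t - s) (X i s \<omega>) y)"
    using X_markov[of i] st A unfolding markov_with_transition_density_def by blast
  then have "AE \<omega> in M. real_cond_exp M ?F (\<lambda>\<omega>. indicator A (X i t \<omega>)) \<omega> = enn2real (G \<omega>)"
    using AE_space by eventually_elim (simp add: lint)
  moreover have int1: "integrable M (\<lambda>\<omega>. indicator A (X i t \<omega>) :: real)"
    by (intro integrable_const_bound[of _ 1]) auto
  ultimately have "(\<integral>\<omega>. indicator B \<omega> * indicator A (X i t \<omega>) \<partial>M) = (\<integral>\<omega>. indicator B \<omega> * enn2real (G \<omega>) \<partial>M)"
    using F.real_cond_exp_intA[OF int1 B] unfolding set_lebesgue_integral_def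
    by (auto intro!: integral_cong_AE)
  moreover have "(\<integral>\<^sup>+\<omega>. indicator B \<omega> * indicator A (X i t \<omega>) \<partial>M) = ennreal (\<integral>\<omega>. indicator B \<omega> * indicator A (X i t \<omega>) \<partial>M)"
  proof -
    have "(\<integral>\<^sup>+\<omega>. ennreal (indicator B \<omega> * indicator A (X i t \<omega>)) \<partial>M) = ennreal (\<integral>\<omega>. indicator B \<omega> * indicator A (X i t \<omega>) \<partial>M)"
      by (intro nn_integral_eq_integral integrable_const_bound[of _ 1]) (auto simp: indicator_def)
    then show ?thesis by (simp add: ennreal_mult' ennreal_indicator)
  qed
  moreover have "(\<integral>\<^sup>+\<omega>. indicator B \<omega> * G \<omega> \<partial>M) = ennreal (\<integral>\<omega>. indicator B \<omega> * enn2real (G \<omega>) \<partial>M)"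
  proof -
    have le: "enn2real (G \<omega>) \<le> 1" if "\<omega> \<in> space M" for \<omega>
      using enn2real_mono[OF G1[OF that]] by simp
    have "(\<integral>\<^sup>+\<omega>. ennreal (indicator B \<omega> * enn2real (G \<omega>)) \<partial>M) = ennreal (\<integral>\<omega>. indicator B \<omega> * enn2real (G \<omega>) \<partial>M)"
      by (intro nn_integral_eq_integral integrable_const_bound[of _ 1]) (auto simp: indicator_def le)
    moreover have "(\<integral>\<^sup>+\<omega>. ennreal (indicator B \<omega> * enn2real (G \<omega>)) \<partial>M) = (\<integral>\<^sup>+\<omega>. indicator B \<omega> * G \<omega> \<partial>M)"
    proof (intro nn_integral_cong)
      fix \<omega> assume "\<omega> \<in> space M"
      then have "G \<omega> < \<top>" by (rule le_less_trans[OF G1]) simp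
      then show "ennreal (indicator B \<omega> * enn2real (G \<omega>)) = indicator B \<omega> * G \<omega>"
        by (simp add: indicator_def)
    qed
    ultimately show ?thesis by simp
  qed
  ultimately show ?thesis by (simp add: G_def)
qed

text \<open>The event \<open>B i\<close> and the position at time \<open>r\<close> are both
  functions of the \<open>i\<close>-th path, so the factors are independent.\<close>

lemma nn_integral_prod_independent:
  assumes "0 \<le> r" and [measurable]: "\<And>i. g i \<in> borel_measurable borel" and B: "\<And>i. B i \<in> sets (natural_filtration M (X i) s)"
  shows "(\<integral>\<^sup>+\<omega>. (\<Prod>i\<in>UNIV. indicator (B i) \<omega> * g i (X i r \<omega>)) \<partial>M) = (\<Prod>i\<in>UNIV. \<integral>\<^sup>+\<omega>. indicator (B i) \<omega> * (g i (X i r \<omega>) :: ennreal) \<partial>M)"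
proof -
  let ?p = "\<lambda>i \<omega>. \<lambda>t\<in>{0..}. X i t \<omega>"
  let ?P = "PiM {0..} (\<lambda>_. borel :: real measure)"
  have "\<exists>S. S \<in> sets ?P \<and> B i = ?p i -` S \<inter> space M" for i
    using natural_filtration_vimage[OF B[of i]] by metis
  then obtain S where S: "\<And>i. S i \<in> sets ?P" "\<And>i. B i = ?p i -` S i \<inter> space M" by metis
  define h where "h i \<zeta> = indicator (S i) \<zeta> * g i (\<zeta> r)" for i \<zeta>
  have [measurable]: "h i \<in> borel_measurable ?P" for i
  proof -
    have [measurable]: "(\<lambda>\<zeta>. \<zeta> r) \<in> borel_measurable ?P"
      using assms(1) by (intro measurable_component_singleton) auto
    show ?thesis unfolding h_def[abs_def] using S(1)[of i] by measurable
  qed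
  have "indep_vars (\<lambda>_. ?P) ?p UNIV"
    using independent by (simp add: independent_processes_def)
  then have ind: "indep_vars (\<lambda>_. borel) (\<lambda>i \<omega>. h i (?p i \<omega>)) UNIV"
    by (rule indep_vars_compose2) measurable
  have h: "h i (?p i \<omega>) = indicator (B i) \<omega> * g i (X i r \<omega>)" if "\<omega> \<in> space M" for i \<omega>
    using that assms(1) by (simp add: h_def S(2) indicator_def)
  have "(\<integral>\<^sup>+\<omega>. (\<Prod>i\<in>UNIV. h i (?p i \<omega>)) \<partial>M) = (\<Prod>i\<in>UNIV. \<integral>\<^sup>+\<omega>. h i (?p i \<omega>) \<partial>M)"
    by (rule indep_vars_nn_integral[OF _ ind]) auto
  moreover have "(\<integral>\<^sup>+\<omega>. (\<Prod>i\<in>UNIV. h i (?p i \<omega>)) \<partial>M) = (\<integral>\<^sup>+\<omega>. (\<Prod>i\<in>UNIV. indicator (B i) \<omega> * g i (X i r \<omega>)) \<partial>M)"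
    by (intro nn_integral_cong prod.cong) (auto simp: h)
  moreover have "(\<integral>\<^sup>+\<omega>. h i (?p i \<omega>) \<partial>M) = (\<integral>\<^sup>+\<omega>. indicator (B i) \<omega> * g i (X i r \<omega>) \<partial>M)" for i
    by (intro nn_integral_cong) (auto simp: h)
  ultimately show ?thesis by simp
qed

text \<open>One past event for each particle: a pi-system whose generated sigma-algebra contains the
  joint past \<open>F s\<close>.\<close>

definition cylinders :: "real \<Rightarrow> 'w set set" where
  "cylinders s = {(\<Inter>i. B i) | B. \<forall>i. B i \<in> sets (natural_filtration M (X i) s)}"

lemma cylinders_subset: "cylinders s \<subseteq> sets M"
proof -
  have "sets (natural_filtration M (X i) s) \<subseteq> sets M" for i
    by (rule natural_filtration_subset) auto
  then show ?thesis by (auto simp: cylinders_def)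
qed

lemma Int_stable_cylinders: "Int_stable (cylinders s)"
proof (rule Int_stableI)
  fix b c assume "b \<in> cylinders s" "c \<in> cylinders s"
  then obtain B C where "b = (\<Inter>i. B i)" "c = (\<Inter>i. C i)" and
    BC: "\<And>i. B i \<in> sets (natural_filtration M (X i) s)" "\<And>i. C i \<in> sets (natural_filtration M (X i) s)"
    by (auto simp: cylinders_def)
  then have "b \<inter> c = (\<Inter>i. B i \<inter> C i)" by auto
  then show "b \<inter> c \<in> cylinders s" using BC by (auto simp: cylinders_def intro!: exI[of _ "\<lambda>i. B i \<inter> C i"])
qed

lemma space_in_cylinders: "space M \<in> cylinders s"
  unfolding cylinders_def using sets.top[of "natural_filtration M (X _) s"]
  by (auto intro!: exI[of _ "\<lambda>_. space M"])

lemma F_subset_cylinders: "sets (F s) \<subseteq> sigma_sets (space M) (cylinders s)"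
proof -
  let ?S = "sigma (space M) (cylinders s)"
  have Pow: "cylinders s \<subseteq> Pow (space M)" using cylinders_subset sets.space_closed by blast
  have sets: "sets ?S = sigma_sets (space M) (cylinders s)" using Pow by (rule sets_measure_of)
  have sp: "space ?S = space M" by (simp add: space_measure_of_conv)
  have "X i r \<in> borel_measurable ?S" if r: "0 \<le> r" "r \<le> s" for i r
  proof (rule measurableI)
    fix A :: "real set" assume A: "A \<in> sets borel"
    define B where "B j = (if j = i then X i r -` A \<inter> space M else space M)" for j
    have "B j \<in> sets (natural_filtration M (X j) s)" for j
      using measurable_sets[OF measurable_natural_filtration[OF r, of "X i" M] A] sets.top[of "natural_filtration M (X j) s"]
      by (auto simp: B_def)
    moreover have "X i r -` A \<inter> space M = (\<Inter>j. B j)" by (auto simp: B_def split: if_splits)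
    ultimately have "X i r -` A \<inter> space M \<in> cylinders s" by (auto simp: cylinders_def)
    then show "X i r -` A \<inter> space ?S \<in> sets ?S" unfolding sets sp by (rule sigma_sets.Basic)
  qed (simp add: sp)
  then have "Y r \<in> borel_measurable ?S" if "0 \<le> r" "r \<le> s" for r
    unfolding Y_def[abs_def] using that by (intro borel_measurable_vec_lambda) auto
  then show ?thesis unfolding sets[symmetric] by (intro natural_filtration_subset) (auto simp: sp)
qed

text \<open>Independence factorises the left-hand side, \<open>single_markov\<close> moves each
  factor back to time \<open>s\<close>, and independence puts the factors together again. The
  product of the one-particle densities is the identity term.\<close>

lemma markov_cylinder:
  assumes st: "0 \<le> s" "s < t" and A[measurable]: "\<And>i. A i \<in> sets borel" and B: "\<And>i. B i \<in> sets (natural_filtration M (X i) s)"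
  shows "(\<integral>\<^sup>+\<omega>. indicator (\<Inter>i. B i) \<omega> * (\<Prod>i\<in>UNIV. indicator (A i) (X i t \<omega>)) \<partial>M)
    = (\<integral>\<^sup>+\<omega>. indicator (\<Inter>i. B i) \<omega> * (\<integral>\<^sup>+z\<in>positive_orthant. ennreal (km_term \<nu> a (t - s) id (Y s \<omega>) z) * (\<Prod>i\<in>UNIV. indicator (A i) (z $ i)) \<partial>lborel) \<partial>M)"
proof -
  define g where "g i y = (\<integral>\<^sup>+w\<in>{0<..}. ennreal (besq_density \<nu> (a i) (t - s) y w) * indicator (A i) w \<partial>lborel)" for i y
  have [measurable]: "g i \<in> borel_measurable borel" for i unfolding g_def by measurable
  have ind: "indicator (\<Inter>i. B i) \<omega> = (\<Prod>i\<in>UNIV. indicator (B i) \<omega> :: ennreal)" for \<omega>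
  proof (cases "\<omega> \<in> (\<Inter>i. B i)")
    case False
    then obtain i where "\<omega> \<notin> B i" by auto
    then have "(\<Prod>i\<in>UNIV. indicator (B i) \<omega> :: ennreal) = 0" by (intro prod_zero bexI[of _ i]) auto
    then show ?thesis using False by simp
  qed simp
  have "(\<integral>\<^sup>+\<omega>. indicator (\<Inter>i. B i) \<omega> * (\<Prod>i\<in>UNIV. indicator (A i) (X i t \<omega>)) \<partial>M)
    = (\<Prod>i\<in>UNIV. \<integral>\<^sup>+\<omega>. indicator (B i) \<omega> * indicator (A i) (X i t \<omega>) \<partial>M)"
    unfolding ind prod.distrib[symmetric]
    using st by (intro nn_integral_prod_independent[where s = s] B) auto
  also have "\<dots> = (\<Prod>i\<in>UNIV. \<integral>\<^sup>+\<omega>. indicator (B i) \<omega> * g i (X i s \<omega>) \<partial>M)"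
    unfolding g_def by (simp only: single_markov[OF st A B])
  also have "\<dots> = (\<integral>\<^sup>+\<omega>. indicator (\<Inter>i. B i) \<omega> * (\<Prod>i\<in>UNIV. g i (X i s \<omega>)) \<partial>M)"
    unfolding ind prod.distrib[symmetric]
    by (intro nn_integral_prod_independent[where s = s, symmetric] B st) auto
  also have "\<dots> = (\<integral>\<^sup>+\<omega>. indicator (\<Inter>i. B i) \<omega> * (\<integral>\<^sup>+z\<in>positive_orthant. ennreal (km_term \<nu> a (t - s) id (Y s \<omega>) z) * (\<Prod>i\<in>UNIV. indicator (A i) (z $ i)) \<partial>lborel) \<partial>M)"
  proof (intro nn_integral_cong arg_cong2[where f = "(*)"] refl)
    fix \<omega> assume \<omega>: "\<omega> \<in> space M"
    have y: "Y s \<omega> \<in> positive_orthant" using Y_orthant[OF \<omega>] st by simp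
    define f where "f i w = ennreal (besq_density \<nu> (a i) (t - s) (X i s \<omega>) w) * indicator (A i) w * indicator {0<..} w" for i w
    have [measurable]: "f i \<in> borel_measurable borel" for i unfolding f_def by measurable
    have "ennreal (km_term \<nu> a (t - s) id (Y s \<omega>) z) * (\<Prod>i\<in>UNIV. indicator (A i) (z $ i)) * indicator positive_orthant z = (\<Prod>i\<in>UNIV. f i (z $ i))" for z
    proof (cases "z \<in> positive_orthant")
      case True
      have "ennreal (km_term \<nu> a (t - s) id (Y s \<omega>) z) = (\<Prod>i\<in>UNIV. ennreal (besq_density \<nu> (a i) (t - s) (X i s \<omega>) (z $ i)))"
        unfolding km_term_eq[OF permutes_id y] bessel_ratio_id[OF y]
        using \<nu> a X_pos[OF \<omega> st(1)] positive_orthantD[OF True]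
        by (subst prod_ennreal) (auto intro!: besq_density_nonneg intro: less_imp_le)
      then show ?thesis using True by (simp add: f_def prod.distrib positive_orthantD)
    next
      case False
      then show ?thesis using indicator_positive_orthant[OF permutes_id, of z] by (simp add: f_def prod.distrib)
    qed
    then show "(\<Prod>i\<in>UNIV. g i (X i s \<omega>)) = (\<integral>\<^sup>+z\<in>positive_orthant. ennreal (km_term \<nu> a (t - s) id (Y s \<omega>) z) * (\<Prod>i\<in>UNIV. indicator (A i) (z $ i)) \<partial>lborel)"
      by (simp add: nn_integral_lborel_vec_prod) (simp add: g_def f_def[abs_def])
  qed
  finally show ?thesis .
qed

text \<open>Extension in the past: for a fixed rectangle both sides are finite measures in
  \<open>B\<close> that agree on the pi-system of cylinders.\<close>

lemma markov_rectangle: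
  assumes st: "0 \<le> s" "s < t" and A[measurable]: "\<And>i. A i \<in> sets borel" and B: "B \<in> sets (F s)"
  shows "(\<integral>\<^sup>+\<omega>. indicator B \<omega> * (\<Prod>i\<in>UNIV. indicator (A i) (X i t \<omega>)) \<partial>M)
    = (\<integral>\<^sup>+\<omega>. indicator B \<omega> * (\<integral>\<^sup>+z\<in>positive_orthant. ennreal (km_term \<nu> a (t - s) id (Y s \<omega>) z) * (\<Prod>i\<in>UNIV. indicator (A i) (z $ i)) \<partial>lborel) \<partial>M)"
proof -
  define f where "f \<omega> = (\<Prod>i\<in>UNIV. indicator (A i) (X i t \<omega>) :: ennreal)" for \<omega>
  define g where "g \<omega> = (\<integral>\<^sup>+z\<in>positive_orthant. ennreal (km_term \<nu> a (t - s) id (Y s \<omega>) z) * (\<Prod>i\<in>UNIV. indicator (A i) (z $ i)) \<partial>lborel)" for \<omega>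
  have [measurable]: "X i t \<in> borel_measurable M" "Y s \<in> borel_measurable M" for i using st by auto
  have [measurable]: "f \<in> borel_measurable M" unfolding f_def by measurable
  have [measurable]: "g \<in> borel_measurable M" unfolding g_def by measurable
  let ?S = "sigma (space M) (cylinders s)"
  have Pow: "cylinders s \<subseteq> Pow (space M)" using cylinders_subset sets.space_closed by blast
  have sets: "sets ?S = sigma_sets (space M) (cylinders s)" using Pow by (rule sets_measure_of)
  have sub: "subalgebra (density M k) ?S" for k
    using sets.sigma_sets_subset[OF cylinders_subset] by (simp add: subalgebra_def sets space_measure_of_conv)
  have em: "emeasure (restr_to_subalg (density M k) ?S) b = (\<integral>\<^sup>+\<omega>. indicator b \<omega> * k \<omega> \<partial>M)"
    if "b \<in> sigma_sets (space M) (cylinders s)" "k \<in> borel_measurable M" for b k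
  proof -
    have "b \<in> sets M" using that(1) sets.sigma_sets_subset[OF cylinders_subset] by auto
    then show ?thesis
      using that sub by (subst emeasure_restr_to_subalg) (auto simp: sets emeasure_density mult.commute intro!: nn_integral_cong)
  qed
  have "restr_to_subalg (density M f) ?S = restr_to_subalg (density M g) ?S"
  proof (rule measure_eqI_generator_eq[OF Int_stable_cylinders Pow, where A = "\<lambda>_. space M"])
    fix b assume b: "b \<in> cylinders s"
    then obtain B' where B': "b = (\<Inter>i. B' i)" "\<And>i. B' i \<in> sets (natural_filtration M (X i) s)"
      by (auto simp: cylinders_def)
    show "emeasure (restr_to_subalg (density M f) ?S) b = emeasure (restr_to_subalg (density M g) ?S) b"
      using markov_cylinder[OF st A B'(2)] b by (simp add: em sigma_sets.Basic f_def g_def B'(1))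
  next
    show "sets (restr_to_subalg (density M f) ?S) = sigma_sets (space M) (cylinders s)"
      "sets (restr_to_subalg (density M g) ?S) = sigma_sets (space M) (cylinders s)"
      using sub by (auto simp: sets_restr_to_subalg sets)
    have "emeasure (restr_to_subalg (density M f) ?S) (space M) = (\<integral>\<^sup>+\<omega>. indicator (space M) \<omega> * f \<omega> \<partial>M)"
      by (intro em sigma_sets.Basic space_in_cylinders) measurable
    also have "\<dots> \<le> (\<integral>\<^sup>+\<omega>. 1 \<partial>M)"
      unfolding f_def by (intro nn_integral_mono) (auto simp: indicator_def intro!: prod_le_1)
    finally show "emeasure (restr_to_subalg (density M f) ?S) (space M) \<noteq> \<infinity>"
      by (auto simp: emeasure_space_1 top_unique)
  qed (use space_in_cylinders in auto)
  moreover have "B \<in> sigma_sets (space M) (cylinders s)" using B F_subset_cylinders by auto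
  ultimately show ?thesis using em[of B f] em[of B g] by (simp add: f_def g_def)
qed

text \<open>Extension in the future: for a fixed past event both sides are integrals of
  \<open>f\<close> against measures on the state space, which agree on boxes because boxes are
  rectangles.\<close>

theorem markov_nn_integral:
  assumes st: "0 \<le> s" "s < t" and f[measurable]: "f \<in> borel_measurable borel" and B: "B \<in> sets (F s)"
  shows "(\<integral>\<^sup>+\<omega>. indicator B \<omega> * f (Y t \<omega>) \<partial>M)
    = (\<integral>\<^sup>+\<omega>. indicator B \<omega> * (\<integral>\<^sup>+z\<in>positive_orthant. ennreal (km_term \<nu> a (t - s) id (Y s \<omega>) z) * f z \<partial>lborel) \<partial>M)"
proof -
  have [measurable]: "Y t \<in> borel_measurable M" "Y s \<in> borel_measurable M" "B \<in> sets M"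
    using st F_sets[OF B] by auto
  interpret P: pair_sigma_finite M "lborel :: (real ^ 'n::{finite,linorder}) measure" ..
  define k where "k \<omega> z = indicator B \<omega> * (ennreal (km_term \<nu> a (t - s) id (Y s \<omega>) z) * indicator positive_orthant z)" for \<omega> z
  have [measurable]: "case_prod k \<in> borel_measurable (M \<Otimes>\<^sub>M lborel)"
    unfolding k_def by measurable
  \<comment> \<open>\<open>\<mu>1\<close> is the law of \<open>Y t\<close> on the event
    \<open>B\<close>; the density of \<open>\<mu>2\<close> averages the transition density over the
    position at time \<open>s\<close>, which is the right-hand side after Tonelli's theorem.\<close>
  define \<mu>1 where "\<mu>1 = distr (density M (indicator B)) borel (Y t)"
  define \<mu>2 where "\<mu>2 = density lborel (\<lambda>z. \<integral>\<^sup>+\<omega>. k \<omega> z \<partial>M)"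
  have k[measurable]: "(\<lambda>z. \<integral>\<^sup>+\<omega>. k \<omega> z \<partial>M) \<in> borel_measurable lborel"
    using P.borel_measurable_nn_integral_fst by measurable
  have int2: "(\<integral>\<^sup>+z. u z \<partial>\<mu>2) = (\<integral>\<^sup>+\<omega>. indicator B \<omega> * (\<integral>\<^sup>+z\<in>positive_orthant. ennreal (km_term \<nu> a (t - s) id (Y s \<omega>) z) * u z \<partial>lborel) \<partial>M)"
    if [measurable]: "u \<in> borel_measurable borel" for u
  proof -
    have "(\<integral>\<^sup>+z. u z \<partial>\<mu>2) = (\<integral>\<^sup>+z. (\<integral>\<^sup>+\<omega>. k \<omega> z \<partial>M) * u z \<partial>lborel)"
      unfolding \<mu>2_def by (intro nn_integral_density) (use k in auto)
    also have "\<dots> = (\<integral>\<^sup>+z. (\<integral>\<^sup>+\<omega>. k \<omega> z * u z \<partial>M) \<partial>lborel)"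
      by (intro nn_integral_cong nn_integral_multc[symmetric]) (auto simp: k_def)
    also have "\<dots> = (\<integral>\<^sup>+\<omega>. (\<integral>\<^sup>+z. k \<omega> z * u z \<partial>lborel) \<partial>M)"
      by (rule P.Fubini') measurable
    also have "\<dots> = (\<integral>\<^sup>+\<omega>. indicator B \<omega> * (\<integral>\<^sup>+z\<in>positive_orthant. ennreal (km_term \<nu> a (t - s) id (Y s \<omega>) z) * u z \<partial>lborel) \<partial>M)"
      by (intro nn_integral_cong, subst nn_integral_cmult[symmetric]) (auto simp: k_def mult_ac intro!: nn_integral_cong)
    finally show ?thesis .
  qed
  have int1: "(\<integral>\<^sup>+z. u z \<partial>\<mu>1) = (\<integral>\<^sup>+\<omega>. indicator B \<omega> * u (Y t \<omega>) \<partial>M)" if [measurable]: "u \<in> borel_measurable borel" for u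
    unfolding \<mu>1_def by (simp add: nn_integral_distr nn_integral_density)
  let ?E = "range (\<lambda>(l, u). box l u) :: (real ^ 'n::{finite,linorder}) set set"
  have SB: "sets (borel :: (real ^ 'n::{finite,linorder}) measure) = sigma_sets UNIV ?E"
    by (subst borel_eq_box, rule sets_measure_of) auto
  have "\<mu>1 = \<mu>2"
  proof (rule measure_eqI_generator_eq[where E = ?E and \<Omega> = UNIV and A = "\<lambda>n. box (- (real n *\<^sub>R One)) (real n *\<^sub>R One)"])
    show "Int_stable ?E" by (auto simp: Int_stable_def box_Int_box)
    fix b assume "b \<in> ?E"
    then obtain l u where b: "b = box l u" by auto
    have ind: "indicator b z = (\<Prod>i\<in>UNIV. indicator {l $ i<..<u $ i} (z $ i) :: ennreal)" for z
    proof (cases "z \<in> b")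
      case False
      then obtain i where "z $ i \<notin> {l $ i<..<u $ i}" by (auto simp: b mem_box_cart)
      then have "(\<Prod>i\<in>UNIV. indicator {l $ i<..<u $ i} (z $ i) :: ennreal) = 0" by (intro prod_zero bexI[of _ i]) auto
      then show ?thesis using False by simp
    qed (auto simp: b mem_box_cart)
    have [measurable]: "b \<in> sets borel" by (simp add: b)
    have "emeasure \<mu>1 b = (\<integral>\<^sup>+z. indicator b z \<partial>\<mu>1)" by (simp add: \<mu>1_def)
    also have "\<dots> = (\<integral>\<^sup>+z. indicator b z \<partial>\<mu>2)"
      unfolding int1[OF borel_measurable_indicator[OF \<open>b \<in> sets borel\<close>]] int2[OF borel_measurable_indicator[OF \<open>b \<in> sets borel\<close>]]
      unfolding ind Y_nth by (rule markov_rectangle[OF st _ B]) auto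
    also have "\<dots> = emeasure \<mu>2 b" by (simp add: \<mu>2_def)
    finally show "emeasure \<mu>1 b = emeasure \<mu>2 b" .
  next
    fix n :: nat
    have "emeasure \<mu>1 c \<le> 1" if "c \<in> sets borel" for c
    proof -
      have "emeasure \<mu>1 c = (\<integral>\<^sup>+\<omega>. indicator B \<omega> * indicator c (Y t \<omega>) \<partial>M)"
        using int1[OF borel_measurable_indicator[OF that]] that by (simp add: \<mu>1_def)
      also have "\<dots> \<le> (\<integral>\<^sup>+\<omega>. 1 \<partial>M)" by (intro nn_integral_mono) (auto simp: indicator_def)
      finally show ?thesis by (simp add: emeasure_space_1)
    qed
    from this[of "box (- (real n *\<^sub>R One)) (real n *\<^sub>R One)"]
    show "emeasure \<mu>1 (box (- (real n *\<^sub>R One)) (real n *\<^sub>R One)) \<noteq> \<infinity>" by (auto simp: top_unique)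
  qed (simp_all add: \<mu>1_def \<mu>2_def UN_box_eq_UNIV SB, blast)
  then show ?thesis using int1[OF f] int2[OF f] by simp
qed

subsection \<open>Stopping at the first collision\<close>

text \<open>Harmonicity of \<open>bessel_ratio\<close> keeps its mean constant in time. The
  finiteness of this mean is the source of the integrability of \<open>ratio_sum\<close> along the
  process.\<close>

lemma nn_integral_bessel_ratio_Y:
  assumes s: "0 \<le> s" and \<pi>: "\<pi> permutes UNIV"
  shows "(\<integral>\<^sup>+\<omega>. ennreal (bessel_ratio \<nu> a \<pi> (Y s \<omega>)) \<partial>M) = ennreal (bessel_ratio \<nu> a \<pi> x)"
proof -
  have 0: "(\<integral>\<^sup>+\<omega>. ennreal (bessel_ratio \<nu> a \<pi> (Y 0 \<omega>)) \<partial>M) = ennreal (bessel_ratio \<nu> a \<pi> x)"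
  proof -
    have "(\<integral>\<^sup>+\<omega>. ennreal (bessel_ratio \<nu> a \<pi> (Y 0 \<omega>)) \<partial>M) = (\<integral>\<^sup>+\<omega>. ennreal (bessel_ratio \<nu> a \<pi> x) \<partial>M)"
      using AE_Y_0 by (intro nn_integral_cong_AE) auto
    then show ?thesis by (simp add: emeasure_space_1)
  qed
  show ?thesis
  proof (cases "s = 0")
    case False
    then have s: "0 < s" using s by simp
    have "(\<integral>\<^sup>+\<omega>. ennreal (bessel_ratio \<nu> a \<pi> (Y s \<omega>)) \<partial>M) = (\<integral>\<^sup>+\<omega>. indicator (space M) \<omega> * ennreal (bessel_ratio \<nu> a \<pi> (Y s \<omega>)) \<partial>M)"
      by (intro nn_integral_cong) auto
    also have "\<dots> = (\<integral>\<^sup>+\<omega>. indicator (space M) \<omega> * (\<integral>\<^sup>+z\<in>positive_orthant. ennreal (km_term \<nu> a (s - 0) id (Y 0 \<omega>) z) * ennreal (bessel_ratio \<nu> a \<pi> z) \<partial>lborel) \<partial>M)"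
      using s sets.top[of "F 0"] by (intro markov_nn_integral) auto
    also have "\<dots> = (\<integral>\<^sup>+\<omega>. ennreal (bessel_ratio \<nu> a \<pi> (Y 0 \<omega>)) \<partial>M)"
    proof (intro nn_integral_cong)
      fix \<omega> assume \<omega>: "\<omega> \<in> space M"
      have y: "Y 0 \<omega> \<in> positive_orthant" using Y_orthant[OF \<omega>] by simp
      have "(\<integral>\<^sup>+z\<in>positive_orthant. ennreal (km_term \<nu> a (s - 0) id (Y 0 \<omega>) z) * ennreal (bessel_ratio \<nu> a \<pi> z) \<partial>lborel)
        = (\<integral>\<^sup>+z\<in>positive_orthant. ennreal (km_term \<nu> a s id (Y 0 \<omega>) z * bessel_ratio \<nu> a \<pi> z) \<partial>lborel)"
        by (intro nn_integral_cong) (auto simp: indicator_def ennreal_mult' km_term_nonneg[OF y])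
      also have "\<dots> = ennreal (bessel_ratio \<nu> a (\<pi> \<circ> id) (Y 0 \<omega>))"
        by (rule nn_integral_km_term[OF permutes_id \<pi> y s])
      finally show "indicator (space M) \<omega> * (\<integral>\<^sup>+z\<in>positive_orthant. ennreal (km_term \<nu> a (s - 0) id (Y 0 \<omega>) z) * ennreal (bessel_ratio \<nu> a \<pi> z) \<partial>lborel) = ennreal (bessel_ratio \<nu> a \<pi> (Y 0 \<omega>))"
        using \<omega> by simp
    qed
    finally show ?thesis using 0 by simp
  qed (simp add: 0)
qed

lemma integrable_bessel_ratio_Y:
  assumes "0 \<le> s" "\<pi> permutes UNIV"
  shows "integrable M (\<lambda>\<omega>. bessel_ratio \<nu> a \<pi> (Y s \<omega>))"
proof (rule integrableI_nonneg)
  have [measurable]: "Y s \<in> borel_measurable M" using assms by simp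
  show "(\<lambda>\<omega>. bessel_ratio \<nu> a \<pi> (Y s \<omega>)) \<in> borel_measurable M" by measurable
  show "AE \<omega> in M. 0 \<le> bessel_ratio \<nu> a \<pi> (Y s \<omega>)"
    using AE_space by eventually_elim (simp add: less_imp_le bessel_ratio_pos Y_orthant assms(1))
qed (simp add: nn_integral_bessel_ratio_Y[OF assms])

text \<open>The transition density over \<open>r' - r\<close>, composed with the term over the
  remaining time \<open>T - r'\<close>, is the term over \<open>T - r\<close> by
  Chapman-Kolmogorov.\<close>

lemma km_term_martingale:
  assumes r: "0 \<le> r" "r \<le> r'" "r' < T" and \<sigma>: "\<sigma> permutes UNIV" and z: "z \<in> positive_orthant" and C: "C \<in> sets (F r)"
  shows "(\<integral>\<^sup>+\<omega>. indicator C \<omega> * ennreal (km_term \<nu> a (T - r') \<sigma> (Y r' \<omega>) z) \<partial>M) = (\<integral>\<^sup>+\<omega>. indicator C \<omega> * ennreal (km_term \<nu> a (T - r) \<sigma> (Y r \<omega>) z) \<partial>M)"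
proof (cases "r = r'")
  case False
  then have rr: "r < r'" using r by simp
  have "(\<integral>\<^sup>+\<omega>. indicator C \<omega> * ennreal (km_term \<nu> a (T - r') \<sigma> (Y r' \<omega>) z) \<partial>M)
    = (\<integral>\<^sup>+\<omega>. indicator C \<omega> * (\<integral>\<^sup>+w\<in>positive_orthant. ennreal (km_term \<nu> a (r' - r) id (Y r \<omega>) w) * ennreal (km_term \<nu> a (T - r') \<sigma> w z) \<partial>lborel) \<partial>M)"
    by (rule markov_nn_integral[OF r(1) rr _ C]) measurable
  also have "\<dots> = (\<integral>\<^sup>+\<omega>. indicator C \<omega> * ennreal (km_term \<nu> a (T - r) \<sigma> (Y r \<omega>) z) \<partial>M)"
  proof (intro nn_integral_cong arg_cong2[where f = "(*)"] refl)
    fix \<omega> assume \<omega>: "\<omega> \<in> space M"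
    have y: "Y r \<omega> \<in> positive_orthant" using Y_orthant[OF \<omega> r(1)] .
    have "(\<integral>\<^sup>+w\<in>positive_orthant. ennreal (km_term \<nu> a (r' - r) id (Y r \<omega>) w) * ennreal (km_term \<nu> a (T - r') \<sigma> w z) \<partial>lborel)
      = (\<integral>\<^sup>+w\<in>positive_orthant. ennreal (km_term \<nu> a (r' - r) id (Y r \<omega>) w * km_term \<nu> a (T - r') \<sigma> w z) \<partial>lborel)"
      by (intro nn_integral_cong) (auto simp: indicator_def ennreal_mult' km_term_nonneg[OF y])
    also have "\<dots> = ennreal (km_term \<nu> a ((r' - r) + (T - r')) \<sigma> (Y r \<omega>) z)"
      using rr r by (intro nn_integral_km_term_chapman_kolmogorov \<sigma> y z) auto
    finally show "(\<integral>\<^sup>+w\<in>positive_orthant. ennreal (km_term \<nu> a (r' - r) id (Y r \<omega>) w) * ennreal (km_term \<nu> a (T - r') \<sigma> w z) \<partial>lborel) = ennreal (km_term \<nu> a (T - r) \<sigma> (Y r \<omega>) z)"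
      by simp
  qed
  finally show ?thesis .
qed simp

lemma integrable_km_term_Y:
  assumes r: "0 \<le> r" "r < T" and \<sigma>: "\<sigma> permutes UNIV" and z: "z \<in> positive_orthant" and C: "C \<in> sets M"
  shows "integrable M (\<lambda>\<omega>. indicator C \<omega> * km_term \<nu> a (T - r) \<sigma> (Y r \<omega>) z)"
proof -
  have "0 < T - r" using r by simp
  obtain K where K: "0 \<le> K" "\<And>t y \<sigma>. T - r \<le> t \<Longrightarrow> y \<in> positive_orthant \<Longrightarrow> \<sigma> permutes UNIV \<Longrightarrow> km_term \<nu> a t \<sigma> y z \<le> K"
    "\<And>t y. T - r \<le> t \<Longrightarrow> y \<in> positive_orthant \<Longrightarrow> \<bar>km_density \<nu> a t y z\<bar> \<le> K"
    using km_density_bounded[OF \<open>0 < T - r\<close> z] by blast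
  have [measurable]: "Y r \<in> borel_measurable M" "C \<in> sets M" using r C by auto
  show ?thesis
  proof (rule integrable_const_bound[of _ K])
    show "AE \<omega> in M. norm (indicator C \<omega> * km_term \<nu> a (T - r) \<sigma> (Y r \<omega>) z) \<le> K"
      using AE_space
    proof eventually_elim
      case (elim \<omega>)
      then show ?case using K(2)[OF order_refl Y_orthant[OF elim r(1)] \<sigma>] K(1) km_term_nonneg[OF Y_orthant[OF elim r(1)] z, of "T - r" \<sigma>]
        by (simp add: indicator_def)
    qed
  qed measurable
qed

lemma integral_km_term_Y:
  assumes r: "0 \<le> r" "r < T" and z: "z \<in> positive_orthant" and [measurable]: "C \<in> sets M"
  shows "(\<integral>\<omega>. indicator C \<omega> * km_term \<nu> a (T - r) \<sigma> (Y r \<omega>) z \<partial>M) = enn2real (\<integral>\<^sup>+\<omega>. indicator C \<omega> * ennreal (km_term \<nu> a (T - r) \<sigma> (Y r \<omega>) z) \<partial>M)"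
proof -
  have [measurable]: "Y r \<in> borel_measurable M" using r by auto
  have "(\<integral>\<omega>. indicator C \<omega> * km_term \<nu> a (T - r) \<sigma> (Y r \<omega>) z \<partial>M) = enn2real (\<integral>\<^sup>+\<omega>. ennreal (indicator C \<omega> * km_term \<nu> a (T - r) \<sigma> (Y r \<omega>) z) \<partial>M)"
  proof (rule integral_eq_nn_integral)
    show "AE \<omega> in M. 0 \<le> indicator C \<omega> * km_term \<nu> a (T - r) \<sigma> (Y r \<omega>) z"
      using AE_space by eventually_elim (auto simp: indicator_def intro!: km_term_nonneg Y_orthant r z)
  qed measurable
  then show ?thesis by (simp add: ennreal_mult' ennreal_indicator)
qed

text \<open>The signs force the passage from nonnegative to Lebesgue integrals; each term is
  integrable because it is bounded before the terminal time.\<close>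

lemma km_density_martingale:
  assumes r: "0 \<le> r" "r \<le> r'" "r' < T" and z: "z \<in> positive_orthant" and C: "C \<in> sets (F r)"
  shows "(\<integral>\<omega>. indicator C \<omega> * km_density \<nu> a (T - r') (Y r' \<omega>) z \<partial>M) = (\<integral>\<omega>. indicator C \<omega> * km_density \<nu> a (T - r) (Y r \<omega>) z \<partial>M)"
proof -
  have CM: "C \<in> sets M" by (rule F_sets[OF C])
  have "(\<integral>\<omega>. indicator C \<omega> * km_density \<nu> a (T - q) (Y q \<omega>) z \<partial>M)
    = (\<Sum>\<sigma> | \<sigma> permutes UNIV. of_int (sign \<sigma>) * (\<integral>\<omega>. indicator C \<omega> * km_term \<nu> a (T - q) \<sigma> (Y q \<omega>) z \<partial>M))" if "0 \<le> q" "q < T" for q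
  proof -
    have "(\<integral>\<omega>. indicator C \<omega> * km_density \<nu> a (T - q) (Y q \<omega>) z \<partial>M)
      = (\<integral>\<omega>. (\<Sum>\<sigma> | \<sigma> permutes UNIV. of_int (sign \<sigma>) * (indicator C \<omega> * km_term \<nu> a (T - q) \<sigma> (Y q \<omega>) z)) \<partial>M)"
      by (intro Bochner_Integration.integral_cong) (auto simp: km_density_def sum_distrib_left mult_ac)
    also have "\<dots> = (\<Sum>\<sigma> | \<sigma> permutes UNIV. (\<integral>\<omega>. of_int (sign \<sigma>) * (indicator C \<omega> * km_term \<nu> a (T - q) \<sigma> (Y q \<omega>) z) \<partial>M))"
      using that z CM by (intro Bochner_Integration.integral_sum integrable_mult_right integrable_km_term_Y) auto
    finally show ?thesis by simp
  qed
  moreover have "(\<integral>\<omega>. indicator C \<omega> * km_term \<nu> a (T - r') \<sigma> (Y r' \<omega>) z \<partial>M) = (\<integral>\<omega>. indicator C \<omega> * km_term \<nu> a (T - r) \<sigma> (Y r \<omega>) z \<partial>M)"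
    if "\<sigma> permutes UNIV" for \<sigma>
    using r z CM km_term_martingale[OF r that z C] by (simp add: integral_km_term_Y)
  ultimately show ?thesis using r by simp
qed

section \<open>Survival up to a given time\<close>

definition alive :: "real \<Rightarrow> 'w set" where
  "alive s = {\<omega> \<in> space M. \<forall>r. 0 \<le> r \<and> r \<le> s \<longrightarrow> Y r \<omega> \<in> weyl_chamber}"

lemma alive_antimono: "s \<le> t \<Longrightarrow> alive t \<subseteq> alive s"
  by (auto simp: alive_def)

lemma X_cont_on: "\<omega> \<in> space M \<Longrightarrow> 0 \<le> p \<Longrightarrow> continuous_on {p..q} (\<lambda>t. X i t \<omega>)"
  by (rule continuous_on_subset[OF X_cont]) auto

text \<open>Rational fractions of \<open>s\<close> are used instead of rational times, so that the
  end point \<open>s\<close> itself is among them.\<close>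

lemma rational_times_dense:
  fixes f :: "real \<Rightarrow> real"
  assumes s: "0 \<le> s" and f: "continuous_on {0..s} f" and q: "\<And>q. q \<in> \<rat> \<Longrightarrow> 0 \<le> q \<Longrightarrow> q \<le> 1 \<Longrightarrow> c \<le> f (s * q)" and r: "0 \<le> r" "r \<le> s"
  shows "c \<le> f r"
proof (cases "s = 0")
  case True
  then show ?thesis using q[of 0] r by simp
next
  case False
  let ?Q = "{0..1} \<inter> (\<rat> :: real set)"
  \<comment> \<open>In dimension one the points with rational coordinates, in the form in which the
    closure theorem presents them, are the rational numbers.\<close>
  have "q \<in> (\<Union>f\<in>{1::real} \<rightarrow> \<rat>. {f 1})" if "q \<in> \<rat>" for q :: real
    using that by (intro UN_I[of "\<lambda>_. q"]) auto
  then have "(\<Union>f\<in>{1::real} \<rightarrow> \<rat>. {f 1}) = (\<rat> :: real set)" by auto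
  then have cl: "closure ?Q = {0..1}"
    using closure_rationals_in_convex_set[of "{0..1 :: real}"] by simp
  have "continuous_on (closure ?Q) (\<lambda>u. f (s * u))"
    unfolding cl using s by (intro continuous_on_compose2[OF f] continuous_intros) (auto intro: mult_left_le)
  moreover have "r / s \<in> closure ?Q" unfolding cl using r s False by simp
  ultimately have "c \<le> f (s * (r / s))"
    by (rule continuous_ge_on_closure) (use q in auto)
  then show ?thesis using False by simp
qed

text \<open>A countable description, needed for measurability. Strict inequalities at rational times
  would not exclude a collision at another time; a gap \<open>1 / real (Suc n)\<close> uniform in
  time does, and it exists because a positive continuous function on a compact interval has a
  positive minimum.\<close>

lemma alive_eq:
  assumes s: "0 \<le> s"
  shows "alive s = (\<Inter>(i, j)\<in>{(i, j). i < j}. \<Union>n. \<Inter>q\<in>\<rat> \<inter> {0..1}. {\<omega> \<in> space M. 1 / real (Suc n) \<le> X j (s * q) \<omega> - X i (s * q) \<omega>}) \<inter> space M"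
    (is "_ = ?R")
proof (intro equalityI subsetI)
  fix \<omega> assume \<omega>: "\<omega> \<in> alive s"
  then have sp: "\<omega> \<in> space M" by (simp add: alive_def)
  have "\<exists>n. \<forall>q\<in>\<rat> \<inter> {0..1}. 1 / real (Suc n) \<le> X j (s * q) \<omega> - X i (s * q) \<omega>" if "i < j" for i j
  proof -
    have "continuous_on {0..s} (\<lambda>t. X j t \<omega> - X i t \<omega>)"
      by (intro continuous_intros X_cont_on sp) auto
    moreover have "{0..s} \<noteq> {}" using s by simp
    ultimately obtain u where u: "u \<in> {0..s}" "\<And>t. t \<in> {0..s} \<Longrightarrow> X j u \<omega> - X i u \<omega> \<le> X j t \<omega> - X i t \<omega>"
      using continuous_attains_inf[of "{0..s}" "\<lambda>t. X j t \<omega> - X i t \<omega>"] by auto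
    have "Y u \<omega> \<in> weyl_chamber" using \<omega> u(1) by (simp add: alive_def)
    then have "0 < X j u \<omega> - X i u \<omega>" using that by (auto simp: weyl_chamber_def)
    then obtain n where n: "1 / real (Suc n) < X j u \<omega> - X i u \<omega>"
      using nat_approx_posE by blast
    show ?thesis
    proof (intro exI[of _ n] ballI)
      fix q :: real assume "q \<in> \<rat> \<inter> {0..1}"
      then have "s * q \<in> {0..s}" using s by (auto intro: mult_left_le)
      then show "1 / real (Suc n) \<le> X j (s * q) \<omega> - X i (s * q) \<omega>" using u(2)[of "s * q"] n by linarith
    qed
  qed
  then show "\<omega> \<in> ?R" using sp by fastforce
next
  fix \<omega> assume \<omega>: "\<omega> \<in> ?R"
  then have sp: "\<omega> \<in> space M" by simp
  have "X i r \<omega> < X j r \<omega>" if "i < j" and r: "0 \<le> r" "r \<le> s" for i j r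
  proof -
    obtain n where n: "\<And>q. q \<in> \<rat> \<inter> {0..1} \<Longrightarrow> 1 / real (Suc n) \<le> X j (s * q) \<omega> - X i (s * q) \<omega>"
      using \<omega> \<open>i < j\<close> by blast
    have "1 / real (Suc n) \<le> X j r \<omega> - X i r \<omega>"
      by (rule rational_times_dense[OF s _ _ r]) (use n in \<open>auto intro!: continuous_intros X_cont_on sp\<close>)
    moreover have "0 < 1 / real (Suc n)" by simp
    ultimately show ?thesis by linarith
  qed
  then show "\<omega> \<in> alive s" using sp X_pos[OF sp] by (simp add: alive_def weyl_chamber_def)
qed

lemma alive_sets:
  assumes s: "0 \<le> s"
  shows "alive s \<in> sets (F s)"
proof -
  have "X i (s * q) \<in> borel_measurable (F s)" if "0 \<le> q" "q \<le> 1" for i q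
  proof -
    have "(\<lambda>\<omega>. Y (s * q) \<omega> $ i) \<in> borel_measurable (F s)"
      using s that by (intro borel_measurable_vec_nth measurable_natural_filtration) (auto intro: mult_left_le)
    then show ?thesis by simp
  qed
  then have 1: "{\<omega> \<in> space (F s). c \<le> X j (s * q) \<omega> - X i (s * q) \<omega>} \<in> sets (F s)" if "q \<in> \<rat> \<inter> {0..1}" for i j q c
    using that by (intro borel_measurable_le borel_measurable_diff) auto
  have "countable (\<rat> \<inter> {0..1 :: real})" by (rule countable_Int1[OF countable_rat])
  moreover have "\<rat> \<inter> {0..1 :: real} \<noteq> {}" using Rats_0 by fastforce
  ultimately have "(\<Inter>q\<in>\<rat> \<inter> {0..1}. {\<omega> \<in> space (F s). c \<le> X j (s * q) \<omega> - X i (s * q) \<omega>}) \<in> sets (F s)" for i j c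
    by (rule sets.countable_INT') (use 1 in auto)
  then have "(\<Union>n. \<Inter>q\<in>\<rat> \<inter> {0..1}. {\<omega> \<in> space (F s). 1 / real (Suc n) \<le> X j (s * q) \<omega> - X i (s * q) \<omega>}) \<in> sets (F s)" for i j
    by (intro sets.countable_UN) auto
  then have "(\<Inter>(i, j)\<in>{(i, j). i < j}. \<Union>n. \<Inter>q\<in>\<rat> \<inter> {0..1}. {\<omega> \<in> space (F s). 1 / real (Suc n) \<le> X j (s * q) \<omega> - X i (s * q) \<omega>}) \<inter> space (F s) \<in> sets (F s)"
    using sets.top[of "F s"]
    by (cases "{(i :: 'n, j). i < j} = {}") (auto intro!: sets.Int sets.finite_INT)
  then show ?thesis unfolding alive_eq[OF s] by simp
qed

lemma alive_sets_M [measurable]: "0 \<le> s \<Longrightarrow> alive s \<in> sets M"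
  by (rule F_sets[OF alive_sets])

text \<open>The particles stay positive, so the chamber is left only through a wrong order of two of
  them, and the intermediate value theorem finds a time at which they meet.\<close>

lemma crossing_collision:
  assumes \<omega>: "\<omega> \<in> alive p - alive q" and p: "0 \<le> p"
  obtains r i j where "p \<le> r" "r \<le> q" "i \<noteq> j" "X i r \<omega> = X j r \<omega>"
proof -
  have sp: "\<omega> \<in> space M" using \<omega> by (simp add: alive_def)
  then obtain u where u: "0 \<le> u" "u \<le> q" "Y u \<omega> \<notin> weyl_chamber" using \<omega> by (auto simp: alive_def)
  then have pu: "p \<le> u" using \<omega> by (force simp: alive_def)
  obtain i j where ij: "i < j" "X j u \<omega> \<le> X i u \<omega>"
    using u X_pos[OF sp u(1)] by (auto simp: weyl_chamber_def not_less)
  have "Y p \<omega> \<in> weyl_chamber" using \<omega> p by (auto simp: alive_def)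
  then have "X i p \<omega> < X j p \<omega>" using ij by (auto simp: weyl_chamber_def)
  moreover have "continuous_on {p..u} (\<lambda>t. X j t \<omega> - X i t \<omega>)"
    by (intro continuous_intros X_cont_on sp p)
  ultimately obtain r where "p \<le> r" "r \<le> u" "X j r \<omega> - X i r \<omega> = 0"
    using IVT2'[of "\<lambda>t. X j t \<omega> - X i t \<omega>" u 0 p] ij pu by auto
  then show ?thesis using that[of r i j] u ij by auto
qed

text \<open>Optional stopping at the first collision: \<open>km_density\<close> vanishes there, and the exit time is approximated
  from above by the points of a uniform grid.\<close>

lemma km_density_stopped:
  assumes s: "0 \<le> s" "s \<le> u" "u < T" and z: "z \<in> positive_orthant" and B: "B \<in> sets (F s)"
  shows "(\<integral>\<omega>. indicator (B \<inter> alive u) \<omega> * km_density \<nu> a (T - u) (Y u \<omega>) z \<partial>M)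
    = (\<integral>\<omega>. indicator (B \<inter> alive s) \<omega> * km_density \<nu> a (T - s) (Y s \<omega>) z \<partial>M)"
proof -
  define R where "R r \<omega> = km_density \<nu> a (T - r) (Y r \<omega>) z" for r \<omega>
  have "0 < T - u" using s by simp
  obtain K where K: "0 \<le> K" "\<And>t y \<sigma>. T - u \<le> t \<Longrightarrow> y \<in> positive_orthant \<Longrightarrow> \<sigma> permutes UNIV \<Longrightarrow> km_term \<nu> a t \<sigma> y z \<le> K"
    "\<And>t y. T - u \<le> t \<Longrightarrow> y \<in> positive_orthant \<Longrightarrow> \<bar>km_density \<nu> a t y z\<bar> \<le> K"
    using km_density_bounded[OF \<open>0 < T - u\<close> z] by blast
  have RK: "\<bar>R r \<omega>\<bar> \<le> K" if "s \<le> r" "r \<le> u" "\<omega> \<in> space M" for r \<omega>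
    unfolding R_def using that s by (intro K(3) Y_orthant) auto
  have R_meas: "R r \<in> borel_measurable M" if "s \<le> r" "r \<le> u" for r
  proof -
    have [measurable]: "Y r \<in> borel_measurable M" using that s by auto
    show ?thesis unfolding R_def[abs_def] by measurable
  qed
  have R_int: "integrable M (\<lambda>\<omega>. indicator C \<omega> * R r \<omega>)" if "s \<le> r" "r \<le> u" "C \<in> sets M" for r C
  proof (rule integrable_const_bound[of _ K])
    show "AE \<omega> in M. norm (indicator C \<omega> * R r \<omega>) \<le> K"
      using AE_space by eventually_elim (use RK[OF that(1,2)] K(1) in \<open>auto simp: indicator_def\<close>)
  qed (use R_meas[OF that(1,2)] that(3) in measurable)
  define t where "t n k = s + (u - s) * (real k / real n)" for n k :: nat
  have t0: "t n 0 = s" and tn: "0 < n \<Longrightarrow> t n n = u" for n by (auto simp: t_def)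
  have t_mono: "t n k \<le> t n l" if "k \<le> l" for n k l
    unfolding t_def using that s by (intro add_left_mono mult_left_mono divide_right_mono) auto
  have t_in: "s \<le> t n k" "k \<le> n \<Longrightarrow> 0 < n \<Longrightarrow> t n k \<le> u" for n k
    using t_mono[of 0 k n] t_mono[of k n n] t0 tn by auto
  have t_nonneg: "0 \<le> t n k" for n k using t_in(1)[of n k] s by linarith
  \<comment> \<open>The paths that leave the chamber within the \<open>k\<close>-th cell of the
    grid.\<close>
  define D where "D n k = alive (t n k) - alive (t n (Suc k))" for n k
  have D_sets: "B \<inter> D n k \<in> sets (F (t n (Suc k)))" if "k < n" for n k
  proof -
    have "sets (F (t n k)) \<subseteq> sets (F (t n (Suc k)))" "sets (F s) \<subseteq> sets (F (t n (Suc k)))"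
      using t_mono t_in by (auto intro!: natural_filtration_mono)
    then show ?thesis
      unfolding D_def using B alive_sets[OF t_nonneg[of n k]] alive_sets[OF t_nonneg[of n "Suc k"]]
      by (intro sets.Int sets.Diff) auto
  qed
  \<comment> \<open>The value of \<open>R\<close> at the first grid point not before the exit,
    restricted to \<open>B\<close>; at most one summand is nonzero.\<close>
  define S where "S n \<omega> = (\<Sum>k<n. indicator (B \<inter> D n k) \<omega> * R (t n (Suc k)) \<omega>)" for n \<omega>
  have alive_u: "alive u \<in> sets M" "alive (t n k) \<in> sets M" "B \<in> sets M" for n k
    using s t_nonneg F_sets[OF B] by (auto intro: alive_sets_M)
  \<comment> \<open>At time \<open>t n (Suc k)\<close> the event \<open>B \<inter> D n k\<close> is
    decided, so the martingale property replaces \<open>R\<close> there by its value at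
    \<open>u\<close>. The events \<open>D n k\<close> are differences of decreasing sets, and the
    sum telescopes.\<close>
  have S_int: "(\<integral>\<omega>. S n \<omega> \<partial>M) = (\<integral>\<omega>. indicator (B \<inter> alive s) \<omega> * R u \<omega> \<partial>M) - (\<integral>\<omega>. indicator (B \<inter> alive u) \<omega> * R u \<omega> \<partial>M)" if n: "0 < n" for n
  proof -
    have "(\<integral>\<omega>. S n \<omega> \<partial>M) = (\<Sum>k<n. \<integral>\<omega>. indicator (B \<inter> D n k) \<omega> * R (t n (Suc k)) \<omega> \<partial>M)"
      unfolding S_def
      using t_in n D_sets F_sets by (intro Bochner_Integration.integral_sum R_int) (auto simp: Suc_le_eq)
    also have "\<dots> = (\<Sum>k<n. (\<integral>\<omega>. indicator (B \<inter> alive (t n k)) \<omega> * R u \<omega> \<partial>M) - (\<integral>\<omega>. indicator (B \<inter> alive (t n (Suc k))) \<omega> * R u \<omega> \<partial>M))"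
    proof (intro sum.cong refl)
      fix k assume "k \<in> {..<n}"
      then have k: "k < n" by simp
      have "(\<integral>\<omega>. indicator (B \<inter> D n k) \<omega> * R (t n (Suc k)) \<omega> \<partial>M) = (\<integral>\<omega>. indicator (B \<inter> D n k) \<omega> * R u \<omega> \<partial>M)"
        unfolding R_def using k n s z t_in(1)[of n "Suc k"] t_in(2)[of "Suc k" n] D_sets[OF k]
        by (intro km_density_martingale[symmetric]) auto
      also have "\<dots> = (\<integral>\<omega>. indicator (B \<inter> alive (t n k)) \<omega> * R u \<omega> - indicator (B \<inter> alive (t n (Suc k))) \<omega> * R u \<omega> \<partial>M)"
        using alive_antimono[OF t_mono[of k "Suc k" n]]
        by (intro Bochner_Integration.integral_cong) (auto simp: D_def indicator_def)
      also have "\<dots> = (\<integral>\<omega>. indicator (B \<inter> alive (t n k)) \<omega> * R u \<omega> \<partial>M) - (\<integral>\<omega>. indicator (B \<inter> alive (t n (Suc k))) \<omega> * R u \<omega> \<partial>M)"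
        using s alive_u by (intro Bochner_Integration.integral_diff R_int) auto
      finally show "(\<integral>\<omega>. indicator (B \<inter> D n k) \<omega> * R (t n (Suc k)) \<omega> \<partial>M) = (\<integral>\<omega>. indicator (B \<inter> alive (t n k)) \<omega> * R u \<omega> \<partial>M) - (\<integral>\<omega>. indicator (B \<inter> alive (t n (Suc k))) \<omega> * R u \<omega> \<partial>M)" .
    qed
    also have "\<dots> = (\<integral>\<omega>. indicator (B \<inter> alive (t n 0)) \<omega> * R u \<omega> \<partial>M) - (\<integral>\<omega>. indicator (B \<inter> alive (t n n)) \<omega> * R u \<omega> \<partial>M)"
      by (rule sum_lessThan_telescope')
    finally show ?thesis using n by (simp add: t0 tn)
  qed
  \<comment> \<open>That only one summand contributes is expressed by a telescoping sum of
    indicators, bounded by 1.\<close>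
  have S_le: "\<bar>S n \<omega>\<bar> \<le> c" if c: "0 \<le> c" "\<And>k. k < n \<Longrightarrow> \<omega> \<in> D n k \<Longrightarrow> \<bar>R (t n (Suc k)) \<omega>\<bar> \<le> c" for n c \<omega>
  proof -
    have "\<bar>S n \<omega>\<bar> \<le> (\<Sum>k<n. \<bar>indicator (B \<inter> D n k) \<omega> * R (t n (Suc k)) \<omega>\<bar>)"
      unfolding S_def by (rule sum_abs)
    also have "\<dots> \<le> (\<Sum>k<n. c * (indicator (alive (t n k)) \<omega> - indicator (alive (t n (Suc k))) \<omega>))"
    proof (rule sum_mono)
      fix k assume "k \<in> {..<n}"
      then show "\<bar>indicator (B \<inter> D n k) \<omega> * R (t n (Suc k)) \<omega>\<bar> \<le> c * (indicator (alive (t n k)) \<omega> - indicator (alive (t n (Suc k))) \<omega>)"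
        using c alive_antimono[OF t_mono[of k "Suc k" n]] by (auto simp: D_def indicator_def)
    qed
    also have "\<dots> = c * (indicator (alive (t n 0)) \<omega> - indicator (alive (t n n)) \<omega>)"
      unfolding sum_distrib_left[symmetric] by (rule arg_cong[OF sum_lessThan_telescope'[where f = "\<lambda>k. indicator (alive (t n k)) \<omega>"]])
    also have "\<dots> \<le> c * 1" using c by (intro mult_left_mono) (auto simp: indicator_def)
    finally show ?thesis by simp
  qed
  \<comment> \<open>\<open>R\<close> is uniformly continuous along the path and zero at the
    collision, which is at most one mesh width away from the grid point used in
    \<open>S\<close>.\<close>
  have lim: "(\<lambda>n. S n \<omega>) \<longlonglongrightarrow> 0" if \<omega>: "\<omega> \<in> space M" for \<omega>
  proof (rule LIMSEQ_I)
    fix e :: real assume e: "0 < e"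
    have "continuous_on {s..u} (\<lambda>r. R r \<omega>)"
      unfolding R_def using s \<omega>
      by (intro continuous_on_km_density continuous_intros continuous_on_subset[OF Y_cont[OF \<omega>]] Y_orthant) auto
    then have "uniformly_continuous_on {s..u} (\<lambda>r. R r \<omega>)"
      by (rule compact_uniformly_continuous) simp
    then obtain d where d: "0 < d" "\<And>r r'. r \<in> {s..u} \<Longrightarrow> r' \<in> {s..u} \<Longrightarrow> dist r' r < d \<Longrightarrow> dist (R r' \<omega>) (R r \<omega>) < e / 2"
      unfolding uniformly_continuous_on_def using e by (metis half_gt_zero)
    obtain n0 where n0: "(u - s) / d < real n0" using reals_Archimedean2 by blast
    show "\<exists>n0. \<forall>n\<ge>n0. norm (S n \<omega> - 0) < e"
    proof (intro exI[of _ "Suc n0"] allI impI)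
      fix n assume n: "Suc n0 \<le> n"
      then have "(u - s) / d < real n" using n0 by linarith
      then have mesh: "(u - s) / real n < d" using d(1) n by (simp add: field_simps)
      have "\<bar>S n \<omega>\<bar> \<le> e / 2"
      proof (rule S_le)
        fix k assume k: "k < n" and "\<omega> \<in> D n k"
        then obtain r i j where r: "t n k \<le> r" "r \<le> t n (Suc k)" "i \<noteq> j" "X i r \<omega> = X j r \<omega>"
          using crossing_collision[of \<omega> "t n k" "t n (Suc k)"] t_in(1)[of n k] s by (auto simp: D_def)
        have "R r \<omega> = 0" unfolding R_def using r by (intro km_density_eq_0[of _ i j]) auto
        moreover have "t n (Suc k) - t n k = (u - s) / real n"
          using n by (simp add: t_def field_simps)
        then have "dist (t n (Suc k)) r < d" using r mesh by (simp add: dist_real_def)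
        moreover have "r \<in> {s..u}" "t n (Suc k) \<in> {s..u}"
          using r k n t_in(1)[of n k] t_in(1)[of n "Suc k"] t_in(2)[of "Suc k" n] by auto
        ultimately have "dist (R (t n (Suc k)) \<omega>) 0 < e / 2" using d(2)[of r "t n (Suc k)"] by simp
        then show "\<bar>R (t n (Suc k)) \<omega>\<bar> \<le> e / 2" by simp
      qed (use e in simp)
      then show "norm (S n \<omega> - 0) < e" using e by simp
    qed
  qed
  have "(\<lambda>n. \<integral>\<omega>. S n \<omega> \<partial>M) \<longlonglongrightarrow> (\<integral>\<omega>. 0 \<partial>M)"
  proof (rule integral_dominated_convergence[where w = "\<lambda>_. K"])
    show "S n \<in> borel_measurable M" for n
    proof (cases "n = 0")
      case False
      then show ?thesis unfolding S_def[abs_def] using t_in D_sets F_sets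
        by (intro borel_measurable_sum borel_measurable_times borel_measurable_indicator R_meas) (auto simp: Suc_le_eq)
    qed (simp add: S_def[abs_def])
    show "AE \<omega> in M. (\<lambda>n. S n \<omega>) \<longlonglongrightarrow> 0" using AE_space by eventually_elim (rule lim)
    show "AE \<omega> in M. norm (S n \<omega>) \<le> K" for n
      using AE_space
    proof eventually_elim
      case (elim \<omega>)
      have "\<bar>S n \<omega>\<bar> \<le> K"
        by (rule S_le[OF K(1) RK]) (use elim t_in(1)[of n] t_in(2)[of _ n] in \<open>auto simp: Suc_le_eq\<close>)
      then show ?case by simp
    qed
  qed auto
  \<comment> \<open>The index is shifted because \<open>S_int\<close> requires a grid with at least
    one cell.\<close>
  then have "(\<lambda>n. \<integral>\<omega>. S (Suc n) \<omega> \<partial>M) \<longlonglongrightarrow> 0" by (subst filterlim_sequentially_Suc) simp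
  then have "(\<lambda>n :: nat. (\<integral>\<omega>. indicator (B \<inter> alive s) \<omega> * R u \<omega> \<partial>M) - (\<integral>\<omega>. indicator (B \<inter> alive u) \<omega> * R u \<omega> \<partial>M)) \<longlonglongrightarrow> 0"
    by (simp add: S_int)
  then have "(\<integral>\<omega>. indicator (B \<inter> alive u) \<omega> * R u \<omega> \<partial>M) = (\<integral>\<omega>. indicator (B \<inter> alive s) \<omega> * R u \<omega> \<partial>M)"
    by (simp add: LIMSEQ_const_iff)
  also have "\<dots> = (\<integral>\<omega>. indicator (B \<inter> alive s) \<omega> * R s \<omega> \<partial>M)"
    unfolding R_def using s z B alive_sets[OF s(1)] by (intro km_density_martingale sets.Int)
  finally show ?thesis by (simp add: R_def)
qed

subsection \<open>The law of the killed process\<close>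

text \<open>On \<open>alive u\<close> the exact law of \<open>Y T\<close> is given by the identity
  term, while by stopping the determinant averaged over \<open>alive u\<close> does not depend on
  \<open>u\<close>. The two differ by the other permutations, which are small uniformly for
  endpoints in the level set as \<open>u\<close> tends to \<open>T\<close>; its finite volume makes
  the integrated error small as well.\<close>

lemma killed_law_level:
  assumes s: "0 \<le> s" "s < T" and m: "0 < m" and B: "B \<in> sets (F s)"
    and f[measurable]: "f \<in> borel_measurable borel" and f_bd: "\<And>z. 0 \<le> f z" "\<And>z. f z \<le> c" and f_supp: "\<And>z. z \<notin> chamber_level m \<Longrightarrow> f z = 0"
  shows "(\<integral>\<omega>. indicator (B \<inter> alive T) \<omega> * f (Y T \<omega>) \<partial>M)
    = (\<integral>z. f z * (\<integral>\<omega>. indicator (B \<inter> alive s) \<omega> * km_density \<nu> a (T - s) (Y s \<omega>) z \<partial>M) \<partial>lborel)"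
proof -
  define \<kappa> where "\<kappa> z = (\<integral>\<omega>. indicator (B \<inter> alive s) \<omega> * km_density \<nu> a (T - s) (Y s \<omega>) z \<partial>M)" for z
  define J where "J u = (\<integral>\<omega>. indicator (B \<inter> alive u) \<omega> * f (Y T \<omega>) \<partial>M)" for u
  have [measurable]: "B \<in> sets M" "Y T \<in> borel_measurable M" "Y s \<in> borel_measurable M" "alive s \<in> sets M"
    using s F_sets[OF B] by auto
  have \<kappa>_meas[measurable]: "\<kappa> \<in> borel_measurable borel"
    unfolding \<kappa>_def by measurable
  have c: "0 \<le> c" using f_bd[of 0] by linarith
  have Kpos: "z \<in> positive_orthant" if "z \<in> chamber_level m" for z
    using that chamber_level_subset[OF m] weyl_chamber_subset by auto
  have "\<exists>\<eta>. (\<eta> \<longlongrightarrow> 0) (at_right 0) \<and> (\<forall>t y z. 0 < t \<longrightarrow> y \<in> weyl_chamber \<longrightarrow> z \<in> chamber_level m \<longrightarrow> km_term \<nu> a t \<sigma> y z \<le> \<eta> t)"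
    if "\<sigma> permutes UNIV" "\<sigma> \<noteq> id" for \<sigma>
    by (rule km_term_off_diagonal_decay[OF that m]) (intro exI conjI allI impI; assumption)
  then obtain \<eta> where \<eta>: "\<And>\<sigma>. \<sigma> permutes UNIV \<Longrightarrow> \<sigma> \<noteq> id \<Longrightarrow> (\<eta> \<sigma> \<longlongrightarrow> 0) (at_right 0)"
    "\<And>\<sigma> t y z. \<sigma> permutes UNIV \<Longrightarrow> \<sigma> \<noteq> id \<Longrightarrow> 0 < t \<Longrightarrow> y \<in> weyl_chamber \<Longrightarrow> z \<in> chamber_level m \<Longrightarrow> km_term \<nu> a t \<sigma> y z \<le> \<eta> \<sigma> t"
    by metis
  define \<epsilon> where "\<epsilon> t = (\<Sum>\<sigma>\<in>{\<sigma>. \<sigma> permutes UNIV} - {id}. \<eta> \<sigma> t)" for t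
  have \<epsilon>_lim: "(\<epsilon> \<longlongrightarrow> 0) (at_right 0)"
    unfolding \<epsilon>_def by (intro tendsto_null_sum \<eta>(1)) auto
  define V where "V = measure lborel (chamber_level m :: (real ^ 'n::{finite,linorder}) set)"
  have key: "\<bar>J u - (\<integral>z. f z * \<kappa> z \<partial>lborel)\<bar> \<le> c * V * \<epsilon> (T - u)" if u: "s \<le> u" "u < T" for u
  proof -
    have u0: "0 \<le> u" using u s by simp
    let ?k = "\<lambda>\<sigma> \<omega> z. km_term \<nu> a (T - u) \<sigma> (Y u \<omega>) z"
    have [measurable]: "Y u \<in> borel_measurable M" "alive u \<in> sets M" using u0 by auto
    define C where "C = B \<inter> alive u"
    have [measurable]: "C \<in> sets M" by (simp add: C_def)
    have CF: "C \<in> sets (F u)"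
      unfolding C_def using B natural_filtration_mono[OF u(1)] alive_sets[OF u0] by auto
    \<comment> \<open>The identity term is the true transition density, so on the support of
      \<open>f\<close> this is the density of the position at time \<open>T\<close> on the event
      \<open>C\<close>.\<close>
    define k where "k z = enn2real (\<integral>\<^sup>+\<omega>. indicator C \<omega> * ennreal (?k id \<omega> z) \<partial>M)" for z
    have [measurable]: "k \<in> borel_measurable borel" unfolding k_def by measurable
    have k0: "0 \<le> k z" for z by (simp add: k_def)
    have k_eq: "k z = (\<integral>\<omega>. indicator C \<omega> * ?k id \<omega> z \<partial>M)" if "z \<in> positive_orthant" for z
      unfolding k_def using that u u0 by (intro integral_km_term_Y[symmetric]) auto
    have k_nn: "(\<integral>\<^sup>+\<omega>. indicator C \<omega> * ennreal (?k id \<omega> z) \<partial>M) = ennreal (k z)" if z: "z \<in> positive_orthant" for z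
    proof -
      have "(\<integral>\<^sup>+\<omega>. ennreal (indicator C \<omega> * ?k id \<omega> z) \<partial>M) = ennreal (\<integral>\<omega>. indicator C \<omega> * ?k id \<omega> z \<partial>M)"
      proof (rule nn_integral_eq_integral)
        show "integrable M (\<lambda>\<omega>. indicator C \<omega> * ?k id \<omega> z)"
          using u u0 z by (intro integrable_km_term_Y permutes_id) auto
        show "AE \<omega> in M. 0 \<le> indicator C \<omega> * ?k id \<omega> z"
          using AE_space by eventually_elim (auto simp: indicator_def intro!: km_term_nonneg Y_orthant u0 z)
      qed
      then show ?thesis by (simp add: k_eq[OF z] ennreal_mult' ennreal_indicator)
    qed
    have nn: "(\<integral>\<^sup>+\<omega>. ennreal (indicator C \<omega> * f (Y T \<omega>)) \<partial>M) = (\<integral>\<^sup>+z. ennreal (f z * k z) \<partial>lborel)"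
    proof -
      interpret P: pair_sigma_finite M "lborel :: (real ^ 'n::{finite,linorder}) measure" ..
      have "(\<integral>\<^sup>+\<omega>. ennreal (indicator C \<omega> * f (Y T \<omega>)) \<partial>M) = (\<integral>\<^sup>+\<omega>. indicator C \<omega> * ennreal (f (Y T \<omega>)) \<partial>M)"
        by (simp add: ennreal_mult' ennreal_indicator)
      also have "\<dots> = (\<integral>\<^sup>+\<omega>. indicator C \<omega> * (\<integral>\<^sup>+z\<in>positive_orthant. ennreal (?k id \<omega> z) * ennreal (f z) \<partial>lborel) \<partial>M)"
        by (rule markov_nn_integral[OF u0 u(2) _ CF]) measurable
      also have "\<dots> = (\<integral>\<^sup>+\<omega>. (\<integral>\<^sup>+z. indicator C \<omega> * (ennreal (?k id \<omega> z) * ennreal (f z) * indicator positive_orthant z) \<partial>lborel) \<partial>M)"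
        by (intro nn_integral_cong nn_integral_cmult[symmetric]) measurable
      also have "\<dots> = (\<integral>\<^sup>+z. (\<integral>\<^sup>+\<omega>. indicator C \<omega> * (ennreal (?k id \<omega> z) * ennreal (f z) * indicator positive_orthant z) \<partial>M) \<partial>lborel)"
        by (rule P.Fubini'[symmetric]) measurable
      also have "\<dots> = (\<integral>\<^sup>+z. ennreal (f z * k z) \<partial>lborel)"
      proof (intro nn_integral_cong)
        fix z :: "real ^ 'n::{finite,linorder}"
        show "(\<integral>\<^sup>+\<omega>. indicator C \<omega> * (ennreal (?k id \<omega> z) * ennreal (f z) * indicator positive_orthant z) \<partial>M) = ennreal (f z * k z)"
        proof (cases "z \<in> positive_orthant")
          case True
          then have "(\<integral>\<^sup>+\<omega>. indicator C \<omega> * (ennreal (?k id \<omega> z) * ennreal (f z) * indicator positive_orthant z) \<partial>M)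
            = (\<integral>\<^sup>+\<omega>. ennreal (f z) * (indicator C \<omega> * ennreal (?k id \<omega> z)) \<partial>M)"
            by (simp add: mult_ac)
          also have "\<dots> = ennreal (f z) * ennreal (k z)"
            unfolding k_nn[OF True, symmetric] by (intro nn_integral_cmult) measurable
          finally show ?thesis using f_bd by (simp add: ennreal_mult')
        next
          case False
          then have "f z = 0" using f_supp[of z] Kpos by blast
          then show ?thesis using False by simp
        qed
      qed
      finally show ?thesis .
    qed
    have J_eq: "J u = (\<integral>z. f z * k z \<partial>lborel)"
    proof -
      have "J u = enn2real (\<integral>\<^sup>+\<omega>. ennreal (indicator C \<omega> * f (Y T \<omega>)) \<partial>M)"
        unfolding J_def C_def[symmetric] using f_bd by (intro integral_eq_nn_integral) auto
      also have "\<dots> = (\<integral>z. f z * k z \<partial>lborel)"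
        unfolding nn using f_bd k0 by (intro integral_eq_nn_integral[symmetric]) auto
      finally show ?thesis .
    qed
    have int_k: "integrable lborel (\<lambda>z. f z * k z)"
    proof (rule integrableI_nonneg)
      have "(\<integral>\<^sup>+\<omega>. ennreal (indicator C \<omega> * f (Y T \<omega>)) \<partial>M) \<le> (\<integral>\<^sup>+\<omega>. ennreal c \<partial>M)"
        using f_bd c by (intro nn_integral_mono ennreal_leI) (auto simp: indicator_def)
      also have "\<dots> < \<infinity>" by (simp add: emeasure_space_1)
      finally show "(\<integral>\<^sup>+z. ennreal (f z * k z) \<partial>lborel) < \<infinity>" unfolding nn .
    qed (use f_bd k0 in auto)
    have diff: "\<bar>f z * (\<kappa> z - k z)\<bar> \<le> c * \<epsilon> (T - u) * indicator (chamber_level m) z" for z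
    proof (cases "z \<in> chamber_level m")
      case True
      note z = Kpos[OF True]
      let ?E = "\<lambda>\<sigma>. \<integral>\<omega>. indicator C \<omega> * ?k \<sigma> \<omega> z \<partial>M"
      have "\<kappa> z = (\<integral>\<omega>. indicator C \<omega> * km_density \<nu> a (T - u) (Y u \<omega>) z \<partial>M)"
        unfolding \<kappa>_def C_def by (rule km_density_stopped[OF s(1) u z B, symmetric])
      also have "\<dots> = (\<integral>\<omega>. (\<Sum>\<sigma> | \<sigma> permutes UNIV. of_int (sign \<sigma>) * (indicator C \<omega> * ?k \<sigma> \<omega> z)) \<partial>M)"
        by (intro Bochner_Integration.integral_cong) (auto simp: km_density_def sum_distrib_left mult_ac)
      also have "\<dots> = (\<Sum>\<sigma> | \<sigma> permutes UNIV. (\<integral>\<omega>. of_int (sign \<sigma>) * (indicator C \<omega> * ?k \<sigma> \<omega> z) \<partial>M))"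
        using u u0 z by (intro Bochner_Integration.integral_sum integrable_mult_right integrable_km_term_Y) auto
      also have "\<dots> = (\<Sum>\<sigma> | \<sigma> permutes UNIV. of_int (sign \<sigma>) * ?E \<sigma>)"
        by simp
      also have "\<dots> = k z + (\<Sum>\<sigma>\<in>{\<sigma>. \<sigma> permutes UNIV} - {id}. of_int (sign \<sigma>) * ?E \<sigma>)"
        by (subst sum.remove[of _ id]) (auto simp: finite_permutations permutes_id k_eq[OF z])
      finally have "\<bar>\<kappa> z - k z\<bar> = \<bar>\<Sum>\<sigma>\<in>{\<sigma>. \<sigma> permutes UNIV} - {id}. of_int (sign \<sigma>) * ?E \<sigma>\<bar>"
        by simp
      also have "\<dots> \<le> (\<Sum>\<sigma>\<in>{\<sigma>. \<sigma> permutes UNIV} - {id}. \<bar>of_int (sign \<sigma>) * ?E \<sigma>\<bar>)"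
        by (rule sum_abs)
      also have "\<dots> \<le> \<epsilon> (T - u)"
        unfolding \<epsilon>_def
      proof (rule sum_mono)
        fix \<sigma> :: "'n \<Rightarrow> 'n" assume "\<sigma> \<in> {\<sigma>. \<sigma> permutes UNIV} - {id}"
        then have \<sigma>: "\<sigma> permutes UNIV" "\<sigma> \<noteq> id" by auto
        have le: "0 \<le> indicator C \<omega> * ?k \<sigma> \<omega> z \<and> indicator C \<omega> * ?k \<sigma> \<omega> z \<le> \<eta> \<sigma> (T - u)" if "\<omega> \<in> C" for \<omega>
        proof -
          have "Y u \<omega> \<in> weyl_chamber" using that u0 by (auto simp: C_def alive_def)
          then show ?thesis using \<eta>(2)[OF \<sigma>, of "T - u" "Y u \<omega>" z] True u that weyl_chamber_subset z
            by (auto intro!: km_term_nonneg)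
        qed
        \<comment> \<open>Any point of the chamber would do: comparing \<open>\<eta>\<close> with a
          nonnegative term there shows that it is nonnegative.\<close>
        have "x \<in> weyl_chamber" by (rule x)
        then have \<eta>0: "0 \<le> \<eta> \<sigma> (T - u)"
          using \<eta>(2)[OF \<sigma>, of "T - u" x z] True u km_term_nonneg[of x z "T - u" \<sigma>] weyl_chamber_subset z by force
        have "0 \<le> ?E \<sigma>"
          using le by (intro Bochner_Integration.integral_nonneg) (auto simp: indicator_def)
        moreover have "?E \<sigma> \<le> (\<integral>\<omega>. \<eta> \<sigma> (T - u) \<partial>M)"
          using u u0 z \<sigma> le \<eta>0 by (intro integral_mono integrable_km_term_Y) (auto simp: indicator_def)
        ultimately show "\<bar>of_int (sign \<sigma>) * ?E \<sigma>\<bar> \<le> \<eta> \<sigma> (T - u)"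
          by (simp add: abs_mult sign_def prob_space)
      qed
      finally have "f z * \<bar>\<kappa> z - k z\<bar> \<le> c * \<epsilon> (T - u)"
        using f_bd[of z] c by (intro mult_mono) auto
      then show ?thesis using True f_bd[of z] by (simp add: abs_mult)
    qed (simp add: f_supp)
    have int_b: "integrable lborel (\<lambda>z :: real ^ 'n::{finite,linorder}. c * \<epsilon> (T - u) * indicator (chamber_level m) z)"
      using emeasure_chamber_level[of m] by (intro integrable_mult_right integrable_real_indicator) auto
    have int_d: "integrable lborel (\<lambda>z. f z * (\<kappa> z - k z))"
      by (rule Bochner_Integration.integrable_bound[OF int_b]) (auto intro!: AE_I2 order_trans[OF diff])
    have "(\<integral>z. f z * \<kappa> z \<partial>lborel) = (\<integral>z. f z * k z + f z * (\<kappa> z - k z) \<partial>lborel)"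
      by (intro Bochner_Integration.integral_cong) (auto simp: algebra_simps)
    also have "\<dots> = J u + (\<integral>z. f z * (\<kappa> z - k z) \<partial>lborel)"
      unfolding J_eq by (intro Bochner_Integration.integral_add int_k int_d)
    finally have "\<bar>J u - (\<integral>z. f z * \<kappa> z \<partial>lborel)\<bar> = \<bar>\<integral>z. f z * (\<kappa> z - k z) \<partial>lborel\<bar>" by simp
    also have "\<dots> \<le> (\<integral>z. \<bar>f z * (\<kappa> z - k z)\<bar> \<partial>lborel)" by (rule integral_abs_bound)
    also have "\<dots> \<le> (\<integral>z. c * \<epsilon> (T - u) * indicator (chamber_level m) z \<partial>(lborel :: (real ^ 'n::{finite,linorder}) measure))"
      by (intro integral_mono integrable_abs int_d int_b diff)
    also have "\<dots> = c * V * \<epsilon> (T - u)" by (simp add: V_def)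
    finally show ?thesis .
  qed
  define u where "u n = T - (T - s) / real (Suc n)" for n
  have u_in: "s \<le> u n" "u n < T" for n
  proof -
    have "(T - s) / real (Suc n) \<le> (T - s) / 1" using s by (intro divide_left_mono) auto
    then show "s \<le> u n" by (simp add: u_def)
    show "u n < T" using s by (simp add: u_def)
  qed
  have u_lim: "(\<lambda>n. T - u n) \<longlonglongrightarrow> 0"
    unfolding u_def using LIMSEQ_Suc[OF lim_const_over_n[of "T - s"]] by simp
  then have "filterlim (\<lambda>n. T - u n) (at_right 0) sequentially"
    using u_in by (intro tendsto_imp_filterlim_at_right) (auto intro!: always_eventually)
  then have "(\<lambda>n. \<epsilon> (T - u n)) \<longlonglongrightarrow> 0" by (rule filterlim_compose[OF \<epsilon>_lim])
  then have "(\<lambda>n. c * V * \<epsilon> (T - u n)) \<longlonglongrightarrow> 0" by (rule tendsto_mult_right_zero)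
  moreover have "norm (J (u n) - (\<integral>z. f z * \<kappa> z \<partial>lborel)) \<le> c * V * \<epsilon> (T - u n)" for n
    using key[OF u_in] by (simp only: real_norm_def)
  ultimately have "(\<lambda>n. J (u n) - (\<integral>z. f z * \<kappa> z \<partial>lborel)) \<longlonglongrightarrow> 0"
    by (rule Lim_null_comparison[OF always_eventually[OF allI], rotated])
  moreover have "(\<lambda>n. J (u n)) \<longlonglongrightarrow> J T"
    unfolding J_def
  proof (rule integral_dominated_convergence[where w = "\<lambda>_. c"])
    show "(\<lambda>\<omega>. indicator (B \<inter> alive T) \<omega> * f (Y T \<omega>)) \<in> borel_measurable M"
      using s by (intro borel_measurable_times borel_measurable_indicator sets.Int alive_sets_M) auto
    show "(\<lambda>\<omega>. indicator (B \<inter> alive (u n)) \<omega> * f (Y T \<omega>)) \<in> borel_measurable M" for n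
      using s u_in[of n] by (intro borel_measurable_times borel_measurable_indicator sets.Int alive_sets_M) auto
    show "AE \<omega> in M. norm (indicator (B \<inter> alive (u n)) \<omega> * f (Y T \<omega>)) \<le> c" for n
      using f_bd c by (auto simp: indicator_def)
    show "AE \<omega> in M. (\<lambda>n. indicator (B \<inter> alive (u n)) \<omega> * f (Y T \<omega>)) \<longlonglongrightarrow> indicator (B \<inter> alive T) \<omega> * f (Y T \<omega>)"
      using AE_space
    proof eventually_elim
      case (elim \<omega>)
      show ?case
      proof (cases "f (Y T \<omega>) = 0 \<or> \<omega> \<in> alive T")
        case True
        then have "indicator (B \<inter> alive (u n)) \<omega> * f (Y T \<omega>) = indicator (B \<inter> alive T) \<omega> * f (Y T \<omega>)" for n
          using alive_antimono[of "u n" T] u_in[of n] by (auto simp: indicator_def)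
        then show ?thesis by (simp only: tendsto_const)
      next
        case False
        then have "Y T \<omega> \<in> weyl_chamber" using f_supp chamber_level_subset[OF m] by blast
        moreover obtain r where r: "0 \<le> r" "r \<le> T" "Y r \<omega> \<notin> weyl_chamber" using False elim by (auto simp: alive_def)
        \<comment> \<open>A path that lies in the chamber at time \<open>T\<close> but was outside
          before had left strictly before \<open>T\<close>, so it drops out of
          \<open>alive (u n)\<close> once \<open>u n\<close> has passed \<open>r\<close>.\<close>
        ultimately have "r < T" by (metis order_le_less)
        then have "\<forall>\<^sub>F n in sequentially. T - u n < T - r" using u_lim by (intro order_tendstoD(2)) auto
        then have "\<forall>\<^sub>F n in sequentially. indicator (B \<inter> alive (u n)) \<omega> * f (Y T \<omega>) = indicator (B \<inter> alive T) \<omega> * f (Y T \<omega>)"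
          by eventually_elim (use r False in \<open>auto simp: indicator_def alive_def\<close>)
        then show ?thesis by (rule tendsto_eventually)
      qed
    qed
  qed auto
  ultimately have "(\<lambda>n. J (u n) - (J (u n) - (\<integral>z. f z * \<kappa> z \<partial>lborel))) \<longlonglongrightarrow> J T - 0"
    by (intro tendsto_diff)
  then have "J T = (\<integral>z. f z * \<kappa> z \<partial>lborel)" by (simp add: LIMSEQ_const_iff)
  then show ?thesis by (simp add: J_def \<kappa>_def)
qed

section \<open>Test functions dominated by harmonic functions\<close>

text \<open>The common dominating function: on the orthant it is above both
  \<open>\<bar>bessel_h\<bar>\<close> and the constant 1, and its mean along the process is finite
  at every time.\<close>

definition ratio_sum :: "real ^ 'n::{finite,linorder} \<Rightarrow> real" where
  "ratio_sum z = (\<Sum>\<pi> | \<pi> permutes UNIV. bessel_ratio \<nu> a \<pi> z)"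

lemma borel_measurable_ratio_sum [measurable]: "ratio_sum \<in> borel_measurable borel"
  unfolding ratio_sum_def[abs_def] by measurable

lemma ratio_sum_nonneg: "z \<in> positive_orthant \<Longrightarrow> 0 \<le> ratio_sum z"
  unfolding ratio_sum_def by (intro sum_nonneg less_imp_le bessel_ratio_pos)

lemma ratio_sum_ge_1: "z \<in> positive_orthant \<Longrightarrow> 1 \<le> ratio_sum z"
proof -
  assume z: "z \<in> positive_orthant"
  have id: "id \<in> {\<pi>. \<pi> permutes (UNIV :: 'n set)}" by (simp only: mem_Collect_eq permutes_id)
  have "bessel_ratio \<nu> a id z \<le> ratio_sum z"
    unfolding ratio_sum_def
    by (rule member_le_sum[OF id]) (use z in \<open>auto intro: less_imp_le bessel_ratio_pos\<close>)
  then show ?thesis using bessel_ratio_id[OF z] by simp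
qed

lemma integrable_ratio_sum_Y: "0 \<le> s \<Longrightarrow> integrable M (\<lambda>\<omega>. ratio_sum (Y s \<omega>))"
  unfolding ratio_sum_def by (intro Bochner_Integration.integrable_sum integrable_bessel_ratio_Y) auto

text \<open>Multiplying out the two sums over permutations leaves integrals that
  \<open>nn_integral_km_term\<close> evaluates exactly.\<close>

lemma nn_integral_km_density_le:
  assumes y: "y \<in> positive_orthant" and t: "0 < t" and [measurable]: "f \<in> borel_measurable borel"
    and f: "\<And>z. z \<in> positive_orthant \<Longrightarrow> \<bar>f z\<bar> \<le> ratio_sum z"
  shows "(\<integral>\<^sup>+z. ennreal \<bar>indicator weyl_chamber z * f z * km_density \<nu> a t y z\<bar> \<partial>lborel)
    \<le> (\<Sum>\<sigma> | \<sigma> permutes UNIV. \<Sum>\<pi> | \<pi> permutes UNIV. ennreal (bessel_ratio \<nu> a (\<pi> \<circ> \<sigma>) y))"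
proof -
  have "(\<integral>\<^sup>+z. ennreal \<bar>indicator weyl_chamber z * f z * km_density \<nu> a t y z\<bar> \<partial>lborel)
    \<le> (\<integral>\<^sup>+z. (\<Sum>\<sigma> | \<sigma> permutes UNIV. \<Sum>\<pi> | \<pi> permutes UNIV. ennreal (km_term \<nu> a t \<sigma> y z * bessel_ratio \<nu> a \<pi> z) * indicator positive_orthant z) \<partial>lborel)"
  proof (rule nn_integral_mono)
    fix z :: "real ^ 'n::{finite,linorder}"
    show "ennreal \<bar>indicator weyl_chamber z * f z * km_density \<nu> a t y z\<bar> \<le> (\<Sum>\<sigma> | \<sigma> permutes UNIV. \<Sum>\<pi> | \<pi> permutes UNIV. ennreal (km_term \<nu> a t \<sigma> y z * bessel_ratio \<nu> a \<pi> z) * indicator positive_orthant z)"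
    proof (cases "z \<in> weyl_chamber")
      case True
      then have z: "z \<in> positive_orthant" using weyl_chamber_subset by auto
      have "\<bar>indicator weyl_chamber z * f z * km_density \<nu> a t y z\<bar> \<le> ratio_sum z * (\<Sum>\<sigma> | \<sigma> permutes UNIV. km_term \<nu> a t \<sigma> y z)"
        using True f[OF z] abs_km_density_le[OF y z, of t] ratio_sum_nonneg[OF z] by (simp add: abs_mult mult_mono)
      also have "\<dots> = (\<Sum>\<sigma> | \<sigma> permutes UNIV. \<Sum>\<pi> | \<pi> permutes UNIV. km_term \<nu> a t \<sigma> y z * bessel_ratio \<nu> a \<pi> z)"
        unfolding ratio_sum_def by (subst mult.commute) (rule sum_product)
      finally have "ennreal \<bar>indicator weyl_chamber z * f z * km_density \<nu> a t y z\<bar> \<le> ennreal (\<Sum>\<sigma> | \<sigma> permutes UNIV. \<Sum>\<pi> | \<pi> permutes UNIV. km_term \<nu> a t \<sigma> y z * bessel_ratio \<nu> a \<pi> z)"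
        by (rule ennreal_leI)
      also have "\<dots> = (\<Sum>\<sigma> | \<sigma> permutes UNIV. \<Sum>\<pi> | \<pi> permutes UNIV. ennreal (km_term \<nu> a t \<sigma> y z * bessel_ratio \<nu> a \<pi> z))"
      proof -
        have "0 \<le> km_term \<nu> a t \<sigma> y z * bessel_ratio \<nu> a \<pi> z" for \<sigma> \<pi>
          by (intro mult_nonneg_nonneg less_imp_le[OF bessel_ratio_pos[OF z]] km_term_nonneg y z)
        then show ?thesis by (simp add: sum_nonneg)
      qed
      finally show ?thesis using z by simp
    qed simp
  qed
  also have "\<dots> = (\<Sum>\<sigma> | \<sigma> permutes UNIV. \<Sum>\<pi> | \<pi> permutes UNIV. (\<integral>\<^sup>+z\<in>positive_orthant. ennreal (km_term \<nu> a t \<sigma> y z * bessel_ratio \<nu> a \<pi> z) \<partial>lborel))"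
    by (subst nn_integral_sum, measurable, intro sum.cong refl nn_integral_sum, measurable)
  also have "\<dots> = (\<Sum>\<sigma> | \<sigma> permutes UNIV. \<Sum>\<pi> | \<pi> permutes UNIV. ennreal (bessel_ratio \<nu> a (\<pi> \<circ> \<sigma>) y))"
    using y t by (intro sum.cong refl nn_integral_km_term) auto
  finally show ?thesis .
qed

lemma integrable_km_density:
  assumes y: "y \<in> positive_orthant" and t: "0 < t" and [measurable]: "f \<in> borel_measurable borel"
    and f: "\<And>z. z \<in> positive_orthant \<Longrightarrow> \<bar>f z\<bar> \<le> ratio_sum z"
  shows "integrable lborel (\<lambda>z. indicator weyl_chamber z * f z * km_density \<nu> a t y z)"
proof (rule integrableI_bounded)
  have "(\<integral>\<^sup>+z. ennreal (norm (indicator weyl_chamber z * f z * km_density \<nu> a t y z)) \<partial>lborel)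
    \<le> (\<Sum>\<sigma> | \<sigma> permutes UNIV. \<Sum>\<pi> | \<pi> permutes UNIV. ennreal (bessel_ratio \<nu> a (\<pi> \<circ> \<sigma>) y))"
    unfolding real_norm_def by (rule nn_integral_km_density_le[OF y t _ f]) auto
  also have "\<dots> < \<infinity>" by (simp add: ennreal_sum_less_top)
  finally show "(\<integral>\<^sup>+z. ennreal (norm (indicator weyl_chamber z * f z * km_density \<nu> a t y z)) \<partial>lborel) < \<infinity>" .
qed measurable

text \<open>Joint integrability for Fubini's theorem. The bound obtained for fixed
  \<open>\<omega>\<close> is again a sum of harmonic functions of \<open>Y s \<omega>\<close>, so
  its mean is its value at \<open>x\<close>.\<close>

lemma integrable_km_density_pair:
  assumes s: "0 \<le> s" and t: "0 < t" and C: "C \<in> sets M" and [measurable]: "f \<in> borel_measurable borel"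
    and f: "\<And>z. z \<in> positive_orthant \<Longrightarrow> \<bar>f z\<bar> \<le> ratio_sum z"
  shows "integrable (M \<Otimes>\<^sub>M lborel) (\<lambda>(\<omega>, z). indicator C \<omega> * (indicator weyl_chamber z * f z * km_density \<nu> a t (Y s \<omega>) z))"
proof (rule integrableI_bounded)
  have [measurable]: "Y s \<in> borel_measurable M" "C \<in> sets M" using s C by auto
  let ?f = "\<lambda>\<omega> z. indicator weyl_chamber z * f z * km_density \<nu> a t (Y s \<omega>) z"
  show meas: "(\<lambda>(\<omega>, z). indicator C \<omega> * ?f \<omega> z) \<in> borel_measurable (M \<Otimes>\<^sub>M lborel)"
    by measurable
  have "(\<integral>\<^sup>+p. ennreal (norm (case p of (\<omega>, z) \<Rightarrow> indicator C \<omega> * ?f \<omega> z)) \<partial>(M \<Otimes>\<^sub>M lborel))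
    = (\<integral>\<^sup>+\<omega>. (\<integral>\<^sup>+z. ennreal \<bar>indicator C \<omega> * ?f \<omega> z\<bar> \<partial>lborel) \<partial>M)"
    by (subst lborel.nn_integral_fst[symmetric]) auto
  also have "\<dots> \<le> (\<integral>\<^sup>+\<omega>. (\<Sum>\<sigma> | \<sigma> permutes UNIV. \<Sum>\<pi> | \<pi> permutes UNIV. ennreal (bessel_ratio \<nu> a (\<pi> \<circ> \<sigma>) (Y s \<omega>))) \<partial>M)"
  proof (rule nn_integral_mono)
    fix \<omega> assume \<omega>: "\<omega> \<in> space M"
    have "(\<integral>\<^sup>+z. ennreal \<bar>indicator C \<omega> * ?f \<omega> z\<bar> \<partial>lborel)
      \<le> (\<integral>\<^sup>+z. ennreal \<bar>indicator weyl_chamber z * f z * km_density \<nu> a t (Y s \<omega>) z\<bar> \<partial>lborel)"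
      by (intro nn_integral_mono ennreal_leI) (auto simp: indicator_def)
    also have "\<dots> \<le> (\<Sum>\<sigma> | \<sigma> permutes UNIV. \<Sum>\<pi> | \<pi> permutes UNIV. ennreal (bessel_ratio \<nu> a (\<pi> \<circ> \<sigma>) (Y s \<omega>)))"
      by (rule nn_integral_km_density_le[OF Y_orthant[OF \<omega> s] t _ f]) auto
    finally show "(\<integral>\<^sup>+z. ennreal \<bar>indicator C \<omega> * ?f \<omega> z\<bar> \<partial>lborel)
      \<le> (\<Sum>\<sigma> | \<sigma> permutes UNIV. \<Sum>\<pi> | \<pi> permutes UNIV. ennreal (bessel_ratio \<nu> a (\<pi> \<circ> \<sigma>) (Y s \<omega>)))" .
  qed
  also have "\<dots> = (\<Sum>\<sigma> | \<sigma> permutes UNIV. \<Sum>\<pi> | \<pi> permutes UNIV. (\<integral>\<^sup>+\<omega>. ennreal (bessel_ratio \<nu> a (\<pi> \<circ> \<sigma>) (Y s \<omega>)) \<partial>M))"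
    by (subst nn_integral_sum, measurable, intro sum.cong refl nn_integral_sum, measurable)
  also have "\<dots> = (\<Sum>\<sigma> | \<sigma> permutes UNIV. \<Sum>\<pi> | \<pi> permutes UNIV. ennreal (bessel_ratio \<nu> a (\<pi> \<circ> \<sigma>) x))"
    using s by (intro sum.cong refl nn_integral_bessel_ratio_Y permutes_compose) auto
  also have "\<dots> < \<infinity>" by (simp add: ennreal_sum_less_top)
  finally show "(\<integral>\<^sup>+p. ennreal (norm (case p of (\<omega>, z) \<Rightarrow> indicator C \<omega> * ?f \<omega> z)) \<partial>(M \<Otimes>\<^sub>M lborel)) < \<infinity>" .
qed

lemma integrable_killed:
  assumes T: "0 \<le> T" and [measurable]: "f \<in> borel_measurable borel" "C \<in> sets M"
    and f: "\<And>z. z \<in> positive_orthant \<Longrightarrow> \<bar>f z\<bar> \<le> ratio_sum z"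
  shows "integrable M (\<lambda>\<omega>. indicator C \<omega> * f (Y T \<omega>))"
proof (rule Bochner_Integration.integrable_bound[OF integrable_ratio_sum_Y[OF T]])
  have [measurable]: "Y T \<in> borel_measurable M" using T by auto
  show "(\<lambda>\<omega>. indicator C \<omega> * f (Y T \<omega>)) \<in> borel_measurable M" by measurable
  show "AE \<omega> in M. norm (indicator C \<omega> * f (Y T \<omega>)) \<le> norm (ratio_sum (Y T \<omega>))"
    using AE_space by eventually_elim (use f[OF Y_orthant[OF _ T]] in \<open>force simp: indicator_def\<close>)
qed

text \<open>The test function is cut off in space and in height at once, so that
  \<open>killed_law_level\<close> applies. On the right-hand side \<open>\<kappa>\<close> may have
  either sign a priori, so the limit is taken by dominated and not by monotone convergence.\<close>

lemma killed_law_nonneg: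
  assumes s: "0 \<le> s" "s < T" and B: "B \<in> sets (F s)" and f[measurable]: "f \<in> borel_measurable borel"
    and f0: "\<And>z. 0 \<le> f z" and fH: "\<And>z. z \<in> positive_orthant \<Longrightarrow> f z \<le> ratio_sum z"
  shows "(\<integral>\<omega>. indicator (B \<inter> alive T) \<omega> * f (Y T \<omega>) \<partial>M)
    = (\<integral>\<omega>. indicator (B \<inter> alive s) \<omega> * (\<integral>z. indicator weyl_chamber z * f z * km_density \<nu> a (T - s) (Y s \<omega>) z \<partial>lborel) \<partial>M)"
proof -
  interpret P: pair_sigma_finite M "lborel :: (real ^ 'n::{finite,linorder}) measure" ..
  have T: "0 \<le> T" using s by simp
  have [measurable]: "B \<in> sets M" "Y T \<in> borel_measurable M" "Y s \<in> borel_measurable M" "alive s \<in> sets M" "alive T \<in> sets M"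
    using s F_sets[OF B] by auto
  define \<kappa> where "\<kappa> z = (\<integral>\<omega>. indicator (B \<inter> alive s) \<omega> * km_density \<nu> a (T - s) (Y s \<omega>) z \<partial>M)" for z
  have [measurable]: "\<kappa> \<in> borel_measurable borel"
    unfolding \<kappa>_def by measurable
  have abs: "\<bar>f z\<bar> \<le> ratio_sum z" if "z \<in> positive_orthant" for z
    using f0[of z] fH[OF that] by simp
  define \<Phi> where "\<Phi> \<omega> z = indicator (B \<inter> alive s) \<omega> * (indicator weyl_chamber z * f z * km_density \<nu> a (T - s) (Y s \<omega>) z)" for \<omega> z
  have pair: "integrable (M \<Otimes>\<^sub>M lborel) (case_prod \<Phi>)"
    unfolding \<Phi>_def using s abs by (intro integrable_km_density_pair) auto
  have inner: "(\<integral>\<omega>. \<Phi> \<omega> z \<partial>M) = indicator weyl_chamber z * f z * \<kappa> z" for z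
  proof -
    have "(\<integral>\<omega>. \<Phi> \<omega> z \<partial>M) = (\<integral>\<omega>. (indicator weyl_chamber z * f z) * (indicator (B \<inter> alive s) \<omega> * km_density \<nu> a (T - s) (Y s \<omega>) z) \<partial>M)"
      unfolding \<Phi>_def by (intro Bochner_Integration.integral_cong) (auto simp: mult_ac)
    then show ?thesis by (simp add: \<kappa>_def)
  qed
  have rhs: "(\<integral>\<omega>. (\<integral>z. \<Phi> \<omega> z \<partial>lborel) \<partial>M) = (\<integral>z. indicator weyl_chamber z * f z * \<kappa> z \<partial>lborel)"
    using P.Fubini_integral[OF pair] by (simp add: inner)
  have int: "integrable lborel (\<lambda>z. indicator weyl_chamber z * f z * \<kappa> z)"
    using P.integrable_snd[OF pair] by (simp add: inner)
  define g where "g m z = (if z \<in> chamber_level (real (Suc m)) \<and> f z \<le> real (Suc m) then f z else 0)" for m z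
  have [measurable]: "g m \<in> borel_measurable borel" for m unfolding g_def by measurable
  have g_eq: "(\<integral>\<omega>. indicator (B \<inter> alive T) \<omega> * g m (Y T \<omega>) \<partial>M) = (\<integral>z. g m z * \<kappa> z \<partial>lborel)" for m
    unfolding \<kappa>_def
    by (rule killed_law_level[OF s _ B, where m = "real (Suc m)" and c = "real (Suc m)"]) (auto simp: g_def f0 simp del: of_nat_Suc)
  have g_le: "0 \<le> g m z" "g m z \<le> f z" for m z by (auto simp: g_def f0)
  have sub: "g m z = 0" if "z \<notin> weyl_chamber" for m z
    using that chamber_level_subset[of "real (Suc m)"] by (auto simp: g_def)
  have g_lim: "(\<lambda>m. g m z) \<longlonglongrightarrow> f z" if z: "z \<in> weyl_chamber" for z
  proof (rule tendsto_eventually)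
    have "\<forall>\<^sub>F m in sequentially. z \<in> chamber_level (real (Suc m))"
      using chamber_level_eventually[OF z] eventually_sequentially_Suc[of "\<lambda>m. z \<in> chamber_level (real m)"] by simp
    moreover have "\<forall>\<^sub>F m in sequentially. f z \<le> real (Suc m)"
      using eventually_compose_filterlim[OF eventually_ge_at_top filterlim_real_sequentially, of "f z"]
      by (subst eventually_sequentially_Suc[of "\<lambda>m. f z \<le> real m"]) simp
    ultimately show "\<forall>\<^sub>F m in sequentially. g m z = f z" by eventually_elim (simp add: g_def)
  qed
  have "(\<lambda>m. \<integral>\<omega>. indicator (B \<inter> alive T) \<omega> * g m (Y T \<omega>) \<partial>M) \<longlonglongrightarrow> (\<integral>\<omega>. indicator (B \<inter> alive T) \<omega> * f (Y T \<omega>) \<partial>M)"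
  proof (rule integral_dominated_convergence[where w = "\<lambda>\<omega>. indicator (space M) \<omega> * f (Y T \<omega>)"])
    show "integrable M (\<lambda>\<omega>. indicator (space M) \<omega> * f (Y T \<omega>))"
      using T abs by (intro integrable_killed) auto
    show "AE \<omega> in M. norm (indicator (B \<inter> alive T) \<omega> * g m (Y T \<omega>)) \<le> indicator (space M) \<omega> * f (Y T \<omega>)" for m
      using AE_space by eventually_elim (use g_le f0 in \<open>auto simp: indicator_def\<close>)
    show "AE \<omega> in M. (\<lambda>m. indicator (B \<inter> alive T) \<omega> * g m (Y T \<omega>)) \<longlonglongrightarrow> indicator (B \<inter> alive T) \<omega> * f (Y T \<omega>)"
    proof (rule AE_I2)
      fix \<omega>
      show "(\<lambda>m. indicator (B \<inter> alive T) \<omega> * g m (Y T \<omega>)) \<longlonglongrightarrow> indicator (B \<inter> alive T) \<omega> * f (Y T \<omega>)"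
        using g_lim[of "Y T \<omega>"] T by (cases "\<omega> \<in> B \<inter> alive T") (auto simp: alive_def)
    qed
  qed measurable
  moreover have "(\<lambda>m. \<integral>z. g m z * \<kappa> z \<partial>lborel) \<longlonglongrightarrow> (\<integral>z. indicator weyl_chamber z * f z * \<kappa> z \<partial>lborel)"
  proof (rule integral_dominated_convergence[where w = "\<lambda>z. \<bar>indicator weyl_chamber z * f z * \<kappa> z\<bar>"])
    show "integrable lborel (\<lambda>z. \<bar>indicator weyl_chamber z * f z * \<kappa> z\<bar>)" by (intro integrable_abs int)
    show "AE z in lborel. norm (g m z * \<kappa> z) \<le> \<bar>indicator weyl_chamber z * f z * \<kappa> z\<bar>" for m
      using g_le sub f0 by (intro AE_I2) (auto simp: indicator_def abs_mult intro!: mult_right_mono)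
    show "AE z in lborel. (\<lambda>m. g m z * \<kappa> z) \<longlonglongrightarrow> indicator weyl_chamber z * f z * \<kappa> z"
    proof (rule AE_I2)
      fix z :: "real ^ 'n::{finite,linorder}"
      show "(\<lambda>m. g m z * \<kappa> z) \<longlonglongrightarrow> indicator weyl_chamber z * f z * \<kappa> z"
        using g_lim[of z] sub[of z] by (cases "z \<in> weyl_chamber") (auto intro!: tendsto_intros)
    qed
  qed measurable
  ultimately have "(\<integral>\<omega>. indicator (B \<inter> alive T) \<omega> * f (Y T \<omega>) \<partial>M) = (\<integral>z. indicator weyl_chamber z * f z * \<kappa> z \<partial>lborel)"
    unfolding g_eq by (rule LIMSEQ_unique)
  also have "\<dots> = (\<integral>\<omega>. (\<integral>z. \<Phi> \<omega> z \<partial>lborel) \<partial>M)" by (rule rhs[symmetric])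
  finally show ?thesis by (simp add: \<Phi>_def)
qed

lemma integrable_km_integral:
  assumes s: "0 \<le> s" "s < T" and C: "C \<in> sets M" and [measurable]: "f \<in> borel_measurable borel"
    and f: "\<And>z. z \<in> positive_orthant \<Longrightarrow> \<bar>f z\<bar> \<le> ratio_sum z"
  shows "integrable M (\<lambda>\<omega>. indicator C \<omega> * (\<integral>z. indicator weyl_chamber z * f z * km_density \<nu> a (T - s) (Y s \<omega>) z \<partial>lborel))"
proof -
  interpret P: pair_sigma_finite M "lborel :: (real ^ 'n::{finite,linorder}) measure" ..
  have "integrable (M \<Otimes>\<^sub>M lborel) (\<lambda>(\<omega>, z). indicator C \<omega> * (indicator weyl_chamber z * f z * km_density \<nu> a (T - s) (Y s \<omega>) z))"
    using s C f by (intro integrable_km_density_pair) auto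
  from P.integrable_fst'[OF this] show ?thesis by simp
qed

text \<open>The signed version is wanted for \<open>bessel_h\<close>, whose sign along the paths is
  not known.\<close>

theorem killed_law:
  assumes s: "0 \<le> s" "s < T" and B: "B \<in> sets (F s)" and f[measurable]: "f \<in> borel_measurable borel"
    and fH: "\<And>z. z \<in> positive_orthant \<Longrightarrow> \<bar>f z\<bar> \<le> ratio_sum z"
  shows "(\<integral>\<omega>. indicator (B \<inter> alive T) \<omega> * f (Y T \<omega>) \<partial>M)
    = (\<integral>\<omega>. indicator (B \<inter> alive s) \<omega> * (\<integral>z. indicator weyl_chamber z * f z * km_density \<nu> a (T - s) (Y s \<omega>) z \<partial>lborel) \<partial>M)"
proof -
  define p n where "p z = max 0 (f z)" and "n z = max 0 (- f z)" for z
  have [measurable]: "p \<in> borel_measurable borel" "n \<in> borel_measurable borel" unfolding p_def n_def by measurable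
  have T: "0 \<le> T" using s by simp
  have [measurable]: "B \<inter> alive s \<in> sets M" "B \<inter> alive T \<in> sets M" using s T F_sets[OF B] by auto
  have p: "0 \<le> p z" "0 \<le> n z" "f z = p z - n z" for z by (auto simp: p_def n_def)
  have H: "p z \<le> ratio_sum z" "n z \<le> ratio_sum z" "\<bar>p z\<bar> \<le> ratio_sum z" "\<bar>n z\<bar> \<le> ratio_sum z" if "z \<in> positive_orthant" for z
    using fH[OF that] by (auto simp: p_def n_def)
  let ?I = "\<lambda>g \<omega>. indicator (B \<inter> alive s) \<omega> * (\<integral>z. indicator weyl_chamber z * g z * km_density \<nu> a (T - s) (Y s \<omega>) z \<partial>lborel)"
  have "(\<integral>\<omega>. indicator (B \<inter> alive T) \<omega> * f (Y T \<omega>) \<partial>M) = (\<integral>\<omega>. indicator (B \<inter> alive T) \<omega> * p (Y T \<omega>) - indicator (B \<inter> alive T) \<omega> * n (Y T \<omega>) \<partial>M)"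
    by (intro Bochner_Integration.integral_cong) (auto simp: p(3) algebra_simps)
  also have "\<dots> = (\<integral>\<omega>. indicator (B \<inter> alive T) \<omega> * p (Y T \<omega>) \<partial>M) - (\<integral>\<omega>. indicator (B \<inter> alive T) \<omega> * n (Y T \<omega>) \<partial>M)"
    using H T by (intro Bochner_Integration.integral_diff integrable_killed) auto
  also have "\<dots> = (\<integral>\<omega>. ?I p \<omega> \<partial>M) - (\<integral>\<omega>. ?I n \<omega> \<partial>M)"
    using H p by (simp add: killed_law_nonneg[OF s B])
  also have "\<dots> = (\<integral>\<omega>. ?I p \<omega> - ?I n \<omega> \<partial>M)"
    using H s by (intro Bochner_Integration.integral_diff[symmetric] integrable_km_integral) auto
  also have "\<dots> = (\<integral>\<omega>. ?I f \<omega> \<partial>M)"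
  proof (intro Bochner_Integration.integral_cong refl)
    fix \<omega> assume \<omega>: "\<omega> \<in> space M"
    have y: "Y s \<omega> \<in> positive_orthant" using Y_orthant[OF \<omega> s(1)] .
    have "(\<integral>z. indicator weyl_chamber z * f z * km_density \<nu> a (T - s) (Y s \<omega>) z \<partial>lborel)
      = (\<integral>z. indicator weyl_chamber z * p z * km_density \<nu> a (T - s) (Y s \<omega>) z - indicator weyl_chamber z * n z * km_density \<nu> a (T - s) (Y s \<omega>) z \<partial>lborel)"
      by (intro Bochner_Integration.integral_cong) (auto simp: p(3) algebra_simps)
    also have "\<dots> = (\<integral>z. indicator weyl_chamber z * p z * km_density \<nu> a (T - s) (Y s \<omega>) z \<partial>lborel) - (\<integral>z. indicator weyl_chamber z * n z * km_density \<nu> a (T - s) (Y s \<omega>) z \<partial>lborel)"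
      using H y s by (intro Bochner_Integration.integral_diff integrable_km_density) auto
    finally show "?I p \<omega> - ?I n \<omega> = ?I f \<omega>" by (simp only: right_diff_distrib)
  qed
  finally show ?thesis .
qed

subsection \<open>The conditioned process\<close>

definition noncolliding :: "'w set" where
  "noncolliding = {\<omega> \<in> space M. \<forall>r\<ge>0. Y r \<omega> \<in> weyl_chamber}"

text \<open>The times are shifted by \<open>s\<close> so that they exceed \<open>s\<close> strictly,
  as \<open>killed_law\<close> requires.\<close>

lemma noncolliding_eq:
  assumes "0 \<le> s"
  shows "noncolliding = (\<Inter>n. alive (s + real (Suc n)))"
proof (intro equalityI subsetI)
  fix \<omega> assume \<omega>: "\<omega> \<in> (\<Inter>n. alive (s + real (Suc n)))"
  have "Y r \<omega> \<in> weyl_chamber" if "0 \<le> r" for r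
  proof -
    obtain n where "r < real n" using reals_Archimedean2 by blast
    then have "r \<le> s + real (Suc n)" using assms by simp
    moreover have "\<omega> \<in> alive (s + real (Suc n))" using \<omega> by blast
    ultimately show ?thesis using that by (simp add: alive_def)
  qed
  moreover have "\<omega> \<in> alive (s + real (Suc 0))" using \<omega> by blast
  ultimately show "\<omega> \<in> noncolliding" by (simp add: noncolliding_def alive_def)
qed (auto simp: noncolliding_def alive_def)

lemma noncolliding_sets [measurable]: "noncolliding \<in> sets M"
  unfolding noncolliding_eq[OF order_refl] by (intro sets.countable_INT) auto

lemma noncolliding_subset: "noncolliding \<subseteq> alive s"
  by (auto simp: noncolliding_def alive_def)

lemma bessel_h_le: "z \<in> positive_orthant \<Longrightarrow> \<bar>bessel_h \<nu> a z\<bar> \<le> ratio_sum z"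
  unfolding ratio_sum_def by (rule abs_bessel_h_le)

lemma bessel_h_nonzero:
  assumes "y \<in> weyl_chamber"
  shows "bessel_h \<nu> a y \<noteq> 0"
proof -
  have "inj a" using a_mono by (metis injI less_irrefl neqE)
  then have "det (\<chi> i j. bessel_series \<nu> (a i * y $ j)) \<noteq> 0"
    using det_bessel_series_nonzero[where a = a, OF \<nu> _ a assms] by blast
  moreover have "bessel_series \<nu> (a i * y $ i) \<noteq> 0" for i
    using bessel_series_orthant_pos[OF subsetD[OF weyl_chamber_subset assms], of i i] by simp
  ultimately show ?thesis by (simp add: bessel_h_eq_det)
qed

text \<open>\<open>killed_law\<close> with the constant 1 gives survival up to \<open>T n\<close>
  through the masses that the \<open>\<sigma>\<close>-terms put into the chamber. Each of them
  converges to the total mass \<open>bessel_ratio\<close>, and \<open>ratio_sum\<close> at time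
  \<open>s\<close> dominates the signed sums.\<close>

theorem survival:
  assumes s: "0 \<le> s" and B: "B \<in> sets (F s)"
  shows "prob (B \<inter> noncolliding) = (\<integral>\<omega>. indicator (B \<inter> alive s) \<omega> * bessel_h \<nu> a (Y s \<omega>) \<partial>M)"
proof -
  have BM: "B \<in> sets M" by (rule F_sets[OF B])
  have [measurable]: "B \<in> sets M" "Y s \<in> borel_measurable M" "alive s \<in> sets M" using s BM by auto
  define T where "T n = s + real (Suc n)" for n
  have T: "0 \<le> T n" "s < T n" for n using s by (auto simp: T_def)
  let ?J = "\<lambda>n \<sigma> \<omega>. \<integral>\<^sup>+z\<in>weyl_chamber. ennreal (km_term \<nu> a (T n - s) \<sigma> (Y s \<omega>) z) \<partial>lborel"
  define G where "G n \<omega> = (\<integral>z. indicator weyl_chamber z * 1 * km_density \<nu> a (T n - s) (Y s \<omega>) z \<partial>lborel)" for n \<omega>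
  have G_meas [measurable]: "G n \<in> borel_measurable M" for n unfolding G_def[abs_def] by measurable
  have P: "prob (B \<inter> alive (T n)) = (\<integral>\<omega>. indicator (B \<inter> alive s) \<omega> * G n \<omega> \<partial>M)" for n
  proof -
    have "prob (B \<inter> alive (T n)) = (\<integral>\<omega>. indicator (B \<inter> alive (T n)) \<omega> * 1 \<partial>M)"
      using BM T by (simp add: alive_sets_M sets.Int Int_absorb2[OF sets.sets_into_space])
    also have "\<dots> = (\<integral>\<omega>. indicator (B \<inter> alive s) \<omega> * G n \<omega> \<partial>M)"
      unfolding G_def using T(2) ratio_sum_ge_1 by (intro killed_law[OF s _ B, where f = "\<lambda>_. 1"]) auto
    finally show ?thesis .
  qed
  have Gs: "G n \<omega> = (\<Sum>\<sigma> | \<sigma> permutes UNIV. of_int (sign \<sigma>) * enn2real (?J n \<sigma> \<omega>))"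
    and Gb: "\<bar>G n \<omega>\<bar> \<le> ratio_sum (Y s \<omega>)" if \<omega>: "\<omega> \<in> space M" for n \<omega>
  proof -
    have y: "Y s \<omega> \<in> positive_orthant" using Y_orthant[OF \<omega> s] .
    have t: "0 < T n - s" using T(2)[of n] by simp
    let ?k = "\<lambda>\<sigma> z. indicator weyl_chamber z * km_term \<nu> a (T n - s) \<sigma> (Y s \<omega>) z"
    have k0: "0 \<le> ?k \<sigma> z" for \<sigma> z
      using km_term_nonneg[OF y, of z] weyl_chamber_subset by (auto simp: indicator_def)
    have nn: "(\<integral>\<^sup>+z. ennreal (?k \<sigma> z) \<partial>lborel) = (?J n \<sigma> \<omega>)" for \<sigma>
      by (intro nn_integral_cong) (auto simp: indicator_def)
    have le: "(?J n \<sigma> \<omega>) \<le> ennreal (bessel_ratio \<nu> a \<sigma> (Y s \<omega>))" if "\<sigma> permutes UNIV" for \<sigma>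
      unfolding nn_integral_km_term_1[OF that y t, symmetric]
      using weyl_chamber_subset by (intro nn_integral_mono) (auto simp: indicator_def)
    have int: "integrable lborel (?k \<sigma>)" if "\<sigma> permutes UNIV" for \<sigma>
    proof (rule integrableI_nonneg)
      show "(\<integral>\<^sup>+z. ennreal (?k \<sigma> z) \<partial>lborel) < \<infinity>"
        unfolding nn using le[OF that] by (rule le_less_trans) simp
    qed (use k0 in auto)
    have ik: "(\<integral>z. ?k \<sigma> z \<partial>lborel) = enn2real (?J n \<sigma> \<omega>)" for \<sigma>
      unfolding nn[symmetric] using k0 by (intro integral_eq_nn_integral) auto
    have "G n \<omega> = (\<integral>z. (\<Sum>\<sigma> | \<sigma> permutes UNIV. of_int (sign \<sigma>) * ?k \<sigma> z) \<partial>lborel)"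
      unfolding G_def by (intro Bochner_Integration.integral_cong) (auto simp: km_density_def sum_distrib_left mult_ac)
    also have "\<dots> = (\<Sum>\<sigma> | \<sigma> permutes UNIV. (\<integral>z. of_int (sign \<sigma>) * ?k \<sigma> z \<partial>lborel))"
      by (intro Bochner_Integration.integral_sum integrable_mult_right int) auto
    also have "\<dots> = (\<Sum>\<sigma> | \<sigma> permutes UNIV. of_int (sign \<sigma>) * enn2real (?J n \<sigma> \<omega>))"
      by (simp only: ik integral_mult_right_zero)
    finally show eq: "G n \<omega> = (\<Sum>\<sigma> | \<sigma> permutes UNIV. of_int (sign \<sigma>) * enn2real (?J n \<sigma> \<omega>))" .
    have "\<bar>of_int (sign \<sigma>) * enn2real (?J n \<sigma> \<omega>)\<bar> \<le> bessel_ratio \<nu> a \<sigma> (Y s \<omega>)" if "\<sigma> permutes UNIV" for \<sigma>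
    proof -
      have "enn2real (?J n \<sigma> \<omega>) \<le> enn2real (ennreal (bessel_ratio \<nu> a \<sigma> (Y s \<omega>)))"
        by (rule enn2real_mono[OF le[OF that]]) simp
      then show ?thesis using bessel_ratio_pos[OF y, of \<sigma>] by (simp add: abs_mult sign_def)
    qed
    then show "\<bar>G n \<omega>\<bar> \<le> ratio_sum (Y s \<omega>)"
      unfolding eq ratio_sum_def by (intro order_trans[OF sum_abs] sum_mono) auto
  qed
  have G_lim: "(\<lambda>n. G n \<omega>) \<longlonglongrightarrow> bessel_h \<nu> a (Y s \<omega>)" if \<omega>: "\<omega> \<in> space M" for \<omega>
  proof -
    have y: "Y s \<omega> \<in> positive_orthant" using Y_orthant[OF \<omega> s] .
    have Ts: "filterlim (\<lambda>n. T n - s) at_top sequentially"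
      unfolding T_def using filterlim_compose[OF filterlim_real_sequentially filterlim_Suc] by simp
    have "(\<lambda>n. enn2real (?J n \<sigma> \<omega>)) \<longlonglongrightarrow> bessel_ratio \<nu> a \<sigma> (Y s \<omega>)"
      if "\<sigma> permutes UNIV" for \<sigma>
    proof -
      have "(\<lambda>n. enn2real (?J n \<sigma> \<omega>)) \<longlonglongrightarrow> enn2real (ennreal (bessel_ratio \<nu> a \<sigma> (Y s \<omega>)))"
        using filterlim_compose[OF km_term_weyl_chamber_limit[OF that y] Ts] by (intro tendsto_enn2real) auto
      then show ?thesis using bessel_ratio_pos[OF y, of \<sigma>] by simp
    qed
    then show ?thesis unfolding bessel_h_def Gs[OF \<omega>] by (intro tendsto_sum tendsto_mult_left) auto
  qed
  have "(\<lambda>n. \<integral>\<omega>. indicator (B \<inter> alive s) \<omega> * G n \<omega> \<partial>M) \<longlonglongrightarrow> (\<integral>\<omega>. indicator (B \<inter> alive s) \<omega> * bessel_h \<nu> a (Y s \<omega>) \<partial>M)"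
  proof (rule integral_dominated_convergence[where w = "\<lambda>\<omega>. ratio_sum (Y s \<omega>)"])
    show "integrable M (\<lambda>\<omega>. ratio_sum (Y s \<omega>))" by (rule integrable_ratio_sum_Y[OF s])
    show "AE \<omega> in M. (\<lambda>n. indicator (B \<inter> alive s) \<omega> * G n \<omega>) \<longlonglongrightarrow> indicator (B \<inter> alive s) \<omega> * bessel_h \<nu> a (Y s \<omega>)"
      using AE_space by eventually_elim (intro tendsto_mult_left G_lim)
    show "AE \<omega> in M. norm (indicator (B \<inter> alive s) \<omega> * G n \<omega>) \<le> ratio_sum (Y s \<omega>)" for n
      using AE_space by eventually_elim (use Gb ratio_sum_nonneg[OF Y_orthant[OF _ s]] in \<open>auto simp: indicator_def\<close>)
  qed measurable
  moreover have "(\<lambda>n. prob (B \<inter> alive (T n))) \<longlonglongrightarrow> prob (\<Inter>n. B \<inter> alive (T n))"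
  proof (rule finite_Lim_measure_decseq)
    show "range (\<lambda>n. B \<inter> alive (T n)) \<subseteq> sets M" using BM T by auto
    show "decseq (\<lambda>n. B \<inter> alive (T n))"
      unfolding decseq_def T_def by (intro allI impI Int_mono order_refl alive_antimono) auto
  qed
  moreover have "(\<Inter>n. B \<inter> alive (T n)) = B \<inter> noncolliding"
    unfolding noncolliding_eq[OF s] T_def by auto
  ultimately show ?thesis unfolding P by (simp add: LIMSEQ_unique)
qed

lemma prob_noncolliding: "prob noncolliding = bessel_h \<nu> a x"
proof -
  have "prob noncolliding = prob (space M \<inter> noncolliding)"
    by (simp add: Int_absorb1[OF sets.sets_into_space])
  also have "\<dots> = (\<integral>\<omega>. indicator (space M \<inter> alive 0) \<omega> * bessel_h \<nu> a (Y 0 \<omega>) \<partial>M)"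
    using sets.top[of "F 0"] by (intro survival) auto
  \<comment> \<open>The start \<open>x\<close> lies in the chamber, so \<open>alive 0\<close> has
    probability 1.\<close>
  also have "\<dots> = (\<integral>\<omega>. bessel_h \<nu> a x \<partial>M)"
  proof (rule integral_cong_AE)
    show "AE \<omega> in M. indicator (space M \<inter> alive 0) \<omega> * bessel_h \<nu> a (Y 0 \<omega>) = bessel_h \<nu> a x"
      using AE_Y_0 AE_space
    proof eventually_elim
      case (elim \<omega>)
      have "Y r \<omega> \<in> weyl_chamber" if "0 \<le> r" "r \<le> 0" for r
        using that elim x by (metis order_antisym)
      then have "\<omega> \<in> alive 0" using elim unfolding alive_def by blast
      then show ?case using elim by simp
    qed
    have [measurable]: "Y 0 \<in> borel_measurable M" "alive 0 \<in> sets M" by auto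
    show "(\<lambda>\<omega>. indicator (space M \<inter> alive 0) \<omega> * bessel_h \<nu> a (Y 0 \<omega>)) \<in> borel_measurable M" by measurable
  qed simp
  finally show ?thesis by (simp add: prob_space)
qed

lemma prob_noncolliding_pos: "0 < prob noncolliding"
  using bessel_h_nonzero[OF x] measure_nonneg[of M noncolliding] by (simp add: prob_noncolliding)

text \<open>Survival is applied at time \<open>t\<close> to the event that also contains the
  position at \<open>t\<close>; then \<open>killed_law\<close> carries the resulting function
  \<open>indicator A z * bessel_h \<nu> a z\<close> back to time \<open>s\<close>.\<close>

theorem joint_law_noncolliding:
  assumes st: "0 \<le> s" "s < t" and A[measurable]: "A \<in> sets borel" and B: "B \<in> sets (F s)"
  shows "prob (B \<inter> (Y t -` A \<inter> space M) \<inter> noncolliding)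
    = (\<integral>\<omega>. indicator (B \<inter> alive s) \<omega> * (\<integral>z. indicator weyl_chamber z * (indicator A z * bessel_h \<nu> a z) * km_density \<nu> a (t - s) (Y s \<omega>) z \<partial>lborel) \<partial>M)"
proof -
  have t: "0 \<le> t" using st by simp
  have "B \<in> sets (F t)" using B natural_filtration_mono[of s t] st by auto
  moreover have "Y t -` A \<inter> space M \<in> sets (F t)"
    using measurable_sets[OF measurable_natural_filtration[OF t order_refl, of Y M] A] by simp
  ultimately have BC: "B \<inter> (Y t -` A \<inter> space M) \<in> sets (F t)" by (rule sets.Int)
  have "prob (B \<inter> (Y t -` A \<inter> space M) \<inter> noncolliding)
    = (\<integral>\<omega>. indicator (B \<inter> (Y t -` A \<inter> space M) \<inter> alive t) \<omega> * bessel_h \<nu> a (Y t \<omega>) \<partial>M)"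
    by (rule survival[OF t BC])
  also have "\<dots> = (\<integral>\<omega>. indicator (B \<inter> alive t) \<omega> * (indicator A (Y t \<omega>) * bessel_h \<nu> a (Y t \<omega>)) \<partial>M)"
    by (intro Bochner_Integration.integral_cong) (auto simp: indicator_def)
  also have "\<dots> = (\<integral>\<omega>. indicator (B \<inter> alive s) \<omega> * (\<integral>z. indicator weyl_chamber z * (indicator A z * bessel_h \<nu> a z) * km_density \<nu> a (t - s) (Y s \<omega>) z \<partial>lborel) \<partial>M)"
  proof (rule killed_law[OF st B])
    show "\<bar>indicator A z * bessel_h \<nu> a z\<bar> \<le> ratio_sum z" if "z \<in> positive_orthant" for z
      using bessel_h_le[OF that] ratio_sum_nonneg[OF that] by (auto simp: indicator_def)
  qed measurable
  finally show ?thesis .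
qed

lemma integral_uniform_noncolliding:
  fixes g :: "'w \<Rightarrow> real"
  assumes [measurable]: "g \<in> borel_measurable M"
  shows "(\<integral>\<omega>. g \<omega> \<partial>uniform_measure M noncolliding) = (\<integral>\<omega>. indicator noncolliding \<omega> * g \<omega> \<partial>M) / prob noncolliding"
proof -
  have "uniform_measure M noncolliding = density M (\<lambda>\<omega>. ennreal (indicator noncolliding \<omega> / prob noncolliding))"
    unfolding uniform_measure_def using prob_noncolliding_pos
    by (intro arg_cong[where f = "density M"]) (auto simp: fun_eq_iff indicator_def emeasure_eq_measure divide_ennreal ennreal_1[symmetric] simp del: ennreal_1)
  then have "(\<integral>\<omega>. g \<omega> \<partial>uniform_measure M noncolliding) = (\<integral>\<omega>. indicator noncolliding \<omega> / prob noncolliding * g \<omega> \<partial>M)"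
    by (simp add: integral_real_density)
  then show ?thesis by simp
qed

text \<open>Bayes' rule: the conditional expectation \<open>V\<close> under the conditioned law satisfies
  \<open>h (Y s) V = E[h (Y t); Y t \<in> A, alive]\<close> on \<open>alive s\<close>, and \<open>h\<close> does not vanish on the chamber.\<close>

lemma conditioned_markov:
  assumes st: "0 \<le> s" "s < t" and A[measurable]: "A \<in> sets borel"
  shows "AE \<omega> in uniform_measure M noncolliding.
    real_cond_exp (uniform_measure M noncolliding) (F s) (\<lambda>\<omega>. indicator A (Y t \<omega>)) \<omega>
    = (\<integral>z. indicator weyl_chamber z * (indicator A z * bessel_h \<nu> a z) * km_density \<nu> a (t - s) (Y s \<omega>) z \<partial>lborel) / bessel_h \<nu> a (Y s \<omega>)"
proof -
  define Q where "Q = uniform_measure M noncolliding"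
  have t: "0 \<le> t" using st by simp
  have [measurable]: "Y t \<in> borel_measurable M" "Y s \<in> borel_measurable M" "alive s \<in> sets M" using st t by auto
  have "prob_space Q"
    unfolding Q_def using prob_noncolliding_pos
    by (intro prob_space_uniform_measure) (auto simp: emeasure_eq_measure)
  then interpret Q: prob_space Q .
  have sets_Q[measurable_cong, simp]: "sets Q = sets M" by (simp add: Q_def)
  have sub_Q: "subalgebra Q (F s)" using F_subalgebra[of s] by (simp add: subalgebra_def Q_def)
  interpret FQ: sigma_finite_subalgebra Q "F s" by (rule Q.sigma_finite_subalgebra_of_subalgebra[OF sub_Q])
  interpret FM: sigma_finite_subalgebra M "F s" by (rule sigma_finite_subalgebra_of_subalgebra[OF F_subalgebra])
  have Ys[measurable]: "Y s \<in> borel_measurable (F s)" using st by (intro measurable_natural_filtration) auto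
  have al[measurable]: "alive s \<in> sets (F s)" by (rule alive_sets[OF st(1)])
  define f where "f \<omega> = (indicator A (Y t \<omega>) :: real)" for \<omega>
  have [measurable]: "f \<in> borel_measurable M" unfolding f_def by measurable
  have f_int: "integrable Q f"
    by (rule Q.integrable_const_bound[of _ 1]) (auto simp: f_def indicator_def)
  \<comment> \<open>Truncation gives a version bounded everywhere. The conditional expectation under
    \<open>Q\<close> is controlled only \<open>Q\<close>-almost everywhere, which says nothing off
    \<open>noncolliding\<close>, whereas integrals under \<open>M\<close> follow.\<close>
  define V where "V \<omega> = max 0 (min 1 (real_cond_exp Q (F s) f \<omega>))" for \<omega>
  have V_meas[measurable]: "V \<in> borel_measurable (F s)" unfolding V_def by measurable
  have [measurable]: "V \<in> borel_measurable M" using F_subalgebra V_meas by (rule measurable_from_subalg)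
  have V01: "0 \<le> V \<omega>" "V \<omega> \<le> 1" for \<omega> by (auto simp: V_def)
  have "AE \<omega> in Q. 0 \<le> real_cond_exp Q (F s) f \<omega>" "AE \<omega> in Q. real_cond_exp Q (F s) f \<omega> \<le> 1"
    by (rule FQ.real_cond_exp_ge_c[OF f_int], simp add: f_def) (rule FQ.real_cond_exp_le_c[OF f_int], simp add: f_def indicator_def)
  then have V_eq: "AE \<omega> in Q. real_cond_exp Q (F s) f \<omega> = V \<omega>"
    by eventually_elim (simp add: V_def)
  define U where "U \<omega> = (\<integral>z. indicator weyl_chamber z * (indicator A z * bessel_h \<nu> a z) * km_density \<nu> a (t - s) (Y s \<omega>) z \<partial>lborel)" for \<omega>
  have [measurable]: "U \<in> borel_measurable (F s)" unfolding U_def by measurable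
  define u v w where "u \<omega> = indicator (alive s) \<omega> * U \<omega>" and "v \<omega> = indicator (alive s) \<omega> * bessel_h \<nu> a (Y s \<omega>) * V \<omega>"
    and "w \<omega> = indicator (alive s) \<omega> * bessel_h \<nu> a (Y s \<omega>)" for \<omega>
  have uvw[measurable]: "u \<in> borel_measurable (F s)" "v \<in> borel_measurable (F s)" "w \<in> borel_measurable (F s)"
    unfolding u_def v_def w_def by measurable
  have uvwM[measurable]: "u \<in> borel_measurable M" "v \<in> borel_measurable M" "w \<in> borel_measurable M"
    by (rule measurable_from_subalg[OF F_subalgebra], rule uvw)+
  have u_int: "integrable M u"
  proof -
    have "\<bar>indicator A z * bessel_h \<nu> a z\<bar> \<le> ratio_sum z" if "z \<in> positive_orthant" for z
      using bessel_h_le[OF that] ratio_sum_nonneg[OF that] by (auto simp: indicator_def)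
    then show ?thesis unfolding u_def[abs_def] U_def using st by (intro integrable_km_integral) auto
  qed
  have w_int: "integrable M w"
    unfolding w_def[abs_def] using bessel_h_le by (intro integrable_killed st(1)) auto
  have v_int: "integrable M v"
    by (rule Bochner_Integration.integrable_bound[OF w_int])
       (use V01 in \<open>auto simp: v_def w_def abs_mult intro!: AE_I2 mult_left_le\<close>)
  have G_int: "integrable M (\<lambda>\<omega>. indicator noncolliding \<omega> :: real)"
    by (intro integrable_real_indicator) (auto simp: emeasure_eq_measure)
  \<comment> \<open>\<open>survival\<close> says precisely that \<open>w\<close> is the conditional
    probability of \<open>noncolliding\<close> given the past under \<open>M\<close>.\<close>
  have cond: "AE \<omega> in M. real_cond_exp M (F s) (indicator noncolliding) \<omega> = w \<omega>"
  proof (rule FM.real_cond_exp_charact[OF _ G_int w_int])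
    fix B assume B: "B \<in> sets (F s)"
    have "(\<integral>\<omega>\<in>B. indicator noncolliding \<omega> \<partial>M) = (\<integral>\<omega>. indicator (B \<inter> noncolliding) \<omega> \<partial>M)"
      unfolding set_lebesgue_integral_def by (intro Bochner_Integration.integral_cong) (auto simp: indicator_def)
    also have "\<dots> = prob (B \<inter> noncolliding)"
      using F_sets[OF B] by (simp add: Int_absorb2[OF sets.sets_into_space])
    also have "\<dots> = (\<integral>\<omega>. indicator (B \<inter> alive s) \<omega> * bessel_h \<nu> a (Y s \<omega>) \<partial>M)"
      by (rule survival[OF st(1) B])
    also have "\<dots> = (\<integral>\<omega>\<in>B. w \<omega> \<partial>M)"
      unfolding set_lebesgue_integral_def w_def by (intro Bochner_Integration.integral_cong) (auto simp: indicator_def)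
    finally show "(\<integral>\<omega>\<in>B. indicator noncolliding \<omega> \<partial>M) = (\<integral>\<omega>\<in>B. w \<omega> \<partial>M)" .
  qed (rule uvw)
  \<comment> \<open>Both sides are the probability that \<open>B\<close>, the event
    \<open>Y t \<in> A\<close> and \<open>noncolliding\<close> occur together: the left one through
    \<open>cond\<close> and the defining property of \<open>V\<close> under \<open>Q\<close>, the
    right one through \<open>joint_law_noncolliding\<close>.\<close>
  have eq: "(\<integral>\<omega>\<in>B. v \<omega> \<partial>M) = (\<integral>\<omega>\<in>B. u \<omega> \<partial>M)" if B: "B \<in> sets (F s)" for B
  proof -
    have BM[measurable]: "B \<in> sets M" by (rule F_sets[OF B])
    have [measurable]: "(\<lambda>\<omega>. indicator B \<omega> * V \<omega>) \<in> borel_measurable (F s)" using B by measurable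
    have int: "integrable M (\<lambda>\<omega>. indicator B \<omega> * V \<omega> * indicator noncolliding \<omega>)"
      by (rule integrable_const_bound[of _ 1]) (use V01 in \<open>auto simp: indicator_def\<close>)
    have "(\<integral>\<omega>\<in>B. v \<omega> \<partial>M) = (\<integral>\<omega>. indicator B \<omega> * V \<omega> * w \<omega> \<partial>M)"
      unfolding set_lebesgue_integral_def v_def w_def by (intro Bochner_Integration.integral_cong) auto
    also have "\<dots> = (\<integral>\<omega>. indicator B \<omega> * V \<omega> * real_cond_exp M (F s) (indicator noncolliding) \<omega> \<partial>M)"
      using cond by (intro integral_cong_AE) auto
    also have "\<dots> = (\<integral>\<omega>. indicator B \<omega> * V \<omega> * indicator noncolliding \<omega> \<partial>M)"
      by (rule FM.real_cond_exp_intg(2)[OF int]) measurable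
    also have "\<dots> = prob noncolliding * (\<integral>\<omega>. indicator B \<omega> * V \<omega> \<partial>Q)"
      unfolding Q_def using prob_noncolliding_pos by (subst integral_uniform_noncolliding) (auto simp: mult_ac)
    also have "(\<integral>\<omega>. indicator B \<omega> * V \<omega> \<partial>Q) = (\<integral>\<omega>. indicator B \<omega> * real_cond_exp Q (F s) f \<omega> \<partial>Q)"
      using V_eq by (intro integral_cong_AE) auto
    also have "\<dots> = (\<integral>\<omega>. indicator B \<omega> * f \<omega> \<partial>Q)"
      using FQ.real_cond_exp_intA[OF f_int B] by (simp add: set_lebesgue_integral_def)
    also have "prob noncolliding * \<dots> = (\<integral>\<omega>. indicator noncolliding \<omega> * (indicator B \<omega> * f \<omega>) \<partial>M)"
      unfolding Q_def using prob_noncolliding_pos by (subst integral_uniform_noncolliding) auto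
    also have "\<dots> = (\<integral>\<omega>. indicator (B \<inter> (Y t -` A \<inter> space M) \<inter> noncolliding) \<omega> \<partial>M)"
      by (intro Bochner_Integration.integral_cong) (auto simp: indicator_def f_def)
    also have "\<dots> = prob (B \<inter> (Y t -` A \<inter> space M) \<inter> noncolliding)"
      by (simp add: Int_absorb2[OF sets.sets_into_space])
    also have "\<dots> = (\<integral>\<omega>. indicator (B \<inter> alive s) \<omega> * U \<omega> \<partial>M)"
      unfolding U_def by (rule joint_law_noncolliding[OF st A B])
    also have "\<dots> = (\<integral>\<omega>\<in>B. u \<omega> \<partial>M)"
      unfolding set_lebesgue_integral_def u_def by (intro Bochner_Integration.integral_cong) (auto simp: indicator_def)
    finally show ?thesis .
  qed
  \<comment> \<open>Both functions are measurable with respect to the past and have equal integrals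
    over past events, so they agree almost surely by uniqueness of the conditional
    expectation.\<close>
  have "AE \<omega> in M. real_cond_exp M (F s) v \<omega> = u \<omega>"
    by (rule FM.real_cond_exp_charact[OF eq v_int u_int uvw(1)])
  moreover have "AE \<omega> in M. real_cond_exp M (F s) v \<omega> = v \<omega>"
    by (rule FM.real_cond_exp_F_meas[OF v_int uvw(2)])
  ultimately have "AE \<omega> in M. \<omega> \<in> noncolliding \<longrightarrow> V \<omega> = U \<omega> / bessel_h \<nu> a (Y s \<omega>)"
  proof eventually_elim
    case (elim \<omega>)
    show ?case
    proof
      assume \<omega>: "\<omega> \<in> noncolliding"
      then have "\<omega> \<in> alive s" "Y s \<omega> \<in> weyl_chamber" using noncolliding_subset st by (auto simp: noncolliding_def)
      then show "V \<omega> = U \<omega> / bessel_h \<nu> a (Y s \<omega>)"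
        using elim bessel_h_nonzero[of "Y s \<omega>"] by (simp add: u_def v_def field_simps)
    qed
  qed
  then have "AE \<omega> in Q. V \<omega> = U \<omega> / bessel_h \<nu> a (Y s \<omega>)"
    unfolding Q_def by (intro AE_uniform_measureI) auto
  with V_eq show ?thesis unfolding Q_def[symmetric] f_def[symmetric] U_def[symmetric] by eventually_elim simp
qed

text \<open>It suffices to know \<open>p\<close> inside the chamber: the endpoint is integrated over
  the chamber, and under the conditioned law \<open>Y s\<close> lies in it almost surely.\<close>

lemma conditioned_process:
  assumes p: "\<And>t y z. 0 < t \<Longrightarrow> y \<in> weyl_chamber \<Longrightarrow> z \<in> weyl_chamber \<Longrightarrow>
      p t y z = bessel_h \<nu> a z / bessel_h \<nu> a y * km_density \<nu> a t y z"
  shows "markov_with_transition_density (uniform_measure M noncolliding) weyl_chamber p x Y"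
  unfolding markov_with_transition_density_def
proof (intro conjI allI impI)
  let ?Q = "uniform_measure M noncolliding"
  show "prob_space ?Q"
    using prob_noncolliding_pos by (intro prob_space_uniform_measure) (auto simp: emeasure_eq_measure)
  show "Y t \<in> borel_measurable ?Q" if "0 \<le> t" for t
    using Y_measurable[OF that] by (simp cong: measurable_cong_sets)
  show "AE \<omega> in ?Q. Y 0 \<omega> = x"
    using AE_Y_0 by (intro AE_uniform_measureI) auto
  fix s t :: real and A assume "0 \<le> s \<and> s < t \<and> A \<in> sets (borel :: (real ^ 'n::{finite,linorder}) measure)"
  then have st: "0 \<le> s" "s < t" and A: "A \<in> sets borel" by auto
  have F: "natural_filtration ?Q Y s = F s" by (simp add: natural_filtration_def)
  have "AE \<omega> in ?Q. \<omega> \<in> noncolliding" by (intro AE_uniform_measureI) auto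
  with conditioned_markov[OF st A]
  show "AE \<omega> in ?Q. real_cond_exp ?Q (natural_filtration ?Q Y s) (\<lambda>\<omega>. indicator A (Y t \<omega>)) \<omega> = (LINT y:A \<inter> weyl_chamber|lborel. p (t - s) (Y s \<omega>) y)"
    unfolding F
  proof eventually_elim
    case (elim \<omega>)
    then have y: "Y s \<omega> \<in> weyl_chamber" using st by (auto simp: noncolliding_def)
    have "(LINT y:A \<inter> weyl_chamber|lborel. p (t - s) (Y s \<omega>) y)
      = (\<integral>z. indicator weyl_chamber z * (indicator A z * bessel_h \<nu> a z) * km_density \<nu> a (t - s) (Y s \<omega>) z / bessel_h \<nu> a (Y s \<omega>) \<partial>lborel)"
      unfolding set_lebesgue_integral_def using st y
      by (intro Bochner_Integration.integral_cong) (auto simp: p indicator_def)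
    then show ?case using elim by simp
  qed
qed

text \<open>Passing from \<open>besq_phi\<close> to the series multiplies both determinants by the
  same power of \<open>2 powr (- \<nu>)\<close>, which cancels in their quotient; the diagonal
  products in \<open>bessel_h\<close> cancel against those of \<open>km_density\<close>.\<close>

lemma conditioned_besq_density_eq:
  assumes t: "0 < t" and y: "y \<in> weyl_chamber" and z: "z \<in> weyl_chamber" and \<mu>: "\<And>i. \<mu> $ i = 4 * a i"
  shows "conditioned_besq_density \<nu> \<mu> t y z = bessel_h \<nu> a z / bessel_h \<nu> a y * km_density \<nu> a t y z"
proof -
  have pos: "0 < y $ i" "0 < z $ i" for i using y z by (auto simp: weyl_chamber_def)
  have \<phi>: "det (\<chi> i j. besq_phi \<nu> (\<mu> $ i / 2) (v $ j)) = (2 powr (- \<nu>)) ^ CARD('n) * det (\<chi> i j. bessel_series \<nu> (a i * v $ j))"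
    if "\<And>i. 0 < v $ i" for v :: "real ^ 'n::{finite,linorder}"
  proof -
    have "(\<chi> i j. besq_phi \<nu> (\<mu> $ i / 2) (v $ j)) = (\<chi> i. 2 powr (- \<nu>) *s (\<chi> j. bessel_series \<nu> (a i * v $ j)))"
      using besq_phi_eq[OF \<nu>] a that by (simp add: vec_eq_iff \<mu>)
    then show ?thesis by (simp add: det_rows_mul)
  qed
  have q: "det (\<chi> i j. besq_q \<nu> t (y $ i) (z $ j)) = det (\<chi> i j. besq_kernel \<nu> t (y $ i) (z $ j))"
    using besq_q_eq[OF \<nu> t pos(1) pos(2)] by simp
  have e: "exp (- (1 / 2) * (\<Sum>i\<in>UNIV. \<mu> $ i * t)) = (\<Prod>i\<in>UNIV. exp (- 2 * a i * t))"
    by (simp add: \<mu> exp_sum[symmetric] sum_negf sum_distrib_left mult_ac)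
  have "bessel_series \<nu> (a i * y $ j) \<noteq> 0" "bessel_series \<nu> (a i * z $ j) \<noteq> 0" for i j
    using bessel_series_orthant_pos[OF subsetD[OF weyl_chamber_subset y], of i j]
      bessel_series_orthant_pos[OF subsetD[OF weyl_chamber_subset z], of i j] by simp_all
  then have ne: "(\<Prod>i\<in>UNIV. bessel_series \<nu> (a i * y $ i)) \<noteq> 0" "(\<Prod>i\<in>UNIV. bessel_series \<nu> (a i * z $ i)) \<noteq> 0"
    by (simp_all add: prod_zero_iff)
  show ?thesis
    unfolding conditioned_besq_density_def \<phi>[OF pos(1)] \<phi>[OF pos(2)] q e bessel_h_eq_det km_density_eq_det prod.distrib prod_dividef
    using ne by simp
qed

end

theorem theorem1p4:
  fixes M :: "'w measure"
    and X :: "'n::{finite,linorder} \<Rightarrow> real \<Rightarrow> 'w \<Rightarrow> real"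
    and x \<mu> :: "real ^ 'n::{finite,linorder}"
    and \<delta> \<nu> :: real
    and Y :: "real \<Rightarrow> 'w \<Rightarrow> real ^ 'n::{finite,linorder}"
    and noncoll :: "'w set"
  assumes "x \<in> weyl_chamber" and "\<mu> \<in> weyl_chamber" and "\<delta> \<ge> 2"
    and "\<nu> = \<delta> / 2 - 1"
    and "prob_space M"
    and "\<And>i. besq_diffusion M (\<mu> $ i / 2) \<delta> (x $ i) (X i)"
    and "independent_processes M X"
    and "Y = (\<lambda>t \<omega>. \<chi> i. X i t \<omega>)"
    and "noncoll = {\<omega> \<in> space M. exit_time weyl_chamber Y \<omega> = \<infinity>}"
  shows "0 < measure M noncoll \<and>
    markov_with_transition_density (uniform_measure M noncoll) weyl_chamber
      (conditioned_besq_density \<nu> \<mu>) x Y"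
proof -
  \<comment> \<open>The diffusion parameter \<open>\<mu> $ i / 2\<close> must equal
    \<open>2 * a i\<close>, the eigenvalue of the series with weight \<open>a i\<close>.\<close>
  define a where "a i = \<mu> $ i / 4" for i
  interpret prob_space M by fact
  interpret P: besq_particles M \<nu> a X x
  proof unfold_locales
    show "0 \<le> \<nu>" using assms(3,4) by simp
    show "0 < a i" for i using assms(2) by (simp add: a_def weyl_chamber_def)
    show "a i < a j" if "i < j" for i j using assms(2) that by (simp add: a_def weyl_chamber_def)
    have "2 * \<nu> + 2 = \<delta>" using assms(4) by simp
    then show "besq_diffusion M (2 * a i) (2 * \<nu> + 2) (x $ i) (X i)" for i
      using assms(6)[of i] by (simp add: a_def)
  qed (use assms in auto)
  have Y: "P.Y = Y" unfolding P.Y_def[abs_def] assms(8) ..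
  have "exit_time weyl_chamber Y \<omega> = \<infinity> \<longleftrightarrow> (\<forall>t\<ge>0. Y t \<omega> \<in> weyl_chamber)" for \<omega>
  proof
    assume "exit_time weyl_chamber Y \<omega> = \<infinity>"
    then have "\<infinity> \<le> ereal t" if "0 \<le> t" "Y t \<omega> \<notin> weyl_chamber" for t
      unfolding exit_time_def using that INF_lower[of t "{t. 0 \<le> t \<and> Y t \<omega> \<notin> weyl_chamber}" ereal] by auto
    then show "\<forall>t\<ge>0. Y t \<omega> \<in> weyl_chamber" by force
  next
    assume "\<forall>t\<ge>0. Y t \<omega> \<in> weyl_chamber"
    \<comment> \<open>The exit time is then an infimum over the empty set, which is infinite by
      convention.\<close>
    then have e: "{t. 0 \<le> t \<and> Y t \<omega> \<notin> weyl_chamber} = {}" by auto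
    show "exit_time weyl_chamber Y \<omega> = \<infinity>" unfolding exit_time_def e by (simp add: top_ereal_def)
  qed
  then have nc: "noncoll = P.noncolliding"
    unfolding assms(9) P.noncolliding_def Y by simp
  have "markov_with_transition_density (uniform_measure M noncoll) weyl_chamber (conditioned_besq_density \<nu> \<mu>) x Y"
    unfolding nc Y[symmetric]
    by (rule P.conditioned_process, rule P.conditioned_besq_density_eq) (auto simp: a_def)
  then show ?thesis using P.prob_noncolliding_pos by (simp add: nc)
qed

end
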